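(* Let $d\in\{2,3\}$, let $\Omega\subset\mathbb{R}^d$ be a bounded connected open polyhedral domain with Lipschitz boundary $\Gamma$, let $f\in L^2(\Omega;\mathbb{R}^d)$, $\gamma>0$, let $k\ge1$ be an integer, let $\sigma:\Omega\times\mathbb{R}^{d\times d}_{\rm sym}\to\mathbb{R}^{d\times d}_{\rm sym}$ satisfy Assumption (S) of the context, and let $\mathcal{T}_h$ be a mesh belonging to a regular mesh sequence of $\Omega$. Denote by $\underline{u}_h\in\underline{U}_{h,0}^k$ a solution of the discrete problem $$\int_\Omega\sigma(\cdot,G_{{\rm s},h}^k\underline{u}_h):G_{{\rm s},h}^k\underline{v}_h+s_h(\underline{u}_h,\underline{v}_h)=\int_\Omega f\cdot v_h\qquad\forall\,\underline{v}_h\in\underline{U}_{h,0}^k,$$ and, for all $T\in\mathcal{T}_h$ and all $F\in\mathcal{F}_T$, define the numerical traction $$T_{TF}(\underline{u}_T)=-\pi_T^k\sigma(\cdot,G_{{\rm s},T}^k\underline{u}_T)\,n_{TF}+R_{TF}^k\underline{u}_T .$$ Then, for all $T\in\mathcal{T}_h$ we have the following discrete principle of virtual work: for all $v_T\in\mathbb{P}^k(T;\mathbb{R}^d)$, $$\int_T\sigma(\cdot,G_{{\rm s},T}^k\underline{u}_T):\nabla_{\rm s}v_T+\sum_{F\in\mathcal{F}_T}\int_FT_{TF}(\underline{u}_T)\cdot v_T=\int_Tf\cdot v_T,$$ and, for any interface $F\in\mathcal{F}_{T_1}\cap\mathcal{F}_{T_2}$ (with $T_1\ne T_2$), the numerical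 tractions satisfy the law of action and reaction: $$T_{T_1F}(\underline{u}_{T_1})+T_{T_2F}(\underline{u}_{T_2})=0 .$$
   Context: **Assumption (S).** $\sigma(x,\cdot)$ is continuous on $\mathbb{R}^{d\times d}_{\rm sym}$ for a.e. $x\in\Omega$; $\sigma(\cdot,\tau)$ is measurable on $\Omega$ for all $\tau\in\mathbb{R}^{d\times d}_{\rm sym}$; $\sigma(\cdot,0)\in L^2(\Omega;\mathbb{R}^{d\times d})$; and there exist $\overline\sigma,\underline\sigma\in(0,+\infty)$ such that for a.e. $x\in\Omega$ and all $\tau,\eta\in\mathbb{R}^{d\times d}_{\rm sym}$: (growth) $\|\sigma(x,\tau)-\sigma(x,0)\|_{d\times d}\le\overline\sigma\|\tau\|_{d\times d}$; (coercivity) $\sigma(x,\tau):\tau\ge\underline\sigma\|\tau\|_{d\times d}^2$; (monotonicity) $(\sigma(x,\tau)-\sigma(x,\eta)):(\tau-\eta)\ge0$. Here $\tau:\eta=\sum_{i,j}\tau_{i,j}\eta_{i,j}$ and $\|\tau\|_{d\times d}^2=\tau:\tau$. **Regular mesh sequence.** $\mathcal{H}\subset(0,+\infty)$ is a countable set having $0$ as its unique accumulation point. For each $h\in\mathcal{H}$, $\mathcal{T}_h$ is a finite collection of nonempty disjoint open connected polyhedral (polygonal if $d=2$) elements $T$ with $\overline\Omega=\bigcup_{T\in\mathcal{T}_h}\overline T$ and $h=\max_{T}h_T$, $h_T$ the diameter of $T$. $\mathcal{F}_h$ is a finite set of faces with disjoint interiors with $\bigcup_{F\in\mathcal{F}_h}F=\bigcup_{T\in\mathcal{T}_h}\partial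 T$; a face is a hyperplanar closed connected subset of $\overline\Omega$ of positive $(d-1)$-dimensional Hausdorff measure such that either there are distinct $T_1,T_2\in\mathcal{T}_h$ with $F\subset\partial T_1\cap\partial T_2$ (interface, $F\in\mathcal{F}_h^{\rm i}$) or there is $T\in\mathcal{T}_h$ with $F\subset\partial T\cap\Gamma$ (boundary face, $F\in\mathcal{F}_h^{\rm b}$). $h_F$ is the diameter of $F$, $\mathcal{F}_T=\{F\in\mathcal{F}_h: F\subset\partial T\}$, and $n_{TF}$ is the unit normal to $F\in\mathcal{F}_T$ pointing out of $T$. Regularity: each $\mathcal{T}_h$ admits a matching simplicial submesh $\mathfrak{T}_h$ (a conforming simplicial mesh of $\Omega$ each simplex of which is contained in exactly one element of $\mathcal{T}_h$ and each simplicial face of which that lies on the mesh skeleton is contained in exactly one face of $\mathcal{F}_h$), and there is $\varrho>0$ such that for all $h\in\mathcal{H}$: $\varrho h_S\le r_S$ for every $S\in\mathfrak{T}_h$ of diameter $h_S$ and inradius $r_S$, and $\varrho h_T\le h_S$ whenever $S\subset T$, $S\in\mathfrak{T}_h$, $T\in\mathcal{T}_h$. **Polynomials and projectors.** For $X$ an element or face, $\mathbb{P}^l(X;V)$ is the space of restrictions to $X$ of $V$-valued $d$-variate polynomials of total degree at most $l$; $\pi_X^l$ is the $L^2$-orthogonal projector onto it, acting componentwise. **Discrete unknowns.** $\underline{U}_h^k=\big(\prod_{T\in\mathcal{T}_h}\mathbb{P}^k(T;\mathbb{R}^d)\big)\times\big(\prod_{F\in\mathcal{F}_h}\mathbb{P}^k(F;\mathbb{R}^d)\big)$,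 with elements $\underline{v}_h=((v_T)_T,(v_F)_F)$; $v_h$ (not underlined) is the broken polynomial with $(v_h)_{|T}=v_T$. Restrictions to $T$: $\underline{U}_T^k$, $\underline{v}_T=(v_T,(v_F)_{F\in\mathcal{F}_T})$. $\underline{U}_{h,0}^k=\{\underline{v}_h\in\underline{U}_h^k: v_F=0\ \forall F\in\mathcal{F}_h^{\rm b}\}$. **Reconstructions.** $\nabla_{\rm s}$ is the symmetric gradient. $G_{{\rm s},T}^k:\underline{U}_T^k\to\mathbb{P}^k(T;\mathbb{R}^{d\times d}_{\rm sym})$ is defined by $$\int_TG_{{\rm s},T}^k\underline{v}_T:\tau=-\int_Tv_T\cdot(\nabla\cdot\tau)+\sum_{F\in\mathcal{F}_T}\int_Fv_F\cdot(\tau n_{TF})\quad\forall\tau\in\mathbb{P}^k(T;\mathbb{R}^{d\times d}_{\rm sym}),$$ and $(G_{{\rm s},h}^k\underline{v}_h)_{|T}=G_{{\rm s},T}^k\underline{v}_T$. $r_T^{k+1}:\underline{U}_T^k\to\mathbb{P}^{k+1}(T;\mathbb{R}^d)$ is defined by $\int_T(\nabla_{\rm s}r_T^{k+1}\underline{v}_T-G_{{\rm s},T}^k\underline{v}_T):\nabla_{\rm s}w=0$ for all $w\in\mathbb{P}^{k+1}(T;\mathbb{R}^d)$, $\int_Tr_T^{k+1}\underline{v}_T=\int_Tv_T$, and $\int_T\nabla_{\rm ss}r_T^{k+1}\underline{v}_T=\sum_{F\in\mathcal{F}_T}\int_F\frac12(n_{TF}\otimes v_F-v_F\otimes n_{TF})$,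 where $(\nabla_{\rm ss}w)_{ij}=\frac12(\partial_iw_j-\partial_jw_i)$. **Stabilization.** For $F\in\mathcal{F}_T$, $\Delta_{TF}^k\underline{v}_T=\pi_F^k(r_T^{k+1}\underline{v}_T-v_F)-\pi_T^k(r_T^{k+1}\underline{v}_T-v_T)$ (as a function on $F$); $s_T(\underline{u}_T,\underline{v}_T)=\sum_{F\in\mathcal{F}_T}\frac{\gamma}{h_F}\int_F\Delta_{TF}^k\underline{u}_T\cdot\Delta_{TF}^k\underline{v}_T$; $s_h(\underline{u}_h,\underline{v}_h)=\sum_{T\in\mathcal{T}_h}s_T(\underline{u}_T,\underline{v}_T)$. **Boundary residual.** $\underline{D}_{\partial T}^k=\prod_{F\in\mathcal{F}_T}\mathbb{P}^k(F;\mathbb{R}^d)$; $\underline{\delta}_{\partial T}^k\underline{v}_T=(v_F-v_T)_{F\in\mathcal{F}_T}\in\underline{D}_{\partial T}^k$. The boundary residual operator $\underline{v}_T\mapsto(R_{TF}^k\underline{v}_T)_{F\in\mathcal{F}_T}\in\underline{D}_{\partial T}^k$ is the unique one such that $$-\sum_{F\in\mathcal{F}_T}\int_FR_{TF}^k\underline{v}_T\cdot\alpha_F=s_T\big((0,\underline{\delta}_{\partial T}^k\underline{v}_T),(0,\underline{\alpha}_{\partial T})\big)\quad\forall\,\underline{\alpha}_{\partial T}=(\alpha_F)_{F\in\mathcal{F}_T}\in\underline{D}_{\partial T}^k .$$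
   Formalization: Each face is also assumed polygonal (a finite union of polytopes), with a constant unit normal pointing out of each adjacent element almost everywhere; otherwise coplanar faces with disjoint interiors can overlap in positive measure and the identity fails. *)

theory Defs
  imports "HOL-Analysis.Analysis"
begin

section \<open>Polyhedral Lipschitz domains\<close>

definition polyhedral_set :: "'a::euclidean_space set \<Rightarrow> bool" where
  "polyhedral_set S \<longleftrightarrow> (\<exists>P. finite P \<and> (\<forall>p\<in>P. polytope p) \<and> S = \<Union>P)"

text \<open>Near every boundary point the set is the strict subgraph of a Lipschitz function over the
  hyperplane orthogonal to some unit vector \<open>e\<close>.\<close>

definition lipschitz_boundary :: "'a::euclidean_space set \<Rightarrow> bool" where
  "lipschitz_boundary \<Omega> \<longleftrightarrow>
     (\<forall>x\<in>frontier \<Omega>. \<exists>r>0. \<exists>e g L. norm e = 1 \<and> L-lipschitz_on {y. e \<bullet> y = 0} g \<and>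
        \<Omega> \<inter> ball x r = {y \<in> ball x r. e \<bullet> y < g (y - (e \<bullet> y) *\<^sub>R e)})"

definition polyhedral_lipschitz_domain :: "'a::euclidean_space set \<Rightarrow> bool" where
  "polyhedral_lipschitz_domain \<Omega> \<longleftrightarrow>
     \<Omega> \<noteq> {} \<and> open \<Omega> \<and> connected \<Omega> \<and> bounded \<Omega> \<and> polyhedral_set (closure \<Omega>) \<and> lipschitz_boundary \<Omega>"


section \<open>Surface measure of hyperplanar sets\<close>

text \<open>Lebesgue measure (equivalently, the normalised Hausdorff measure of codimension one) on the
  hyperplane \<open>{x. n \<bullet> x = c}\<close> with unit normal \<open>n\<close>: the measure of \<open>A\<close> is the volume of the right
  prism of height one \<open>{x + t *\<^sub>R n | x \<in> A, 0 \<le> t \<le> 1}\<close>.\<close>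

definition hyperplane_measure :: "'a::euclidean_space \<Rightarrow> real \<Rightarrow> 'a measure" where
  "hyperplane_measure n c =
     distr (restrict_space lborel {x. c \<le> n \<bullet> x \<and> n \<bullet> x \<le> c + 1}) borel
       (\<lambda>x. x - (n \<bullet> x - c) *\<^sub>R n)"

definition unit_normal :: "'a::euclidean_space set \<Rightarrow> 'a \<Rightarrow> bool" where
  "unit_normal F n \<longleftrightarrow> norm n = 1 \<and> (\<forall>x\<in>F. \<forall>y\<in>F. n \<bullet> x = n \<bullet> y)"

text \<open>The choice of the unit normal is irrelevant: a hyperplanar set of positive surface measure has
  exactly two unit normals \<open>n\<close> and \<open>- n\<close>, which yield the same measure, and a set contained in two
  distinct hyperplanes is a null set for either choice.\<close>

definition surface_measure :: "'a::euclidean_space set \<Rightarrow> 'a measure" where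
  "surface_measure F =
     (let n = (SOME n. unit_normal F n); c = n \<bullet> (SOME x. x \<in> F)
      in restrict_space (hyperplane_measure n c) F)"

definition outward_normal :: "'a::euclidean_space set \<Rightarrow> 'a set \<Rightarrow> 'a \<Rightarrow> bool" where
  "outward_normal T F n \<longleftrightarrow> unit_normal F n \<and>
     (AE x in surface_measure F. \<exists>\<epsilon>>0. \<forall>t. 0 < t \<and> t < \<epsilon> \<longrightarrow> x - t *\<^sub>R n \<in> T \<and> x + t *\<^sub>R n \<notin> T)"

definition normal :: "'a::euclidean_space set \<Rightarrow> 'a set \<Rightarrow> 'a" where
  "normal T F = (THE n. outward_normal T F n)"


section \<open>Regular mesh sequences\<close>

definition mesh_faces :: "'a::euclidean_space set set \<Rightarrow> 'a set \<Rightarrow> 'a set set" where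
  "mesh_faces \<F> T = {F \<in> \<F>. F \<subseteq> frontier T}"

definition is_interface :: "'a::euclidean_space set set \<Rightarrow> 'a set \<Rightarrow> bool" where
  "is_interface \<T> F \<longleftrightarrow> (\<exists>T1\<in>\<T>. \<exists>T2\<in>\<T>. T1 \<noteq> T2 \<and> F \<subseteq> frontier T1 \<inter> frontier T2)"

definition is_boundary_face :: "'a::euclidean_space set \<Rightarrow> 'a set set \<Rightarrow> 'a set \<Rightarrow> bool" where
  "is_boundary_face \<Omega> \<T> F \<longleftrightarrow> (\<exists>T\<in>\<T>. F \<subseteq> frontier T \<inter> frontier \<Omega>)"

text \<open>As a face of a polyhedral element, a face is itself polyhedral (a segment for \<open>d = 2\<close>, where
  this is automatic, and a planar polygonal region for \<open>d = 3\<close>); so the overlap of two faces with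
  disjoint relative interiors is a null set.\<close>

definition mesh_face :: "'a::euclidean_space set \<Rightarrow> 'a set set \<Rightarrow> 'a set \<Rightarrow> bool" where
  "mesh_face \<Omega> \<T> F \<longleftrightarrow>
     closed F \<and> connected F \<and> F \<subseteq> closure \<Omega> \<and> polyhedral_set F \<and>
     (\<exists>n. unit_normal F n) \<and> 0 < emeasure (surface_measure F) F \<and>
     (is_interface \<T> F \<or> is_boundary_face \<Omega> \<T> F)"

text \<open>The last conjunct says that the constant unit normal to a face pointing out of an element is
  meaningful, i.e. that the element lies on the same side of the face at almost all of its points.\<close>

definition polyhedral_mesh :: "'a::euclidean_space set \<Rightarrow> 'a set set \<Rightarrow> 'a set set \<Rightarrow> bool" where
  "polyhedral_mesh \<Omega> \<T> \<F> \<longleftrightarrow>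
     finite \<T> \<and>
     (\<forall>T\<in>\<T>. T \<noteq> {} \<and> open T \<and> connected T \<and> polyhedral_set (closure T)) \<and>
     (\<forall>T\<in>\<T>. \<forall>T'\<in>\<T>. T \<noteq> T' \<longrightarrow> T \<inter> T' = {}) \<and>
     closure \<Omega> = (\<Union>T\<in>\<T>. closure T) \<and>
     finite \<F> \<and>
     (\<forall>F\<in>\<F>. mesh_face \<Omega> \<T> F) \<and>
     (\<forall>F\<in>\<F>. \<forall>F'\<in>\<F>. F \<noteq> F' \<longrightarrow> rel_interior F \<inter> rel_interior F' = {}) \<and>
     \<Union>\<F> = (\<Union>T\<in>\<T>. frontier T) \<and>
     (\<forall>T\<in>\<T>. \<forall>F\<in>mesh_faces \<F> T. \<exists>n. outward_normal T F n)"

definition inradius :: "'a::euclidean_space set \<Rightarrow> real" where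
  "inradius S = Sup {r. 0 < r \<and> (\<exists>x. ball x r \<subseteq> S)}"

text \<open>Simplices are closed here; the open mesh cells of the submesh are their interiors.\<close>

definition matching_simplicial_submesh ::
    "'a::euclidean_space set \<Rightarrow> 'a set set \<Rightarrow> 'a set set \<Rightarrow> 'a set set \<Rightarrow> bool" where
  "matching_simplicial_submesh \<Omega> \<T> \<F> \<SS> \<longleftrightarrow>
     triangulation \<SS> \<and> (\<forall>S\<in>\<SS>. int DIM('a) simplex S) \<and> \<Union>\<SS> = closure \<Omega> \<and>
     (\<forall>S\<in>\<SS>. \<exists>!T. T \<in> \<T> \<and> interior S \<subseteq> T) \<and>
     (\<forall>S\<in>\<SS>. \<forall>E. E facet_of S \<and> E \<subseteq> (\<Union>T\<in>\<T>. frontier T) \<longrightarrow> (\<exists>!F. F \<in> \<F> \<and> E \<subseteq> F))"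

definition regular_mesh_sequence ::
    "'a::euclidean_space set \<Rightarrow> real set \<Rightarrow> (real \<Rightarrow> 'a set set) \<Rightarrow> (real \<Rightarrow> 'a set set) \<Rightarrow> bool" where
  "regular_mesh_sequence \<Omega> \<H> \<T> \<F> \<longleftrightarrow>
     \<H> \<subseteq> {0<..} \<and> countable \<H> \<and> (\<forall>x. x islimpt \<H> \<longleftrightarrow> x = 0) \<and>
     (\<forall>h\<in>\<H>. polyhedral_mesh \<Omega> (\<T> h) (\<F> h) \<and> h = Max (diameter ` \<T> h)) \<and>
     (\<exists>\<SS> \<rho>. 0 < \<rho> \<and>
        (\<forall>h\<in>\<H>. matching_simplicial_submesh \<Omega> (\<T> h) (\<F> h) (\<SS> h) \<and>
           (\<forall>S\<in>\<SS> h. \<rho> * diameter S \<le> inradius S) \<and>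
           (\<forall>S\<in>\<SS> h. \<forall>T\<in>\<T> h. interior S \<subseteq> T \<longrightarrow> \<rho> * diameter T \<le> diameter S)))"


section \<open>Fields, differential operators and the constitutive law\<close>


type_synonym 'd vec_field = "real^'d \<Rightarrow> real^'d"
type_synonym 'd tensor_field = "real^'d \<Rightarrow> real^'d^'d"

definition sym_matrices :: "(real^'d^'d) set" where
  "sym_matrices = {A. transpose A = A}"

definition outer :: "real^'d \<Rightarrow> real^'d \<Rightarrow> real^'d^'d" where
  "outer a b = (\<chi> i j. a $ i * b $ j)"

text \<open>\<open>jacobian v (at x) $ i $ j\<close> is the derivative of \<open>v $ i\<close> in the \<open>j\<close>-th variable.\<close>

definition sym_grad :: "'d::finite vec_field \<Rightarrow> 'd tensor_field" where
  "sym_grad v x = (1/2) *\<^sub>R (jacobian v (at x) + transpose (jacobian v (at x)))"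

definition skew_grad :: "'d::finite vec_field \<Rightarrow> 'd tensor_field" where
  "skew_grad v x = (\<chi> i j. (jacobian v (at x) $ j $ i - jacobian v (at x) $ i $ j) / 2)"

definition tensor_div :: "'d::finite tensor_field \<Rightarrow> 'd vec_field" where
  "tensor_div \<tau> x = (\<chi> i. \<Sum>j\<in>UNIV. frechet_derivative \<tau> (at x) (axis j 1) $ i $ j)"

definition square_integrable ::
    "'a measure \<Rightarrow> ('a \<Rightarrow> 'b::euclidean_space) \<Rightarrow> bool" where
  "square_integrable M f \<longleftrightarrow> f \<in> borel_measurable M \<and> integrable M (\<lambda>x. (norm (f x))\<^sup>2)"

text \<open>The inner product and norm of \<open>real^'d^'d\<close> are the Frobenius ones.\<close>

definition assumption_S ::
    "(real^'d::finite) set \<Rightarrow> (real^'d \<Rightarrow> real^'d^'d \<Rightarrow> real^'d^'d) \<Rightarrow> bool" where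
  "assumption_S \<Omega> \<sigma> \<longleftrightarrow>
     (AE x in lebesgue_on \<Omega>. continuous_on sym_matrices (\<sigma> x)) \<and>
     (\<forall>\<tau>\<in>sym_matrices. (\<lambda>x. \<sigma> x \<tau>) \<in> borel_measurable (lebesgue_on \<Omega>)) \<and>
     square_integrable (lebesgue_on \<Omega>) (\<lambda>x. \<sigma> x 0) \<and>
     (\<exists>\<sigma>_up>0. \<exists>\<sigma>_low>0. AE x in lebesgue_on \<Omega>. \<forall>\<tau>\<in>sym_matrices. \<forall>\<eta>\<in>sym_matrices.
        norm (\<sigma> x \<tau> - \<sigma> x 0) \<le> \<sigma>_up * norm \<tau> \<and>
        \<sigma> x \<tau> \<bullet> \<tau> \<ge> \<sigma>_low * (norm \<tau>)\<^sup>2 \<and>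
        (\<sigma> x \<tau> - \<sigma> x \<eta>) \<bullet> (\<tau> - \<eta>) \<ge> 0)"


section \<open>Polynomial spaces and projectors\<close>

definition polynomials :: "nat \<Rightarrow> 'v::real_vector set \<Rightarrow> (real^'d::finite \<Rightarrow> 'v) set" where
  "polynomials l V =
     {p. \<exists>c :: ('d \<Rightarrow> nat) \<Rightarrow> 'v. (\<forall>\<alpha>. c \<alpha> \<in> V) \<and>
        p = (\<lambda>x. \<Sum>\<alpha> | sum \<alpha> UNIV \<le> l. (\<Prod>i\<in>UNIV. x $ i ^ \<alpha> i) *\<^sub>R c \<alpha>)}"

definition restr :: "'a set \<Rightarrow> ('a \<Rightarrow> 'v::zero) \<Rightarrow> 'a \<Rightarrow> 'v" where
  "restr X g = (\<lambda>x. if x \<in> X then g x else 0)"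

text \<open>Functions on \<open>X\<close> are encoded as functions vanishing off \<open>closure X\<close>. Faces are closed; a
  polynomial on an open element carries its trace on the boundary of the element.\<close>

definition poly_space :: "nat \<Rightarrow> (real^'d::finite) set \<Rightarrow> 'v::real_vector set \<Rightarrow> (real^'d \<Rightarrow> 'v) set" where
  "poly_space l X V = restr (closure X) ` polynomials l V"

text \<open>\<open>M\<close> is the measure on \<open>X\<close>: \<open>lebesgue_on X\<close> for elements, \<open>surface_measure X\<close> for faces.
  Orthogonality to all polynomials with values in the full space \<open>'v\<close> makes the projector act
  componentwise.\<close>

definition L2_proj :: "(real^'d::finite) measure \<Rightarrow> nat \<Rightarrow> (real^'d) set \<Rightarrow>
    (real^'d \<Rightarrow> 'v::euclidean_space) \<Rightarrow> real^'d \<Rightarrow> 'v" where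
  "L2_proj M l X g =
     (THE p. p \<in> poly_space l X UNIV \<and> (\<forall>q\<in>poly_space l X UNIV. (LINT x|M. (g x - p x) \<bullet> q x) = 0))"

abbreviation elem_proj :: "nat \<Rightarrow> (real^'d::finite) set \<Rightarrow>
    (real^'d \<Rightarrow> 'v::euclidean_space) \<Rightarrow> real^'d \<Rightarrow> 'v" where
  "elem_proj l T \<equiv> L2_proj (lebesgue_on T) l T"

abbreviation face_proj :: "nat \<Rightarrow> (real^'d::finite) set \<Rightarrow>
    (real^'d \<Rightarrow> 'v::euclidean_space) \<Rightarrow> real^'d \<Rightarrow> 'v" where
  "face_proj l F \<equiv> L2_proj (surface_measure F) l F"


section \<open>Discrete unknowns\<close>

type_synonym 'd local_unknown = "'d vec_field \<times> ((real^'d) set \<Rightarrow> 'd vec_field)"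
type_synonym 'd global_unknown = "((real^'d) set \<Rightarrow> 'd vec_field) \<times> ((real^'d) set \<Rightarrow> 'd vec_field)"

definition global_space ::
    "nat \<Rightarrow> (real^'d::finite) set set \<Rightarrow> (real^'d) set set \<Rightarrow> 'd global_unknown set" where
  "global_space k \<T> \<F> = (\<Pi>\<^sub>E T\<in>\<T>. poly_space k T UNIV) \<times> (\<Pi>\<^sub>E F\<in>\<F>. poly_space k F UNIV)"

definition global_space_0 ::
    "(real^'d::finite) set \<Rightarrow> nat \<Rightarrow> (real^'d) set set \<Rightarrow> (real^'d) set set \<Rightarrow> 'd global_unknown set" where
  "global_space_0 \<Omega> k \<T> \<F> =
     {v \<in> global_space k \<T> \<F>. \<forall>F\<in>\<F>. is_boundary_face \<Omega> \<T> F \<longrightarrow> snd v F = (\<lambda>x. 0)}"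

definition localize ::
    "(real^'d::finite) set set \<Rightarrow> (real^'d) set \<Rightarrow> 'd global_unknown \<Rightarrow> 'd local_unknown" where
  "localize \<F> T v = (fst v T, restrict (snd v) (mesh_faces \<F> T))"

text \<open>Function with restriction \<open>g T\<close> to every element \<open>T\<close>, set to zero on the mesh skeleton.\<close>

definition broken :: "'a set set \<Rightarrow> ('a set \<Rightarrow> 'a \<Rightarrow> 'v::comm_monoid_add) \<Rightarrow> 'a \<Rightarrow> 'v" where
  "broken \<T> g x = (\<Sum>T\<in>\<T>. restr T (g T) x)"


section \<open>Reconstructions and stabilization\<close>

definition grad_rec ::
    "nat \<Rightarrow> (real^'d::finite) set set \<Rightarrow> (real^'d) set \<Rightarrow> 'd local_unknown \<Rightarrow> 'd tensor_field" where
  "grad_rec k \<F> T v =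
     (THE G. G \<in> poly_space k T sym_matrices \<and>
        (\<forall>\<tau>\<in>poly_space k T sym_matrices.
           (LINT x|lebesgue_on T. G x \<bullet> \<tau> x) =
             - (LINT x|lebesgue_on T. fst v x \<bullet> tensor_div \<tau> x)
             + (\<Sum>F\<in>mesh_faces \<F> T. LINT x|surface_measure F. snd v F x \<bullet> (\<tau> x *v normal T F))))"

definition disp_rec ::
    "nat \<Rightarrow> (real^'d::finite) set set \<Rightarrow> (real^'d) set \<Rightarrow> 'd local_unknown \<Rightarrow> 'd vec_field" where
  "disp_rec k \<F> T v =
     (THE r. r \<in> poly_space (k + 1) T UNIV \<and>
        (\<forall>w\<in>poly_space (k + 1) T UNIV.
           (LINT x|lebesgue_on T. (sym_grad r x - grad_rec k \<F> T v x) \<bullet> sym_grad w x) = 0) \<and>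
        (LINT x|lebesgue_on T. r x) = (LINT x|lebesgue_on T. fst v x) \<and>
        (LINT x|lebesgue_on T. skew_grad r x) =
          (\<Sum>F\<in>mesh_faces \<F> T. LINT x|surface_measure F.
             (1/2) *\<^sub>R (outer (normal T F) (snd v F x) - outer (snd v F x) (normal T F))))"

definition face_diff ::
    "nat \<Rightarrow> (real^'d::finite) set set \<Rightarrow> (real^'d) set \<Rightarrow> (real^'d) set \<Rightarrow> 'd local_unknown \<Rightarrow> 'd vec_field" where
  "face_diff k \<F> T F v x =
     face_proj k F (\<lambda>y. disp_rec k \<F> T v y - snd v F y) x
     - elem_proj k T (\<lambda>y. disp_rec k \<F> T v y - fst v y) x"

definition stab ::
    "nat \<Rightarrow> real \<Rightarrow> (real^'d::finite) set set \<Rightarrow> (real^'d) set \<Rightarrow> 'd local_unknown \<Rightarrow> 'd local_unknown \<Rightarrow> real" where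
  "stab k \<gamma> \<F> T u v =
     (\<Sum>F\<in>mesh_faces \<F> T. \<gamma> / diameter F *
        (LINT x|surface_measure F. face_diff k \<F> T F u x \<bullet> face_diff k \<F> T F v x))"

definition global_stab ::
    "nat \<Rightarrow> real \<Rightarrow> (real^'d::finite) set set \<Rightarrow> (real^'d) set set \<Rightarrow> 'd global_unknown \<Rightarrow> 'd global_unknown \<Rightarrow> real" where
  "global_stab k \<gamma> \<T> \<F> u v = (\<Sum>T\<in>\<T>. stab k \<gamma> \<F> T (localize \<F> T u) (localize \<F> T v))"

definition global_grad_rec ::
    "nat \<Rightarrow> (real^'d::finite) set set \<Rightarrow> (real^'d) set set \<Rightarrow> 'd global_unknown \<Rightarrow> 'd tensor_field" where
  "global_grad_rec k \<T> \<F> v = broken \<T> (\<lambda>T. grad_rec k \<F> T (localize \<F> T v))"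


section \<open>Boundary residual and numerical traction\<close>

definition bdry_space ::
    "nat \<Rightarrow> (real^'d::finite) set set \<Rightarrow> (real^'d) set \<Rightarrow> ((real^'d) set \<Rightarrow> 'd vec_field) set" where
  "bdry_space k \<F> T = (\<Pi>\<^sub>E F\<in>mesh_faces \<F> T. poly_space k F UNIV)"

definition bdry_diff ::
    "(real^'d::finite) set set \<Rightarrow> (real^'d) set \<Rightarrow> 'd local_unknown \<Rightarrow> (real^'d) set \<Rightarrow> 'd vec_field" where
  "bdry_diff \<F> T v = (\<lambda>F\<in>mesh_faces \<F> T. restr F (\<lambda>x. snd v F x - fst v x))"

definition bdry_residual ::
    "nat \<Rightarrow> real \<Rightarrow> (real^'d::finite) set set \<Rightarrow> (real^'d) set \<Rightarrow> 'd local_unknown \<Rightarrow> (real^'d) set \<Rightarrow> 'd vec_field" where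
  "bdry_residual k \<gamma> \<F> T v =
     (THE R. R \<in> bdry_space k \<F> T \<and>
        (\<forall>\<alpha>\<in>bdry_space k \<F> T.
           - (\<Sum>F\<in>mesh_faces \<F> T. LINT x|surface_measure F. R F x \<bullet> \<alpha> F x) =
           stab k \<gamma> \<F> T ((\<lambda>x. 0), bdry_diff \<F> T v) ((\<lambda>x. 0), \<alpha>)))"

definition traction ::
    "nat \<Rightarrow> real \<Rightarrow> (real^'d::finite \<Rightarrow> real^'d^'d \<Rightarrow> real^'d^'d) \<Rightarrow> (real^'d) set set \<Rightarrow>
     (real^'d) set \<Rightarrow> (real^'d) set \<Rightarrow> 'd local_unknown \<Rightarrow> 'd vec_field" where
  "traction k \<gamma> \<sigma> \<F> T F u x =
     - (elem_proj k T (\<lambda>y. \<sigma> y (grad_rec k \<F> T u y)) x *v normal T F)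
     + bdry_residual k \<gamma> \<F> T u F x"

end

theory Submission
  imports Defs
begin

text \<open>
  The stabilization vanishes on interpolants of polynomials \<open>p\<close> of degree at most \<open>k\<close>, because the
  displacement reconstruction of such an interpolant is \<open>p\<close> itself. Hence \<open>s\<^sub>T(u, v)\<close> only depends
  on the boundary differences of \<open>u\<close> and \<open>v\<close> and equals \<open>- \<Sum>\<^sub>F \<integral>\<^sub>F R u \<bullet> (v\<^sub>F - v\<^sub>T)\<close>. Similarly,
  integration by parts turns \<open>\<integral>\<^sub>T \<sigma> : G v = \<integral>\<^sub>T \<pi>\<sigma> : G v\<close> into
  \<open>\<integral>\<^sub>T \<sigma> : \<nabla>\<^sub>s v\<^sub>T + \<Sum>\<^sub>F \<integral>\<^sub>F (\<pi>\<sigma> n) \<bullet> (v\<^sub>F - v\<^sub>T)\<close>, so that the discrete problem becomes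
  \<open>\<Sum>\<^sub>T (\<integral>\<^sub>T \<sigma> : \<nabla>\<^sub>s v\<^sub>T - \<Sum>\<^sub>F \<integral>\<^sub>F T\<^sub>T\<^sub>F \<bullet> (v\<^sub>F - v\<^sub>T)) = \<integral> f \<bullet> v\<close>. Testing with one element unknown
  gives the principle of virtual work, testing with one interface unknown gives action and reaction.

  The required divergence theorem on a polyhedral element is proved in directions \<open>e\<close> transversal to
  all faces: on almost every segment \<open>{y + t e | 0 \<le> t \<le> 1}\<close> the fundamental theorem of calculus
  yields a sum over the crossed faces, and integrating over \<open>y\<close> turns each crossing into a surface
  integral weighted by \<open>\<bar>n \<bullet> e\<bar>\<close> while the endpoint terms cancel by translation invariance.
\<close>

section \<open>Riesz representation in finite-dimensional function spaces\<close>

text \<open>The discrete operators \<open>L2_proj\<close>, \<open>grad_rec\<close>,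
  \<open>disp_rec\<close>, \<open>bdry_residual\<close>, and also \<open>normal\<close>, are
  definite descriptions, so none of their defining equations may be used before unique existence is
  shown. For the operators this comes down to representing functionals on finite-dimensional
  function spaces by a definite symmetric form. Definiteness can mean equality of functions because
  members of \<open>poly_space\<close> are cut off outside the closure and a polynomial that
  vanishes almost everywhere on an element or a face vanishes there identically. For the
  displacement reconstruction the strain form is degenerate on rigid motions, which the two closure
  conditions must fix.

  The geometric obstacle is that elements need not be convex and that a normal is only known to
  point outward almost everywhere on a face. Generic lines avoid the exceptional sets, and surface
  measure, the volume of a straight prism, is compared with slanted prisms through the determinant
  of one linear map. The Lipschitz boundary gives
  \<open>interior (closure \<Omega>) = \<Omega>\<close>, which keeps a face shared by two elements
  off the boundary, so that it may carry a test function.\<close>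

definition fspan :: "('i \<Rightarrow> 'a \<Rightarrow> 'v::real_vector) \<Rightarrow> 'i set \<Rightarrow> ('a \<Rightarrow> 'v) set" where
  "fspan b I = {p. \<exists>c. p = (\<lambda>x. \<Sum>i\<in>I. c i *\<^sub>R b i x)}"

lemma fspanI: "p = (\<lambda>x. \<Sum>i\<in>I. c i *\<^sub>R b i x) \<Longrightarrow> p \<in> fspan b I"
  by (auto simp: fspan_def)

lemma fspan_empty: "fspan b {} = {\<lambda>x. 0}"
  by (auto simp: fspan_def)

lemma fspan_insert:
  assumes "finite I" "i \<notin> I"
  shows "p \<in> fspan b (insert i I) \<longleftrightarrow> (\<exists>c. \<exists>q\<in>fspan b I. p = (\<lambda>x. c *\<^sub>R b i x + q x))"
proof
  assume "p \<in> fspan b (insert i I)"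
  then obtain c where "p = (\<lambda>x. \<Sum>j\<in>insert i I. c j *\<^sub>R b j x)"
    by (auto simp: fspan_def)
  then have "p = (\<lambda>x. c i *\<^sub>R b i x + (\<Sum>j\<in>I. c j *\<^sub>R b j x))"
    using assms by simp
  then show "\<exists>c. \<exists>q\<in>fspan b I. p = (\<lambda>x. c *\<^sub>R b i x + q x)"
    by (auto simp: fspan_def)
next
  assume "\<exists>c. \<exists>q\<in>fspan b I. p = (\<lambda>x. c *\<^sub>R b i x + q x)"
  then obtain a c where p: "p = (\<lambda>x. a *\<^sub>R b i x + (\<Sum>j\<in>I. c j *\<^sub>R b j x))"
    by (auto simp: fspan_def)
  have "(\<Sum>j\<in>I. (c(i := a)) j *\<^sub>R b j x) = (\<Sum>j\<in>I. c j *\<^sub>R b j x)" for x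
    using assms by (intro sum.cong) auto
  then have "p = (\<lambda>x. \<Sum>j\<in>insert i I. (c(i := a)) j *\<^sub>R b j x)"
    using assms p by simp
  then show "p \<in> fspan b (insert i I)"
    by (rule fspanI)
qed

lemma fspan_add: "p \<in> fspan b I \<Longrightarrow> q \<in> fspan b I \<Longrightarrow> (\<lambda>x. p x + q x) \<in> fspan b I"
proof -
  assume "p \<in> fspan b I" "q \<in> fspan b I"
  then obtain c d where "p = (\<lambda>x. \<Sum>i\<in>I. c i *\<^sub>R b i x)" "q = (\<lambda>x. \<Sum>i\<in>I. d i *\<^sub>R b i x)"
    by (auto simp: fspan_def)
  then have "(\<lambda>x. p x + q x) = (\<lambda>x. \<Sum>i\<in>I. (c i + d i) *\<^sub>R b i x)"
    by (simp add: scaleR_add_left sum.distrib)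
  then show ?thesis
    by (rule fspanI)
qed

lemma fspan_scale: "p \<in> fspan b I \<Longrightarrow> (\<lambda>x. a *\<^sub>R p x) \<in> fspan b I"
proof -
  assume "p \<in> fspan b I"
  then obtain c where "p = (\<lambda>x. \<Sum>i\<in>I. c i *\<^sub>R b i x)"
    by (auto simp: fspan_def)
  then have "(\<lambda>x. a *\<^sub>R p x) = (\<lambda>x. \<Sum>i\<in>I. (a * c i) *\<^sub>R b i x)"
    by (simp add: scaleR_sum_right)
  then show ?thesis
    by (rule fspanI)
qed

lemma fspan_base:
  assumes "finite I" "i \<in> I" shows "b i \<in> fspan b I"
proof -
  have "b i = (\<lambda>x. \<Sum>j\<in>I. (if j = i then 1 else 0) *\<^sub>R b j x)"
    using assms by (simp add: if_distrib[of "\<lambda>c. c *\<^sub>R _"] cong: if_cong)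
  then show ?thesis
    by (rule fspanI)
qed

lemma fspan_mono:
  assumes "finite J" "I \<subseteq> J" shows "fspan b I \<subseteq> fspan b J"
proof
  fix p assume "p \<in> fspan b I"
  then obtain c where p: "p = (\<lambda>x. \<Sum>i\<in>I. c i *\<^sub>R b i x)"
    by (auto simp: fspan_def)
  have "(\<Sum>i\<in>I. c i *\<^sub>R b i x) = (\<Sum>i\<in>J. (if i \<in> I then c i else 0) *\<^sub>R b i x)" for x
    using assms by (intro sum.mono_neutral_cong_left) auto
  then show "p \<in> fspan b J"
    unfolding p by (intro fspanI[where c = "\<lambda>i. if i \<in> I then c i else 0"]) auto
qed

text \<open>Gram-Schmidt: the new basis function is first made orthogonal to the span of the others.\<close>

lemma riesz_exists:
  fixes b :: "'i \<Rightarrow> 'a \<Rightarrow> 'v::real_vector"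
  assumes "finite I"
    and add: "\<And>p q r. p \<in> fspan b I \<Longrightarrow> q \<in> fspan b I \<Longrightarrow> r \<in> fspan b I \<Longrightarrow>
      B (\<lambda>x. p x + q x) r = B p r + B q r"
    and scale: "\<And>a p r. p \<in> fspan b I \<Longrightarrow> r \<in> fspan b I \<Longrightarrow> B (\<lambda>x. a *\<^sub>R p x) r = a * B p r"
    and sym: "\<And>p r. p \<in> fspan b I \<Longrightarrow> r \<in> fspan b I \<Longrightarrow> B p r = B r p"
    and definite: "\<And>p. p \<in> fspan b I \<Longrightarrow> B p p = 0 \<Longrightarrow> p = (\<lambda>x. 0)"
    and L_add: "\<And>p q. p \<in> fspan b I \<Longrightarrow> q \<in> fspan b I \<Longrightarrow> L (\<lambda>x. p x + q x) = L p + L q"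
    and L_scale: "\<And>a p. p \<in> fspan b I \<Longrightarrow> L (\<lambda>x. a *\<^sub>R p x) = a * (L p :: real)"
  shows "\<exists>w\<in>fspan b I. \<forall>q\<in>fspan b I. B w q = L q"
  using assms
proof (induction I arbitrary: L rule: finite_induct)
  case empty
  have "B (\<lambda>x. 0) (\<lambda>x. 0) = 0" "L (\<lambda>x. 0) = 0"
    using empty(2)[of "\<lambda>x. 0" "\<lambda>x. 0" 0] empty(6)[of "\<lambda>x. 0" 0]
      empty.prems(2)[of "\<lambda>x. 0" "\<lambda>x. 0" 0] empty.prems(6)[of "\<lambda>x. 0" 0] by (simp_all add: fspan_empty)
  then show ?case
    by (simp add: fspan_empty)
next
  case (insert i I)
  let ?W = "fspan b I" and ?W' = "fspan b (insert i I)"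
  have sub: "?W \<subseteq> ?W'"
    using insert.hyps by (intro fspan_mono) auto
  have bi: "b i \<in> ?W'"
    using insert.hyps by (intro fspan_base) auto
  \<comment> \<open>The induction hypothesis is used for two functionals: \<open>B (b i)\<close>,
    whose representative \<open>p\<close> is the orthogonal projection of the new function onto the
    old span, and \<open>L\<close> itself.\<close>
  have *: "\<exists>w\<in>?W. \<forall>q\<in>?W. B w q = M q"
    if "\<And>p q. p \<in> ?W' \<Longrightarrow> q \<in> ?W' \<Longrightarrow> M (\<lambda>x. p x + q x) = M p + M q"
      "\<And>a p. p \<in> ?W' \<Longrightarrow> M (\<lambda>x. a *\<^sub>R p x) = a * (M p :: real)" for M
    by (rule insert.IH) (use sub that insert.prems(1-4) in \<open>simp_all add: subset_iff\<close>)
  have add2: "B r (\<lambda>x. p x + q x) = B r p + B r q" if "p \<in> ?W'" "q \<in> ?W'" "r \<in> ?W'" for p q r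
    using insert.prems(1)[OF that] insert.prems(3)[OF that(1,3)] insert.prems(3)[OF that(2,3)]
      insert.prems(3)[OF fspan_add[OF that(1,2)] that(3)] by simp
  have scale2: "B r (\<lambda>x. a *\<^sub>R p x) = a * B r p" if "p \<in> ?W'" "r \<in> ?W'" for a p r
    using insert.prems(2)[OF that] insert.prems(3)[OF that] insert.prems(3)[OF fspan_scale[OF that(1)] that(2)]
    by simp
  obtain p where p: "p \<in> ?W" "\<And>q. q \<in> ?W \<Longrightarrow> B p q = B (b i) q"
    using *[of "B (b i)"] add2 scale2 bi by blast
  obtain w where w: "w \<in> ?W" "\<And>q. q \<in> ?W \<Longrightarrow> B w q = L q"
    using *[of L] insert.prems(5,6) by blast
  define e where "e = (\<lambda>x. b i x + (-1) *\<^sub>R p x)"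
  have pW': "p \<in> ?W'" "w \<in> ?W'"
    using p(1) w(1) sub by auto
  have eW: "e \<in> ?W'"
    unfolding e_def using bi pW' by (intro fspan_add fspan_scale)
  have orth: "B e q = 0" if "q \<in> ?W" for q
  proof -
    have q: "q \<in> ?W'" using that sub by auto
    have "B e q = B (b i) q + B (\<lambda>x. (-1) *\<^sub>R p x) q"
      unfolding e_def using bi pW'(1) q by (intro insert.prems(1) fspan_scale)
    also have "\<dots> = 0"
      using insert.prems(2)[OF pW'(1) q, of "-1"] p(2)[OF that] by simp
    finally show ?thesis .
  qed
  \<comment> \<open>The coefficient for which \<open>w + a e\<close> represents \<open>L\<close> on
    \<open>e\<close> too. If \<open>B e e = 0\<close>, then \<open>a = 0\<close> by the convention
    on division, and \<open>aee\<close> below still holds since definiteness forces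
    \<open>e = 0\<close>.\<close>
  define a where "a = (L e - B w e) / B e e"
  let ?u = "\<lambda>x. w x + a *\<^sub>R e x"
  have aee: "a * B e e = L e - B w e"
  proof (cases "B e e = 0")
    case True
    then have e0: "e = (\<lambda>x. 0)"
      using insert.prems(4)[OF eW] by simp
    have "L e = 0" using insert.prems(6)[OF eW, of 0] by (simp add: e0)
    moreover have "B w e = 0" using scale2[OF eW pW'(2), of 0] by (simp add: e0)
    ultimately show ?thesis using True by simp
  qed (simp add: a_def)
  have ae: "(\<lambda>x. a *\<^sub>R e x) \<in> ?W'"
    using eW by (rule fspan_scale)
  have uW: "?u \<in> ?W'"
    using pW' ae by (intro fspan_add)
  have u_on: "B ?u q = B w q + a * B e q" if "q \<in> ?W'" for q
    using insert.prems(1)[OF pW'(2) ae that] insert.prems(2)[OF eW that] by simp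
  have "B ?u q = L q" if "q \<in> ?W'" for q
  proof -
    obtain c r where r: "r \<in> ?W" "q = (\<lambda>x. c *\<^sub>R b i x + r x)"
      using \<open>q \<in> ?W'\<close> insert.hyps by (auto simp: fspan_insert)
    \<comment> \<open>Writing \<open>q\<close> with the orthogonalized \<open>e\<close> instead of
      \<open>b i\<close> separates the two summands: \<open>s\<close> lies in the old span, on which
      \<open>B e\<close> vanishes.\<close>
    define s where "s = (\<lambda>x. r x + c *\<^sub>R p x)"
    have s: "s \<in> ?W"
      unfolding s_def using r p by (intro fspan_add fspan_scale)
    have q: "q = (\<lambda>x. s x + c *\<^sub>R e x)"
      by (simp add: s_def r(2) e_def algebra_simps)
    have s': "s \<in> ?W'" using s sub by auto
    have ce: "(\<lambda>x. c *\<^sub>R e x) \<in> ?W'" using eW by (rule fspan_scale)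
    have "B ?u s = L s"
      using u_on[OF s'] w(2)[OF s] orth[OF s] by simp
    moreover have "B ?u e = L e"
      using u_on[OF eW] aee by simp
    ultimately show ?thesis
      unfolding q using add2[OF s' ce uW] scale2[OF eW uW, of c]
        insert.prems(5)[OF s' ce] insert.prems(6)[OF eW, of c] by simp
  qed
  then show ?case
    using uW by blast
qed

text \<open>Uniqueness comes from definiteness: the difference of two representatives is orthogonal
  to itself. The unique-existence form is the one that the definite descriptions of the discrete
  operators call for.\<close>

lemma riesz:
  fixes b :: "'i \<Rightarrow> 'a \<Rightarrow> 'v::real_vector"
  assumes "finite I" and W: "W = fspan b I"
    and add: "\<And>p q r. p \<in> W \<Longrightarrow> q \<in> W \<Longrightarrow> r \<in> W \<Longrightarrow> B (\<lambda>x. p x + q x) r = B p r + B q r"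
    and scale: "\<And>a p r. p \<in> W \<Longrightarrow> r \<in> W \<Longrightarrow> B (\<lambda>x. a *\<^sub>R p x) r = a * B p r"
    and sym: "\<And>p r. p \<in> W \<Longrightarrow> r \<in> W \<Longrightarrow> B p r = B r p"
    and definite: "\<And>p. p \<in> W \<Longrightarrow> B p p = 0 \<Longrightarrow> p = (\<lambda>x. 0)"
    and L_add: "\<And>p q. p \<in> W \<Longrightarrow> q \<in> W \<Longrightarrow> L (\<lambda>x. p x + q x) = L p + L q"
    and L_scale: "\<And>a p. p \<in> W \<Longrightarrow> L (\<lambda>x. a *\<^sub>R p x) = a * (L p :: real)"
  shows "\<exists>!w. w \<in> W \<and> (\<forall>q\<in>W. B w q = L q)"
proof -
  have "\<exists>w\<in>W. \<forall>q\<in>W. B w q = L q"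
    unfolding W by (rule riesz_exists) (use assms in \<open>auto\<close>)
  moreover have "w = w'" if w: "w \<in> W" "\<forall>q\<in>W. B w q = L q" "w' \<in> W" "\<forall>q\<in>W. B w' q = L q" for w w'
  proof -
    let ?d = "\<lambda>x. w x + (-1) *\<^sub>R w' x"
    have m: "(\<lambda>x. (-1) *\<^sub>R w' x) \<in> W"
      using w(3) unfolding W by (rule fspan_scale)
    then have d: "?d \<in> W"
      using w(1) unfolding W by (intro fspan_add)
    have "B ?d ?d = 0"
      using add[OF w(1) m d] scale[OF w(3) d, of "-1"] w(2,4) d by simp
    then have "?d x = 0" for x
      using definite[OF d] by meson
    then show ?thesis
      by (intro ext) simp
  qed
  ultimately show ?thesis
    by blast
qed

section \<open>Polynomial spaces\<close>

definition mpower :: "('d::finite \<Rightarrow> nat) \<Rightarrow> real^'d \<Rightarrow> real" where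
  "mpower \<alpha> x = (\<Prod>i\<in>UNIV. x $ i ^ \<alpha> i)"

lemma finite_multi_indices: "finite {\<alpha> :: 'd::finite \<Rightarrow> nat. sum \<alpha> UNIV \<le> l}"
proof (rule finite_subset)
  have "\<alpha> i \<le> sum \<alpha> UNIV" for \<alpha> :: "'d \<Rightarrow> nat" and i
    by (rule member_le_sum) auto
  then show "{\<alpha> :: 'd \<Rightarrow> nat. sum \<alpha> UNIV \<le> l} \<subseteq> (\<Pi>\<^sub>E i\<in>UNIV. {..l})"
    by (fastforce intro: order_trans)
qed (simp add: finite_PiE)

lemma polynomials_eq:
  "polynomials l V =
     {p. \<exists>c. (\<forall>\<alpha>. c \<alpha> \<in> V) \<and> p = (\<lambda>x. \<Sum>\<alpha> | sum \<alpha> UNIV \<le> l. mpower \<alpha> x *\<^sub>R c \<alpha>)}"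
  by (simp add: polynomials_def mpower_def)

lemma polynomialsE:
  assumes "p \<in> polynomials l V"
  obtains c where "\<forall>\<alpha>. c \<alpha> \<in> V" "\<forall>x. p x = (\<Sum>\<alpha> | sum \<alpha> UNIV \<le> l. mpower \<alpha> x *\<^sub>R c \<alpha>)"
  using assms by (auto simp: polynomials_eq)

lemma polynomialsI:
  assumes "\<And>\<alpha>. c \<alpha> \<in> V" "\<And>x. p x = (\<Sum>\<alpha> | sum \<alpha> UNIV \<le> l. mpower \<alpha> x *\<^sub>R c \<alpha>)"
  shows "p \<in> polynomials l V"
  using assms by (auto simp: polynomials_eq)

lemma polynomials_add:
  assumes "subspace V" "p \<in> polynomials l V" "q \<in> polynomials l V"
  shows "(\<lambda>x. p x + q x) \<in> polynomials l V"
proof -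
  obtain c where c: "\<forall>\<alpha>. c \<alpha> \<in> V" "\<forall>x. p x = (\<Sum>\<alpha> | sum \<alpha> UNIV \<le> l. mpower \<alpha> x *\<^sub>R c \<alpha>)"
    using assms(2) by (rule polynomialsE)
  obtain d where d: "\<forall>\<alpha>. d \<alpha> \<in> V" "\<forall>x. q x = (\<Sum>\<alpha> | sum \<alpha> UNIV \<le> l. mpower \<alpha> x *\<^sub>R d \<alpha>)"
    using assms(3) by (rule polynomialsE)
  show ?thesis
    using c d
    by (intro polynomialsI[where c = "\<lambda>\<alpha>. c \<alpha> + d \<alpha>"])
      (auto intro: subspace_add[OF assms(1)] simp: scaleR_add_right sum.distrib)
qed

lemma polynomials_linear_image:
  assumes "linear A" "A ` V \<subseteq> W" "p \<in> polynomials l V"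
  shows "(\<lambda>x. A (p x)) \<in> polynomials l W"
proof -
  obtain c where c: "\<forall>\<alpha>. c \<alpha> \<in> V" "\<forall>x. p x = (\<Sum>\<alpha> | sum \<alpha> UNIV \<le> l. mpower \<alpha> x *\<^sub>R c \<alpha>)"
    using assms(3) by (rule polynomialsE)
  show ?thesis
    using c assms(1,2)
    by (intro polynomialsI[where c = "\<lambda>\<alpha>. A (c \<alpha>)"]) (auto simp: linear_sum linear_cmul)
qed

lemma polynomials_mono:
  assumes "V \<subseteq> W" shows "polynomials l V \<subseteq> polynomials l W"
proof
  fix p assume "p \<in> polynomials l V"
  then obtain c where "\<forall>\<alpha>. c \<alpha> \<in> V" "\<forall>x. p x = (\<Sum>\<alpha> | sum \<alpha> UNIV \<le> l. mpower \<alpha> x *\<^sub>R c \<alpha>)"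
    by (rule polynomialsE)
  then show "p \<in> polynomials l W"
    using assms by (intro polynomialsI[where c = c]) auto
qed

lemma polynomials_mpower:
  assumes "0 \<in> V" "v \<in> V" "sum \<alpha> UNIV \<le> l"
  shows "(\<lambda>x. mpower \<alpha> x *\<^sub>R v) \<in> polynomials l V"
  using assms
  by (intro polynomialsI[where c = "\<lambda>\<beta>. if \<beta> = \<alpha> then v else 0"])
    (auto simp: if_distrib[of "\<lambda>c. _ *\<^sub>R c"] sum.delta[OF finite_multi_indices] cong: if_cong)

lemma polynomials_0: "0 \<in> V \<Longrightarrow> (\<lambda>x. 0) \<in> polynomials l V"
  by (rule polynomialsI[where c = "\<lambda>_. 0"]) auto

lemma polynomials_const: "0 \<in> V \<Longrightarrow> v \<in> V \<Longrightarrow> (\<lambda>x. v) \<in> polynomials l V"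
  using polynomials_mpower[of V v "\<lambda>_. 0"] by (simp add: mpower_def)

lemma polynomials_sum:
  assumes "subspace V" "\<And>i. i \<in> I \<Longrightarrow> p i \<in> polynomials l V"
  shows "(\<lambda>x. \<Sum>i\<in>I. p i x) \<in> polynomials l V"
  using assms(2)
  by (induction I rule: infinite_finite_induct)
    (auto intro: polynomials_add[OF assms(1)] polynomials_0 subspace_0[OF assms(1)])

text \<open>Supplies the linear part of the rigid motions that serve as test functions; the
  coefficients are the images of the coordinate vectors.\<close>

lemma polynomials_linear:
  assumes "linear A" "l \<ge> 1"
  shows "A \<in> polynomials l UNIV"
proof -
  have "x $ j = mpower (\<lambda>i. if i = j then 1 else 0) x" for x :: "real^'a" and j
    by (simp add: mpower_def if_distrib[of "\<lambda>n. _ ^ n"] cong: if_cong)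
  then have *: "(\<lambda>x. x $ j *\<^sub>R A (axis j 1)) \<in> polynomials l UNIV" for j
    using assms(2) by (simp only:) (intro polynomials_mpower, auto)
  have A: "A = (\<lambda>x. \<Sum>j\<in>UNIV. x $ j *\<^sub>R A (axis j 1))"
  proof
    fix x
    have "A x = A (\<Sum>j\<in>UNIV. x $ j *\<^sub>R axis j 1)"
      using basis_expansion[of x] by (simp add: scalar_mult_eq_scaleR)
    then show "A x = (\<Sum>j\<in>UNIV. x $ j *\<^sub>R A (axis j 1))"
      using assms(1) by (simp add: linear_sum linear_cmul)
  qed
  show ?thesis
    by (subst A) (rule polynomials_sum[OF subspace_UNIV *])
qed

text \<open>The truncated exponent at \<open>\<alpha> j = 0\<close> is harmless, because the factor
  \<open>\<alpha> j\<close> then removes the term.\<close>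

lemma mpower_has_derivative:
  "(mpower \<alpha> has_derivative (\<lambda>h. \<Sum>j\<in>UNIV. h $ j * (\<alpha> j * mpower (\<alpha>(j := \<alpha> j - 1)) x))) (at x)"
proof -
  have *: "(\<lambda>h. h $ i * (real (\<alpha> i) * x $ i ^ (\<alpha> i - 1)) * (\<Prod>j\<in>UNIV - {i}. x $ j ^ \<alpha> j)) =
     (\<lambda>h. h $ i * (real (\<alpha> i) * mpower (\<alpha>(i := \<alpha> i - 1)) x))" for i
  proof -
    have "mpower (\<alpha>(i := \<alpha> i - 1)) x = x $ i ^ (\<alpha> i - 1) * (\<Prod>j\<in>UNIV - {i}. x $ j ^ \<alpha> j)"
      unfolding mpower_def by (subst prod.remove[of _ i]) auto
    then show ?thesis by (simp only: mult.assoc)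
  qed
  have "((\<lambda>x. x $ i ^ \<alpha> i) has_derivative (\<lambda>h. h $ i * (real (\<alpha> i) * x $ i ^ (\<alpha> i - 1)))) (at x)" for i
    by (auto intro!: derivative_eq_intros bounded_linear.has_derivative[OF bounded_linear_vec_nth])
  then have "((\<lambda>x. \<Prod>i\<in>UNIV. x $ i ^ \<alpha> i) has_derivative
     (\<lambda>h. \<Sum>i\<in>UNIV. h $ i * (real (\<alpha> i) * x $ i ^ (\<alpha> i - 1)) * (\<Prod>j\<in>UNIV - {i}. x $ j ^ \<alpha> j))) (at x)"
    by (intro has_derivative_prod)
  then show ?thesis
    unfolding * fun_cong[OF *] by (simp add: mpower_def[abs_def])
qed

text \<open>Lowering an exponent never raises the degree, so the partial derivatives
  \<open>D j\<close> are recorded in the same space. This avoids a special case for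
  \<open>l = 0\<close> and keeps the coefficients in the subspace \<open>V\<close>.\<close>

lemma polynomials_has_derivative:
  assumes "subspace V" "p \<in> polynomials l (V::'v::real_normed_vector set)"
  obtains D where "\<forall>j. D j \<in> polynomials l V"
    "\<forall>x. (p has_derivative (\<lambda>h. \<Sum>j\<in>UNIV. h $ j *\<^sub>R D j x)) (at x)"
proof -
  let ?I = "{\<alpha>. sum \<alpha> UNIV \<le> l}"
  obtain c where c: "\<forall>\<alpha>. c \<alpha> \<in> V" "\<forall>x. p x = (\<Sum>\<alpha>\<in>?I. mpower \<alpha> x *\<^sub>R c \<alpha>)"
    using assms(2) by (rule polynomialsE)
  define D where "D j x = (\<Sum>\<alpha>\<in>?I. mpower (\<alpha>(j := \<alpha> j - 1)) x *\<^sub>R (real (\<alpha> j) *\<^sub>R c \<alpha>))" for j x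
  have le: "sum (\<alpha>(j := \<alpha> j - 1)) UNIV \<le> l" if "sum \<alpha> UNIV \<le> l" for \<alpha> and j :: 'a
    using that by (intro order_trans[OF sum_mono that]) auto
  have 1: "D j \<in> polynomials l V" for j
    unfolding D_def[abs_def]
    using assms(1) c(1) le
    by (intro polynomials_sum polynomials_mpower) (auto simp: subspace_0 subspace_scale)
  have 2: "(p has_derivative (\<lambda>h. \<Sum>j\<in>UNIV. h $ j *\<^sub>R D j x)) (at x)" for x
  proof -
    have "((\<lambda>x. \<Sum>\<alpha>\<in>?I. mpower \<alpha> x *\<^sub>R c \<alpha>) has_derivative
       (\<lambda>h. \<Sum>\<alpha>\<in>?I. (\<Sum>j\<in>UNIV. h $ j * (\<alpha> j * mpower (\<alpha>(j := \<alpha> j - 1)) x)) *\<^sub>R c \<alpha>)) (at x)"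
      by (intro has_derivative_sum has_derivative_scaleR_left mpower_has_derivative)
    moreover have "(\<Sum>\<alpha>\<in>?I. (\<Sum>j\<in>UNIV. h $ j * (\<alpha> j * mpower (\<alpha>(j := \<alpha> j - 1)) x)) *\<^sub>R c \<alpha>) =
        (\<Sum>j\<in>UNIV. h $ j *\<^sub>R D j x)" for h
      unfolding D_def scaleR_sum_right scaleR_sum_left
      by (subst sum.swap) (simp add: ac_simps)
    moreover have "p = (\<lambda>x. \<Sum>\<alpha>\<in>?I. mpower \<alpha> x *\<^sub>R c \<alpha>)"
      using c(2) by (intro ext) blast
    ultimately show ?thesis
      by simp
  qed
  show thesis
    using that 1 2 by blast
qed

lemma polynomials_continuous:
  assumes "p \<in> polynomials l (V::'v::real_normed_vector set)"
  shows "continuous_on S p"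
proof -
  have "p \<in> polynomials l UNIV"
    using assms polynomials_mono[of V UNIV] by auto
  then obtain D where "\<forall>j. D j \<in> polynomials l UNIV"
      "\<forall>x. (p has_derivative (\<lambda>h. \<Sum>j\<in>UNIV. h $ j *\<^sub>R D j x)) (at x)"
    by (rule polynomials_has_derivative[OF subspace_UNIV])
  then show ?thesis
    by (intro continuous_at_imp_continuous_on) (auto intro: has_derivative_continuous)
qed

lemma polynomials_inner_real_polynomial_function:
  assumes "p \<in> polynomials l (V::'v::real_inner set)"
  shows "real_polynomial_function (\<lambda>x. p x \<bullet> w)"
proof -
  obtain c where c: "\<forall>\<alpha>. c \<alpha> \<in> V" "\<forall>x. p x = (\<Sum>\<alpha> | sum \<alpha> UNIV \<le> l. mpower \<alpha> x *\<^sub>R c \<alpha>)"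
    using assms by (rule polynomialsE)
  have "real_polynomial_function (\<lambda>x. \<Sum>\<alpha> | sum \<alpha> UNIV \<le> l. mpower \<alpha> x * (c \<alpha> \<bullet> w))"
    unfolding mpower_def
    by (intro real_polynomial_function_sum finite_multi_indices real_polynomial_function.intros(4)
        real_polynomial_function.intros(2) real_polynomial_function_prod real_polynomial_function_power
        real_polynomial_function.intros(1) bounded_linear_vec_nth finite_class.finite_UNIV)
  then show ?thesis
    by (simp add: c inner_sum_left)
qed

text \<open>An open subset of \<open>S\<close> on which the polynomial is nonzero would have
  positive measure, so it vanishes everywhere on \<open>S\<close>. Along the line from a point of
  \<open>S\<close> to an arbitrary point it is a polynomial in one variable with infinitely many
  roots.\<close>

lemma real_polynomial_function_eq_0:
  fixes p :: "'a::euclidean_space \<Rightarrow> real"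
  assumes p: "real_polynomial_function p" and S: "open S" "S \<noteq> {}"
    and ae: "AE x in lborel. x \<in> S \<longrightarrow> p x = 0"
  shows "p x = 0"
proof -
  have cont: "continuous_on UNIV p"
    using p by (simp add: continuous_at_imp_continuous_on continuous_real_polymonial_function)
  have zero: "p y = 0" if "y \<in> S" for y
  proof (rule ccontr)
    assume "p y \<noteq> 0"
    define U where "U = S \<inter> p -` (- {0})"
    have U: "open U" "y \<in> U"
      using \<open>p y \<noteq> 0\<close> that S(1) cont by (auto simp: U_def intro!: open_Int open_vimage)
    have "AE x in lborel. x \<notin> U"
      using ae by eventually_elim (auto simp: U_def)
    then have "emeasure lborel U = 0"
      using U(1) by (subst (asm) AE_iff_null) (auto simp: null_sets_def)
    then have "U \<in> null_sets lborel"
      using U(1) by auto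
    then have "negligible U"
      by (metis U(1) negligible_iff_null_sets null_sets_completionI)
    then show False
      using U open_not_negligible by blast
  qed
  obtain x0 where x0: "x0 \<in> S"
    using S by auto
  obtain r where r: "r > 0" "ball x0 r \<subseteq> S"
    using x0 S(1) openE by metis
  let ?g = "\<lambda>t::real. x0 + t *\<^sub>R (x - x0)"
  have "polynomial_function ?g"
    by (intro polynomial_function_add polynomial_function_const polynomial_function_mult polynomial_function_id)
  then have "real_polynomial_function (p \<circ> ?g)"
    using p by blast
  then obtain a n where an: "p \<circ> ?g = (\<lambda>t. \<Sum>i\<le>n. a i * t ^ i)"
    using real_polynomial_function_imp_sum by metis
  \<comment> \<open>Small enough that the segment stays inside the ball around \<open>x0\<close>;
    the \<open>+ 1\<close> covers the case \<open>x = x0\<close>.\<close>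
  define \<epsilon> where "\<epsilon> = r / (norm (x - x0) + 1)"
  have \<epsilon>: "\<epsilon> > 0"
    using r by (simp add: \<epsilon>_def add_nonneg_pos)
  have "(\<Sum>i\<le>n. a i * t ^ i) = 0" if "t \<in> {0<..<\<epsilon>}" for t
  proof -
    have "norm (t *\<^sub>R (x - x0)) < r"
    proof -
      have "t * norm (x - x0) \<le> t * (norm (x - x0) + 1)"
        using that by (intro mult_left_mono) auto
      also have "\<dots> < r"
        using that by (simp add: \<epsilon>_def pos_less_divide_eq[OF add_nonneg_pos])
      finally show ?thesis
        using that by simp
    qed
    then have "?g t \<in> S"
      using r(2) by (auto simp: dist_norm)
    then show ?thesis
      using zero fun_cong[OF an, of t] by simp
  qed
  then have "{0<..<\<epsilon>} \<subseteq> {t. (\<Sum>i\<le>n. a i * t ^ i) = 0}"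
    by auto
  moreover have "infinite {0<..<\<epsilon>}"
    using \<epsilon> by simp
  ultimately have "infinite {t. (\<Sum>i\<le>n. a i * t ^ i) = 0}"
    using finite_subset by blast
  then have "\<forall>i\<le>n. a i = 0"
    using polyfun_finite_roots[of a n] by auto
  then have "(p \<circ> ?g) 1 = 0"
    unfolding an by simp
  then show ?thesis
    by simp
qed

section \<open>Polynomial spaces on elements and faces\<close>

lemma poly_spaceE:
  assumes "p \<in> poly_space l X V"
  obtains P where "P \<in> polynomials l V" "p = restr (closure X) P"
  using assms by (auto simp: poly_space_def)

lemma poly_spaceI: "P \<in> polynomials l V \<Longrightarrow> restr (closure X) P \<in> poly_space l X V"
  by (simp add: poly_space_def)

lemma poly_space_add:
  assumes "subspace V" "p \<in> poly_space l X V" "q \<in> poly_space l X V"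
  shows "(\<lambda>x. p x + q x) \<in> poly_space l X V"
proof -
  obtain P Q where *: "P \<in> polynomials l V" "p = restr (closure X) P"
    "Q \<in> polynomials l V" "q = restr (closure X) Q"
    using assms(2,3) by (elim poly_spaceE)
  have "(\<lambda>x. p x + q x) = restr (closure X) (\<lambda>x. P x + Q x)"
    by (auto simp: * restr_def)
  then show ?thesis
    using poly_spaceI[OF polynomials_add[OF assms(1) *(1,3)]] by simp
qed

lemma poly_space_linear_image:
  assumes "linear A" "A ` V \<subseteq> W" "p \<in> poly_space l X V"
  shows "(\<lambda>x. A (p x)) \<in> poly_space l X W"
proof -
  obtain P where *: "P \<in> polynomials l V" "p = restr (closure X) P"
    using assms(3) by (rule poly_spaceE)
  have "(\<lambda>x. A (p x)) = restr (closure X) (\<lambda>x. A (P x))"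
    by (auto simp: * restr_def linear_0[OF assms(1)])
  then show ?thesis
    using poly_spaceI[OF polynomials_linear_image[OF assms(1,2) *(1)]] by simp
qed

lemma poly_space_scale:
  assumes "subspace V" "p \<in> poly_space l X V"
  shows "(\<lambda>x. a *\<^sub>R p x) \<in> poly_space l X V"
  using assms by (intro poly_space_linear_image[of "\<lambda>v. a *\<^sub>R v"]) (auto intro: subspace_scale)

lemma poly_space_0: "subspace V \<Longrightarrow> (\<lambda>x. 0) \<in> poly_space l X V"
  using poly_spaceI[OF polynomials_0[OF subspace_0], of V X l] by (simp add: restr_def)

lemma poly_space_diff:
  assumes "subspace V" "p \<in> poly_space l X V" "q \<in> poly_space l X V"
  shows "(\<lambda>x. p x - q x) \<in> poly_space l X V"
  using poly_space_add[OF assms(1,2) poly_space_scale[OF assms(1,3), where a = "-1"]] by simp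

lemma poly_space_mono: "V \<subseteq> W \<Longrightarrow> poly_space l X V \<subseteq> poly_space l X W"
  unfolding poly_space_def by (intro image_mono polynomials_mono)

lemma poly_space_outside: "p \<in> poly_space l X V \<Longrightarrow> x \<notin> closure X \<Longrightarrow> p x = 0"
  by (auto simp: poly_space_def restr_def)

lemma poly_space_restr:
  assumes "p \<in> poly_space l X V" "closed Y" "Y \<subseteq> closure X"
  shows "restr Y p \<in> poly_space l Y V"
proof -
  obtain P where *: "P \<in> polynomials l V" "p = restr (closure X) P"
    using assms(1) by (rule poly_spaceE)
  have "restr Y p = restr (closure Y) P"
    using assms(2,3) by (auto simp: * restr_def fun_eq_iff)
  then show ?thesis
    using poly_spaceI[OF *(1), of Y] by simp
qed

text \<open>Monomials times a basis of \<open>V\<close> generate. They may become dependent after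
  the restriction, since the coordinates of points on a face satisfy an affine relation;
  \<open>fspan\<close> asks only for a finite generating family.\<close>

lemma poly_space_fspan:
  fixes V :: "'v::euclidean_space set" and X :: "(real^'d::finite) set"
  assumes "subspace V"
  obtains b :: "('d \<Rightarrow> nat) \<times> 'v \<Rightarrow> real^'d \<Rightarrow> 'v" and I where "finite I" "poly_space l X V = fspan b I"
proof -
  obtain B where B: "B \<subseteq> V" "independent B" "V \<subseteq> span B"
    using basis_exists by metis
  have "finite B"
    using B(2) independent_imp_finite by blast
  define I where "I = {\<alpha> :: 'd \<Rightarrow> nat. sum \<alpha> UNIV \<le> l} \<times> B"
  define b where "b = (\<lambda>(\<alpha>, v). restr (closure X) (\<lambda>x::real^'d. mpower \<alpha> x *\<^sub>R (v::'v)))"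
  have "finite I"
    using \<open>finite B\<close> finite_multi_indices by (auto simp: I_def)
  moreover have "poly_space l X V = fspan b I"
  proof (intro equalityI subsetI)
    fix p assume "p \<in> poly_space l X V"
    then obtain c where c: "\<And>\<alpha>. c \<alpha> \<in> V"
      and p: "p = restr (closure X) (\<lambda>x. \<Sum>\<alpha> | sum \<alpha> UNIV \<le> l. mpower \<alpha> x *\<^sub>R c \<alpha>)"
      by (auto simp: poly_space_def polynomials_eq)
    have "\<forall>\<alpha>. \<exists>u. c \<alpha> = (\<Sum>v\<in>B. u v *\<^sub>R v)"
      using c B(3) span_finite[OF \<open>finite B\<close>] by blast
    then obtain u where u: "\<And>\<alpha>. c \<alpha> = (\<Sum>v\<in>B. u \<alpha> v *\<^sub>R v)"
      by metis
    show "p \<in> fspan b I"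
      by (rule fspanI[where c = "\<lambda>(\<alpha>, v). u \<alpha> v"])
        (auto simp: p u fun_eq_iff restr_def I_def b_def scaleR_sum_right sum.cartesian_product'
          ac_simps split_def)
  next
    fix p assume "p \<in> fspan b I"
    then obtain c where c: "p = (\<lambda>x. \<Sum>i\<in>I. c i *\<^sub>R b i x)"
      by (auto simp: fspan_def)
    have p: "p = restr (closure X) (\<lambda>x. \<Sum>i\<in>I. mpower (fst i) x *\<^sub>R (c i *\<^sub>R snd i))"
      by (auto simp: c fun_eq_iff restr_def b_def ac_simps split_def)
    have "(\<lambda>x. \<Sum>i\<in>I. mpower (fst i) x *\<^sub>R (c i *\<^sub>R snd i)) \<in> polynomials l V"
      using assms B(1) by (intro polynomials_sum polynomials_mpower)
        (auto simp: I_def subset_iff subspace_0 subspace_scale)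
    then show "p \<in> poly_space l X V"
      unfolding p by (rule poly_spaceI)
  qed
  ultimately show thesis
    using that by blast
qed

section \<open>Linear maps and Lebesgue measure\<close>

text \<open>For an invertible linear map the factor is the reciprocal of the absolute determinant.
  It is stated for preimages because these are what image measures and changes of variables
  see.\<close>

definition scales :: "('a::euclidean_space \<Rightarrow> 'a) \<Rightarrow> real \<Rightarrow> bool" where
  "scales f \<kappa> \<longleftrightarrow> \<kappa> \<ge> 0 \<and> f \<in> borel_measurable borel \<and>
     (\<forall>A\<in>sets borel. emeasure lborel (f -` A) = ennreal \<kappa> * emeasure lborel A)"

lemma scales_measurable: "scales f \<kappa> \<Longrightarrow> f \<in> borel_measurable borel"
  by (simp add: scales_def)

lemma scales_compose:
  assumes "scales f \<kappa>" "scales g \<kappa>'"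
  shows "scales (\<lambda>x. f (g x)) (\<kappa> * \<kappa>')"
proof -
  have *: "f -` A \<in> sets borel" if "A \<in> sets borel" for A
    using measurable_sets[OF scales_measurable[OF assms(1)] that] by simp
  have "(\<lambda>x. f (g x)) -` A = g -` (f -` A)" for A
    by auto
  then show ?thesis
    using assms * by (auto simp: scales_def ennreal_mult' ac_simps measurable_compose)
qed

lemma scales_unique:
  fixes f :: "'a::euclidean_space \<Rightarrow> 'a"
  assumes "scales f \<kappa>" "scales f \<kappa>'"
  shows "\<kappa> = \<kappa>'"
proof -
  let ?B = "box 0 (One::'a)"
  have "emeasure lborel ?B = 1"
    by simp
  then have "ennreal \<kappa> = ennreal \<kappa>'"
    using assms by (metis (no_types, lifting) borel_open mult.right_neutral open_box scales_def)
  then show ?thesis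
    using assms by (simp add: scales_def)
qed

lemma lborel_nn_integral_translation:
  fixes g :: "'a::euclidean_space \<Rightarrow> ennreal"
  assumes [measurable]: "g \<in> borel_measurable borel"
  shows "(\<integral>\<^sup>+x. g (a + x) \<partial>lborel) = (\<integral>\<^sup>+x. g x \<partial>lborel)"
proof -
  have "(\<integral>\<^sup>+x. g x \<partial>lborel) = (\<integral>\<^sup>+x. g x \<partial>(distr lborel borel ((+) a)))"
    by (simp add: lborel_distr_plus)
  also have "\<dots> = (\<integral>\<^sup>+x. g (a + x) \<partial>lborel)"
    by (rule nn_integral_distr) auto
  finally show ?thesis by simp
qed

lemma lborel_nn_integral_reflect:
  fixes g :: "'a::euclidean_space \<Rightarrow> ennreal"
  assumes [measurable]: "g \<in> borel_measurable borel"
  shows "(\<integral>\<^sup>+x. g (a - x) \<partial>lborel) = (\<integral>\<^sup>+x. g x \<partial>lborel)"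
proof -
  have "(\<integral>\<^sup>+x. g x \<partial>lborel) = (\<integral>\<^sup>+x. g x \<partial>(distr lborel borel (\<lambda>x. a + (-1) *\<^sub>R x)))"
    using lborel_affine[of "-1" a] by (simp add: density_1)
  also have "\<dots> = (\<integral>\<^sup>+x. g (a + (-1) *\<^sub>R x) \<partial>lborel)"
    by (rule nn_integral_distr) auto
  finally show ?thesis by simp
qed

text \<open>Weil's argument for the uniqueness of translation invariant measures, applied to the image of
  Lebesgue measure under \<open>f\<close>.\<close>

lemma linear_scales:
  fixes f :: "'a::euclidean_space \<Rightarrow> 'a"
  assumes f: "linear f" and g: "linear g" "\<And>x. f (g x) = x" "\<And>x. g (f x) = x"
  obtains \<kappa> where "scales f \<kappa>"
proof -
  have contf: "continuous_on UNIV f"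
    using f by (simp add: linear_continuous_on linear_conv_bounded_linear)
  have contg: "continuous_on UNIV g"
    using g by (simp add: linear_continuous_on linear_conv_bounded_linear)
  have [measurable]: "f \<in> borel_measurable borel" "g \<in> borel_measurable borel"
    using contf contg by (simp_all add: borel_measurable_continuous_onI)
  let ?B = "box 0 (One::'a)"
  let ?i = "\<lambda>S x. indicator S x :: ennreal"
  have B1: "emeasure lborel ?B = 1"
    by simp
  have *: "emeasure lborel (f -` A) = emeasure lborel (f -` ?B) * emeasure lborel A"
    if [measurable]: "A \<in> sets borel" for A
  proof -
    have pre: "emeasure lborel (f -` S) = (\<integral>\<^sup>+x. ?i S (f x) \<partial>lborel)" if [measurable]: "S \<in> sets borel" for S
    proof -
      have "f -` S \<in> sets borel"
        using measurable_sets[of f borel borel S] by simp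
      then have "emeasure lborel (f -` S) = (\<integral>\<^sup>+x. ?i (f -` S) x \<partial>lborel)"
        by simp
      then show ?thesis
        by (simp add: indicator_def)
    qed
    have "emeasure lborel (f -` A) = (\<integral>\<^sup>+x. ?i A (f x) * (\<integral>\<^sup>+y. ?i ?B y \<partial>lborel) \<partial>lborel)"
      using pre[of A] B1 by simp
    also have "\<dots> = (\<integral>\<^sup>+x. ?i A (f x) * (\<integral>\<^sup>+y. ?i ?B (f x + y) \<partial>lborel) \<partial>lborel)"
      by (subst lborel_nn_integral_translation) auto
    also have "\<dots> = (\<integral>\<^sup>+x. (\<integral>\<^sup>+y. ?i A (f x) * ?i ?B (f x + y) \<partial>lborel) \<partial>lborel)"
      by (simp add: nn_integral_cmult)
    also have "\<dots> = (\<integral>\<^sup>+y. (\<integral>\<^sup>+x. ?i A (f x) * ?i ?B (f x + y) \<partial>lborel) \<partial>lborel)"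
      by (rule lborel_pair.Fubini'[symmetric]) measurable
    \<comment> \<open>For fixed \<open>y\<close>, shifting \<open>x\<close> by
      \<open>g (- y)\<close> replaces \<open>f x\<close> by \<open>f x - y\<close>: the variable
      \<open>y\<close> moves from the box factor to the factor of \<open>A\<close>.\<close>
    also have "\<dots> = (\<integral>\<^sup>+y. (\<integral>\<^sup>+x. ?i A (f x - y) * ?i ?B (f x) \<partial>lborel) \<partial>lborel)"
    proof (rule nn_integral_cong)
      fix y
      have "(\<integral>\<^sup>+x. ?i A (f x) * ?i ?B (f x + y) \<partial>lborel) =
          (\<integral>\<^sup>+x. ?i A (f (g (- y) + x)) * ?i ?B (f (g (- y) + x) + y) \<partial>lborel)"
        by (rule lborel_nn_integral_translation[symmetric]) measurable
      then show "(\<integral>\<^sup>+x. ?i A (f x) * ?i ?B (f x + y) \<partial>lborel) = (\<integral>\<^sup>+x. ?i A (f x - y) * ?i ?B (f x) \<partial>lborel)"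
        by (simp add: linear_add[OF f] g)
    qed
    also have "\<dots> = (\<integral>\<^sup>+x. (\<integral>\<^sup>+y. ?i A (f x - y) * ?i ?B (f x) \<partial>lborel) \<partial>lborel)"
      by (rule lborel_pair.Fubini') measurable
    also have "\<dots> = (\<integral>\<^sup>+x. (\<integral>\<^sup>+y. ?i A (f x - y) \<partial>lborel) * ?i ?B (f x) \<partial>lborel)"
      by (simp add: nn_integral_multc)
    \<comment> \<open>The inner integral is the volume of a reflected and shifted copy of
      \<open>A\<close>, which does not depend on \<open>x\<close>; so the two factors
      separate.\<close>
    also have "\<dots> = (\<integral>\<^sup>+x. emeasure lborel A * ?i ?B (f x) \<partial>lborel)"
      by (subst lborel_nn_integral_reflect) auto
    also have "\<dots> = emeasure lborel A * emeasure lborel (f -` ?B)"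
      by (subst nn_integral_cmult) (simp_all add: pre)
    finally show ?thesis by (simp add: ac_simps)
  qed
  \<comment> \<open>The factor has to be finite to be a real number: the preimage of the box is
    contained in its image under the inverse map, hence bounded.\<close>
  have "bounded (g ` ?B)"
    using g(1) by (intro bounded_linear_image) (auto simp: linear_conv_bounded_linear)
  moreover have "f -` ?B \<subseteq> g ` ?B"
    by (metis g(3) image_eqI subsetI vimage_eq)
  ultimately have "bounded (f -` ?B)"
    using bounded_subset by blast
  then have "emeasure lborel (f -` ?B) < \<infinity>"
    by (rule emeasure_bounded_finite)
  then have fin: "emeasure lborel (f -` ?B) = ennreal (measure lborel (f -` ?B))"
    by (intro emeasure_eq_ennreal_measure) simp
  have "scales f (measure lborel (f -` ?B))"
    unfolding scales_def using *[unfolded fin] by (intro conjI ballI) simp_all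
  then show thesis
    by (rule that)
qed

section \<open>Volume factors of reflections, shears and stretches\<close>

lemma scales_id: "scales (\<lambda>x. x) 1"
  by (simp add: scales_def)

text \<open>The Householder reflection in the hyperplane orthogonal to \<open>v\<close>; for
  \<open>v = 0\<close> it is the identity.\<close>

definition reflect :: "'a::euclidean_space \<Rightarrow> 'a \<Rightarrow> 'a" where
  "reflect v x = x - (2 * (v \<bullet> x) / (v \<bullet> v)) *\<^sub>R v"

lemma linear_reflect: "linear (reflect v)"
  by (rule linearI) (simp_all add: reflect_def inner_add_right add_divide_distrib algebra_simps)

lemma reflect_reflect: "reflect v (reflect v x) = x"
  by (cases "v = 0") (simp_all add: reflect_def algebra_simps)

lemma norm_reflect: "norm (reflect v x) = norm x"
proof -
  have "reflect v x \<bullet> reflect v x = x \<bullet> x"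
    by (cases "v = 0") (simp_all add: reflect_def algebra_simps inner_commute power2_eq_square)
  then show ?thesis
    by (simp add: norm_eq_sqrt_inner)
qed

lemma reflect_inner: "reflect v x \<bullet> y = x \<bullet> reflect v y"
  by (simp add: reflect_def algebra_simps inner_commute)

text \<open>Equal norms give \<open>(a - b) \<bullet> (a - b) = 2 * ((a - b) \<bullet> a)\<close>,
  so exactly \<open>a - b\<close> is subtracted from \<open>a\<close>. Later this exchanges a unit
  normal with a coordinate vector.\<close>

lemma reflect_swap:
  assumes "norm a = norm b" shows "reflect (a - b) a = b"
proof (cases "a = b")
  case False
  have "a \<bullet> a = b \<bullet> b"
    using assms by (simp add: norm_eq)
  then have "(a - b) \<bullet> (a - b) = 2 * ((a - b) \<bullet> a)"
    by (simp add: algebra_simps inner_commute)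
  moreover have "(a - b) \<bullet> (a - b) \<noteq> 0"
    using False by (metis inner_eq_zero_iff right_minus_eq)
  ultimately have *: "2 * ((a - b) \<bullet> a) / ((a - b) \<bullet> (a - b)) = 1"
    by (metis divide_self)
  show ?thesis
    unfolding reflect_def * by simp
qed (simp add: reflect_def)

text \<open>The factor is read off a set that the map leaves invariant, the unit ball, whose volume
  is positive and finite.\<close>

lemma scales_reflect: "scales (reflect v) 1"
proof -
  obtain \<kappa> where \<kappa>: "scales (reflect v) \<kappa>"
    using linear_scales[OF linear_reflect linear_reflect, of v v] reflect_reflect by metis
  have "reflect v -` ball 0 1 = ball 0 1"
    by (auto simp: norm_reflect)
  then have "emeasure lborel (ball (0::'a) 1) = ennreal \<kappa> * emeasure lborel (ball (0::'a) 1)"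
    using \<kappa> unfolding scales_def by (metis borel_open open_ball)
  moreover have "emeasure lborel (ball (0::'a) 1) \<noteq> 0" "emeasure lborel (ball (0::'a) 1) \<noteq> \<infinity>"
    using emeasure_lborel_ball_finite[of "0::'a" 1] emeasure_lborel_box[of 0 "One::'a"]
    using less_imp_neq[OF unit_ball_vol_pos[of "real DIM('a)"]] by (auto simp: emeasure_ball)
  ultimately have "ennreal \<kappa> = 1"
    by (metis ennreal_mult_cancel_left infinity_ennreal_def mult.commute mult.right_neutral)
  then have "\<kappa> = 1"
    by simp
  then show ?thesis
    using \<kappa> by simp
qed

text \<open>Reflection in the hyperplane conjugates the shear into its inverse, so \<open>\<kappa>\<^sup>2 = 1\<close>.\<close>

lemma scales_shear:
  fixes n w :: "'a::euclidean_space"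
  assumes "norm n = 1" "n \<bullet> w = 0"
  shows "scales (\<lambda>x. x + (n \<bullet> x) *\<^sub>R w) 1"
proof -
  let ?S = "\<lambda>w x. x + (n \<bullet> x) *\<^sub>R (w::'a)"
  have nn: "n \<bullet> n = 1"
    using assms(1) by (simp add: norm_eq_1)
  have lin: "linear (?S w)" for w
    by (rule linearI) (simp_all add: algebra_simps)
  obtain \<kappa> where \<kappa>: "scales (?S w) \<kappa>"
    by (rule linear_scales[of "?S w" "?S (- w)"])
      (simp_all only: lin, use assms(2) in \<open>auto simp: algebra_simps\<close>)
  have "scales (\<lambda>x. reflect n (?S w (reflect n x))) (1 * (\<kappa> * 1))"
    by (intro scales_compose scales_reflect \<kappa>)
  then have \<kappa>': "scales (\<lambda>x. reflect n (?S w (reflect n x))) \<kappa>"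
    by simp
  have "(\<lambda>x. ?S w (reflect n (?S w (reflect n x)))) = (\<lambda>x. x)"
    using assms(2) nn by (auto simp: reflect_def algebra_simps)
  then have "scales (\<lambda>x::'a. x) (\<kappa> * \<kappa>)"
    using scales_compose[OF \<kappa> \<kappa>'] by (simp only:)
  then have "\<kappa> * \<kappa> = 1"
    using scales_unique[OF _ scales_id] by blast
  moreover have "\<kappa> \<ge> 0"
    using \<kappa> by (simp add: scales_def)
  ultimately have "\<kappa> = 1"
    by (metis abs_of_nonneg abs_square_eq_1 power2_eq_square)
  then show ?thesis
    using \<kappa> by simp
qed

text \<open>In a coordinate direction the map is diagonal, so its factor is the one of a
  coordinatewise scaling of Lebesgue measure; a general direction follows by conjugation.\<close>

lemma scales_stretch_Basis:
  fixes b :: "'a::euclidean_space"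
  assumes "b \<in> Basis" "s \<noteq> 0"
  shows "scales (\<lambda>x. x + ((s - 1) * (b \<bullet> x)) *\<^sub>R b) (1 / \<bar>s\<bar>)"
proof -
  let ?c = "\<lambda>j. if j = b then s else 1"
  let ?T = "\<lambda>x::'a. 0 + (\<Sum>j\<in>Basis. (?c j * (x \<bullet> j)) *\<^sub>R j)"
  have T: "?T = (\<lambda>x. x + ((s - 1) * (b \<bullet> x)) *\<^sub>R b)"
  proof
    fix x :: 'a
    have "?T x = (\<Sum>j\<in>Basis. (x \<bullet> j) *\<^sub>R j + (if j = b then ((s - 1) * (x \<bullet> b)) *\<^sub>R b else 0))"
      by (simp add: algebra_simps) (intro sum.cong, auto simp: algebra_simps)
    also have "\<dots> = (\<Sum>j\<in>Basis. (x \<bullet> j) *\<^sub>R j) + ((s - 1) * (x \<bullet> b)) *\<^sub>R b"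
      using assms(1) by (simp add: sum.distrib)
    also have "\<dots> = x + ((s - 1) * (b \<bullet> x)) *\<^sub>R b"
      using euclidean_representation[of x] by (simp add: inner_commute)
    finally show "?T x = x + ((s - 1) * (b \<bullet> x)) *\<^sub>R b" .
  qed
  have "(\<Prod>j\<in>Basis. \<bar>?c j\<bar>) = \<bar>s\<bar>"
    using assms(1) by (simp add: if_distrib[of abs] cong: if_cong)
  then have L: "lborel = density (distr lborel borel ?T) (\<lambda>_. \<bar>s\<bar>)"
    using lborel_affine_euclidean[of ?c 0] assms(2) by simp
  have [measurable]: "?T \<in> borel_measurable borel"
    by measurable
  have "emeasure lborel (?T -` A) = ennreal (1 / \<bar>s\<bar>) * emeasure lborel A"
    if [measurable]: "A \<in> sets borel" for A
  proof -
    have "emeasure lborel A = ennreal \<bar>s\<bar> * emeasure lborel (?T -` A)"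
      by (subst L) (simp add: emeasure_density emeasure_distr nn_integral_cmult_indicator)
    then show ?thesis
      using assms(2) by (simp add: mult.assoc[symmetric] ennreal_mult[symmetric])
  qed
  then show ?thesis
    unfolding scales_def T[symmetric] by auto
qed

text \<open>Conjugation with the reflection that swaps \<open>n\<close> and a coordinate vector
  turns this into the coordinate stretch, and reflections have factor 1.\<close>

lemma scales_stretch:
  fixes n :: "'a::euclidean_space"
  assumes "norm n = 1" "s \<noteq> 0"
  shows "scales (\<lambda>x. x + ((s - 1) * (n \<bullet> x)) *\<^sub>R n) (1 / \<bar>s\<bar>)"
proof -
  obtain b :: 'a where b: "b \<in> Basis"
    using nonempty_Basis by blast
  let ?U = "reflect (n - b)"
  have U: "?U n = b" "?U b = n"
    using reflect_swap[of n b] reflect_reflect[of "n - b" n] assms(1) b by auto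
  have "scales (\<lambda>x. ?U (?U x + ((s - 1) * (b \<bullet> ?U x)) *\<^sub>R b)) (1 * (1 / \<bar>s\<bar> * 1))"
    using scales_compose[OF scales_reflect scales_compose[OF scales_stretch_Basis[OF b assms(2)] scales_reflect]] .
  moreover have "?U (?U x + ((s - 1) * (b \<bullet> ?U x)) *\<^sub>R b) = x + ((s - 1) * (n \<bullet> x)) *\<^sub>R n" for x
    using linear_reflect[of "n - b"] U reflect_inner[of "n - b" b x]
    by (simp add: linear_add linear_cmul reflect_reflect)
  ultimately show ?thesis
    by simp
qed

text \<open>The map fixes the hyperplane orthogonal to \<open>n\<close> and sends \<open>n\<close>
  to \<open>- e\<close>, so its determinant is \<open>- (n \<bullet> e)\<close>. It is a stretch
  along \<open>n\<close> followed by a shear.\<close>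

lemma scales_slant:
  fixes n e :: "'a::euclidean_space"
  assumes "norm n = 1" "n \<bullet> e \<noteq> 0"
  shows "scales (\<lambda>x. x - (n \<bullet> x) *\<^sub>R (n + e)) (1 / \<bar>n \<bullet> e\<bar>)"
proof -
  \<comment> \<open>\<open>s\<close> is the \<open>n\<close>-component of the target
    \<open>- e\<close>, and \<open>w\<close> is chosen so that stretching and then shearing sends
    \<open>n\<close> to \<open>s n + s w = - e\<close>.\<close>
  define s where "s = - (n \<bullet> e)"
  define w where "w = (- 1 / s) *\<^sub>R (e + s *\<^sub>R n)"
  have nn: "n \<bullet> n = 1"
    using assms(1) by (simp add: norm_eq_1)
  have s: "s \<noteq> 0"
    using assms(2) by (simp add: s_def)
  have "n \<bullet> w = 0"
    using nn by (simp add: w_def inner_add_right inner_diff_right s_def)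
  then have "scales (\<lambda>x. (x + ((s - 1) * (n \<bullet> x)) *\<^sub>R n) + (n \<bullet> (x + ((s - 1) * (n \<bullet> x)) *\<^sub>R n)) *\<^sub>R w)
      (1 * (1 / \<bar>s\<bar>))"
    using scales_compose[OF scales_shear[OF assms(1)] scales_stretch[OF assms(1) s]] by blast
  moreover have "(x + ((s - 1) * (n \<bullet> x)) *\<^sub>R n) + (n \<bullet> (x + ((s - 1) * (n \<bullet> x)) *\<^sub>R n)) *\<^sub>R w =
      x - (n \<bullet> x) *\<^sub>R (n + e)" for x
  proof -
    have "n \<bullet> (x + ((s - 1) * (n \<bullet> x)) *\<^sub>R n) = s * (n \<bullet> x)"
      using nn by (simp add: inner_add_right algebra_simps)
    moreover have "(s * (n \<bullet> x)) *\<^sub>R w = - (n \<bullet> x) *\<^sub>R (e + s *\<^sub>R n)"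
      using s by (simp add: w_def)
    ultimately show ?thesis
      by (simp add: algebra_simps)
  qed
  ultimately have "scales (\<lambda>x. x - (n \<bullet> x) *\<^sub>R (n + e)) (1 * (1 / \<bar>s\<bar>))"
    by (simp only:)
  then show ?thesis
    by (simp add: s_def)
qed

lemma scales_nn_integral:
  fixes g :: "'a::euclidean_space \<Rightarrow> ennreal"
  assumes f: "scales f \<kappa>" and [measurable]: "g \<in> borel_measurable borel"
  shows "(\<integral>\<^sup>+x. g (f x) \<partial>lborel) = ennreal \<kappa> * (\<integral>\<^sup>+x. g x \<partial>lborel)"
proof -
  note [measurable] = scales_measurable[OF f]
  have "distr lborel borel f = scale_measure (ennreal \<kappa>) lborel"
    using f by (intro measure_eqI) (auto simp: emeasure_distr scales_def)
  moreover have "(\<integral>\<^sup>+x. g (f x) \<partial>lborel) = (\<integral>\<^sup>+x. g x \<partial>(distr lborel borel f))"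
    by (rule nn_integral_distr[symmetric]) auto
  ultimately show ?thesis
    by (simp add: nn_integral_scale_measure)
qed

section \<open>Surface measure\<close>

text \<open>For a unit vector \<open>n\<close> this is the orthogonal projection onto the hyperplane
  at level \<open>c\<close>; it is the map inside \<open>hyperplane_measure\<close>.\<close>

definition foot :: "'a::euclidean_space \<Rightarrow> real \<Rightarrow> 'a \<Rightarrow> 'a" where
  "foot n c x = x - (n \<bullet> x - c) *\<^sub>R n"

lemma continuous_on_foot: "continuous_on S (foot n c)"
  unfolding foot_def[abs_def] by (intro continuous_intros)

lemma measurable_foot [measurable]: "foot n c \<in> borel_measurable borel"
  by (simp add: continuous_on_foot borel_measurable_continuous_onI)

lemma foot_on: "norm n = 1 \<Longrightarrow> n \<bullet> foot n c x = c"
  by (simp add: foot_def inner_diff_right norm_eq_1)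

lemma foot_id: "n \<bullet> x = c \<Longrightarrow> foot n c x = x"
  by (simp add: foot_def)

abbreviation strip :: "'a::euclidean_space \<Rightarrow> real \<Rightarrow> 'a set" where
  "strip n c \<equiv> {x. c \<le> n \<bullet> x \<and> n \<bullet> x \<le> c + 1}"

lemma sets_hyperplane_measure [simp, measurable_cong]: "sets (hyperplane_measure n c) = sets borel"
  by (simp add: hyperplane_measure_def)

lemma space_hyperplane_measure [simp]: "space (hyperplane_measure n c) = UNIV"
  by (simp add: hyperplane_measure_def)

lemma hyperplane_measure_eq:
  "hyperplane_measure n c = distr (restrict_space lborel (strip n c)) borel (foot n c)"
  by (simp add: hyperplane_measure_def foot_def[abs_def])

lemma nn_integral_hyperplane_measure:
  assumes [measurable]: "g \<in> borel_measurable borel"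
  shows "(\<integral>\<^sup>+z. g z \<partial>hyperplane_measure n c) =
    (\<integral>\<^sup>+x. g (foot n c x) * indicator (strip n c) x \<partial>lborel)"
proof -
  have "(\<integral>\<^sup>+z. g z \<partial>hyperplane_measure n c) =
      (\<integral>\<^sup>+x. g (foot n c x) \<partial>restrict_space lborel (strip n c))"
    unfolding hyperplane_measure_eq by (rule nn_integral_distr) (auto intro: measurable_restrict_space1)
  also have "\<dots> = (\<integral>\<^sup>+x. g (foot n c x) * indicator (strip n c) x \<partial>lborel)"
    by (rule nn_integral_restrict_space) measurable
  finally show ?thesis .
qed

lemma emeasure_hyperplane_measure:
  assumes [measurable]: "A \<in> sets borel"
  shows "emeasure (hyperplane_measure n c) A = emeasure lborel {x. x \<in> strip n c \<and> foot n c x \<in> A}"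
proof -
  have "emeasure (hyperplane_measure n c) A = (\<integral>\<^sup>+z. indicator A z \<partial>hyperplane_measure n c)"
    by simp
  also have "\<dots> = (\<integral>\<^sup>+x. indicator {x. x \<in> strip n c \<and> foot n c x \<in> A} x \<partial>lborel)"
    by (subst nn_integral_hyperplane_measure) (auto intro!: nn_integral_cong simp del: nn_integral_indicator split: split_indicator)
  also have "\<dots> = emeasure lborel {x. x \<in> strip n c \<and> foot n c x \<in> A}"
    by (rule nn_integral_indicator) measurable
  finally show ?thesis .
qed

text \<open>The line through \<open>y\<close> in direction \<open>e\<close> meets the hyperplane at time \<open>t y\<close>.\<close>

lemma distr_slanted_prism:
  fixes n e :: "'a::euclidean_space" and c :: real
  assumes n: "norm n = 1" and e: "n \<bullet> e \<noteq> 0"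
  defines "t \<equiv> \<lambda>y. (c - n \<bullet> y) / (n \<bullet> e)"
  shows "distr (restrict_space lborel {y. 0 \<le> t y \<and> t y \<le> 1}) borel (\<lambda>y. y + t y *\<^sub>R e) =
    density (hyperplane_measure n c) (\<lambda>_. ennreal \<bar>n \<bullet> e\<bar>)"
proof (rule measure_eqI)
  let ?S = "{y. 0 \<le> t y \<and> t y \<le> 1}"
  let ?Z = "\<lambda>y. y + t y *\<^sub>R e"
  have [measurable]: "t \<in> borel_measurable borel"
    unfolding t_def by measurable
  fix A assume "A \<in> sets (distr (restrict_space lborel ?S) borel ?Z)"
  then have [measurable]: "A \<in> sets borel" by simp
  let ?G = "\<lambda>y. indicator A (?Z y) * indicator ?S y :: ennreal"
  \<comment> \<open>A point at height \<open>r\<close> above the hyperplane is sent to the point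
    that reaches the same foot after travelling for time \<open>r\<close> along \<open>e\<close>. So
    the straight prism becomes the slanted one.\<close>
  let ?\<Phi> = "\<lambda>x. c *\<^sub>R (n + e) + (x - (n \<bullet> x) *\<^sub>R (n + e))"
  have "emeasure (distr (restrict_space lborel ?S) borel ?Z) A =
      (\<integral>\<^sup>+y. indicator A y \<partial>distr (restrict_space lborel ?S) borel ?Z)"
    by simp
  also have "\<dots> = (\<integral>\<^sup>+y. indicator A (?Z y) \<partial>restrict_space lborel ?S)"
    by (rule nn_integral_distr) (auto intro: measurable_restrict_space1)
  also have "\<dots> = (\<integral>\<^sup>+y. ?G y \<partial>lborel)"
    by (rule nn_integral_restrict_space) measurable
  \<comment> \<open>The factor 1 is split into \<open>\<bar>n \<bullet> e\<bar>\<close> and its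
    reciprocal; the latter is the volume factor of the linear part of \<open>?\<Phi>\<close> and is
    absorbed by the change of variables.\<close>
  also have "\<dots> = ennreal (\<bar>n \<bullet> e\<bar> * (1 / \<bar>n \<bullet> e\<bar>)) * (\<integral>\<^sup>+y. ?G (c *\<^sub>R (n + e) + y) \<partial>lborel)"
    using e lborel_nn_integral_translation[of ?G "c *\<^sub>R (n + e)"] by simp
  also have "\<dots> = ennreal \<bar>n \<bullet> e\<bar> * (ennreal (1 / \<bar>n \<bullet> e\<bar>) * (\<integral>\<^sup>+y. ?G (c *\<^sub>R (n + e) + y) \<partial>lborel))"
    by (subst ennreal_mult) (simp_all add: mult.assoc)
  also have "ennreal (1 / \<bar>n \<bullet> e\<bar>) * (\<integral>\<^sup>+y. ?G (c *\<^sub>R (n + e) + y) \<partial>lborel) = (\<integral>\<^sup>+x. ?G (?\<Phi> x) \<partial>lborel)"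
    by (rule scales_nn_integral[OF scales_slant[OF n e], symmetric]) measurable
  also have "\<dots> = (\<integral>\<^sup>+x. indicator A (foot n c x) * indicator (strip n c) x \<partial>lborel)"
  proof (rule nn_integral_cong)
    fix x
    have "c - n \<bullet> ?\<Phi> x = (n \<bullet> x - c) * (n \<bullet> e)"
      using n by (simp add: inner_add_right inner_diff_right norm_eq_1 algebra_simps)
    then have t: "t (?\<Phi> x) = n \<bullet> x - c"
      using e by (simp add: t_def)
    have Z: "?Z (?\<Phi> x) = foot n c x"
      unfolding t by (simp add: foot_def algebra_simps)
    show "?G (?\<Phi> x) = indicator A (foot n c x) * indicator (strip n c) x"
      unfolding Z by (auto simp: t split: split_indicator)
  qed
  also have "\<dots> = emeasure (hyperplane_measure n c) A"
    by (subst nn_integral_hyperplane_measure[symmetric]) auto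
  also have "ennreal \<bar>n \<bullet> e\<bar> * emeasure (hyperplane_measure n c) A =
      emeasure (density (hyperplane_measure n c) (\<lambda>_. ennreal \<bar>n \<bullet> e\<bar>)) A"
    by (subst emeasure_density) (auto simp: nn_integral_cmult_indicator)
  finally show "emeasure (distr (restrict_space lborel ?S) borel ?Z) A =
      emeasure (density (hyperplane_measure n c) (\<lambda>_. ennreal \<bar>n \<bullet> e\<bar>)) A" .
qed simp

lemma hyperplane_null: "(a::'a::euclidean_space) \<noteq> 0 \<Longrightarrow> {x. a \<bullet> x = b} \<in> null_sets lborel"
  using negligible_hyperplane[of a b]
  by (simp add: negligible_iff_null_sets null_sets_completion_iff)

text \<open>The component \<open>a\<close> of \<open>m\<close> orthogonal to \<open>n\<close> is
  nonzero, and the part of the prism that lies over the second hyperplane is contained in a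
  hyperplane with normal \<open>a\<close>, a null set.\<close>

lemma hyperplane_measure_other_hyperplane:
  fixes m n :: "'a::euclidean_space"
  assumes "norm n = 1" "norm m = 1" "m \<noteq> n" "m \<noteq> - n"
  shows "{x. m \<bullet> x = c'} \<in> null_sets (hyperplane_measure n c)"
proof -
  define a where "a = m - (m \<bullet> n) *\<^sub>R n"
  have "a \<noteq> 0"
  proof
    assume "a = 0"
    then have m: "m = (m \<bullet> n) *\<^sub>R n" by (simp add: a_def)
    then have "norm m = \<bar>m \<bullet> n\<bar> * norm n"
      by (metis norm_scaleR)
    then have "\<bar>m \<bullet> n\<bar> = 1"
      using assms by simp
    then show False
      using m assms(3,4) by (cases "m \<bullet> n \<ge> 0") auto
  qed
  then have null: "{x. a \<bullet> x = c' - c * (m \<bullet> n)} \<in> null_sets lborel"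
    by (rule hyperplane_null)
  have "{x. x \<in> strip n c \<and> foot n c x \<in> {x. m \<bullet> x = c'}} \<subseteq> {x. a \<bullet> x = c' - c * (m \<bullet> n)}"
    by (auto simp: foot_def a_def algebra_simps)
  moreover have "{x. x \<in> strip n c \<and> foot n c x \<in> {x. m \<bullet> x = c'}} \<in> sets lborel"
    by (simp, measurable)
  ultimately have "emeasure lborel {x. x \<in> strip n c \<and> foot n c x \<in> {x. m \<bullet> x = c'}} = 0"
    using null null_sets_subset by blast
  then show ?thesis
    by (auto simp: emeasure_hyperplane_measure)
qed

definition relatively_interior :: "'a::euclidean_space \<Rightarrow> real \<Rightarrow> 'a set \<Rightarrow> 'a set" where
  "relatively_interior n c P = {z. \<exists>\<epsilon>>0. {y. n \<bullet> y = c} \<inter> ball z \<epsilon> \<subseteq> P}"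

lemma open_relatively_interior: "open (relatively_interior n c P)"
proof (rule openI)
  fix z assume "z \<in> relatively_interior n c P"
  then obtain \<epsilon> where \<epsilon>: "\<epsilon> > 0" "{y. n \<bullet> y = c} \<inter> ball z \<epsilon> \<subseteq> P"
    by (auto simp: relatively_interior_def)
  have "ball w (\<epsilon> / 2) \<subseteq> ball z \<epsilon>" if "w \<in> ball z (\<epsilon> / 2)" for w
    using that dist_triangle_half_r[of w z \<epsilon>] by (auto simp: dist_commute)
  then have "ball z (\<epsilon> / 2) \<subseteq> relatively_interior n c P"
    using \<epsilon> unfolding relatively_interior_def
    by (intro subsetI CollectI exI[of _ "\<epsilon> / 2"]) auto
  then show "\<exists>e>0. ball z e \<subseteq> relatively_interior n c P"
    using \<epsilon>(1) half_gt_zero by blast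
qed

text \<open>The prism over a convex set is convex, so its boundary is negligible.\<close>

lemma convex_minus_relatively_interior_null:
  fixes n :: "'a::euclidean_space"
  assumes n: "norm n = 1" and P: "convex P" "closed P"
  shows "P - relatively_interior n c P \<in> null_sets (hyperplane_measure n c)"
proof -
  let ?Q = "{x. x \<in> strip n c \<and> foot n c x \<in> P}"
  have Q: "?Q = strip n c \<inter> foot n c -` P"
    by auto
  have "convex ?Q"
  proof (rule convexI)
    fix x y u v assume *: "x \<in> ?Q" "y \<in> ?Q" "0 \<le> u" "0 \<le> v" "u + v = (1::real)"
    have "u *\<^sub>R x + v *\<^sub>R y \<in> strip n c"
      using * convexD[OF convex_Int[OF convex_halfspace_ge[of c n] convex_halfspace_le[of n "c + 1"]]]
      by (simp add: Int_def)
    moreover have "foot n c (u *\<^sub>R x + v *\<^sub>R y) = u *\<^sub>R foot n c x + v *\<^sub>R foot n c y"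
    proof -
      have "v = 1 - u" using *(5) by simp
      then show ?thesis
        by (simp only: foot_def) (simp add: algebra_simps)
    qed
    ultimately show "u *\<^sub>R x + v *\<^sub>R y \<in> ?Q"
      using * convexD[OF P(1)] by auto
  qed
  then have "negligible (frontier ?Q)"
    by (rule negligible_convex_frontier)
  then have fr: "frontier ?Q \<in> null_sets lborel"
    by (simp add: negligible_iff_null_sets null_sets_completion_iff)
  have sub: "{x. x \<in> strip n c \<and> foot n c x \<in> P - relatively_interior n c P} \<subseteq> frontier ?Q"
  proof
    fix x assume x: "x \<in> {x. x \<in> strip n c \<and> foot n c x \<in> P - relatively_interior n c P}"
    have "x \<notin> interior ?Q"
    proof
      assume "x \<in> interior ?Q"
      then obtain \<epsilon> where \<epsilon>: "\<epsilon> > 0" "ball x \<epsilon> \<subseteq> ?Q"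
        by (meson mem_interior)
      \<comment> \<open>Raising \<open>w\<close> by the height of \<open>x\<close> above the plane
        preserves distances, so the ball around \<open>x\<close> inside the prism yields a relative
        ball around the foot inside \<open>P\<close>.\<close>
      have "w \<in> P" if w: "n \<bullet> w = c" "w \<in> ball (foot n c x) \<epsilon>" for w
      proof -
        let ?w = "w + (n \<bullet> x - c) *\<^sub>R n"
        have "dist x ?w = dist (foot n c x) w"
          by (simp add: foot_def dist_norm algebra_simps)
        then have "?w \<in> ball x \<epsilon>"
          using w(2) by simp
        then have "?w \<in> ?Q"
          by (rule subsetD[OF \<epsilon>(2)])
        moreover have "foot n c ?w = w"
          using n w(1) by (simp add: foot_def inner_add_right norm_eq_1)
        ultimately show ?thesis by auto
      qed
      then have "foot n c x \<in> relatively_interior n c P"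
        using \<epsilon>(1) by (auto simp: relatively_interior_def)
      then show False
        using x by auto
    qed
    moreover have "x \<in> closure ?Q"
    proof (rule subsetD[OF closure_subset])
      show "x \<in> ?Q" using x by simp
    qed
    ultimately show "x \<in> frontier ?Q"
      by (simp add: frontier_def)
  qed
  have meas: "P - relatively_interior n c P \<in> sets borel"
    using P(2) borel_open[OF open_relatively_interior] by (intro sets.Diff) auto
  note [measurable] = borel_closed[OF P(2)] borel_open[OF open_relatively_interior]
  have "{x. x \<in> strip n c \<and> foot n c x \<in> P - relatively_interior n c P} \<in> sets lborel"
    by (simp, measurable)
  then have "emeasure lborel {x. x \<in> strip n c \<and> foot n c x \<in> P - relatively_interior n c P} = 0"
    using fr sub null_sets_subset by blast
  then show ?thesis
    using meas by (auto simp: emeasure_hyperplane_measure)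
qed

text \<open>A point relatively interior to one of the polytopes is relatively interior to their
  union, so the exceptional set is covered by those of the finitely many pieces.\<close>

lemma polyhedral_minus_relatively_interior_null:
  fixes n :: "'a::euclidean_space"
  assumes n: "norm n = 1" and F: "polyhedral_set F"
  shows "F - relatively_interior n c F \<in> null_sets (hyperplane_measure n c)"
proof -
  obtain \<P> where P: "finite \<P>" "\<And>P. P \<in> \<P> \<Longrightarrow> polytope P" "F = \<Union>\<P>"
    using F by (auto simp: polyhedral_set_def)
  have "(\<Union>P\<in>\<P>. P - relatively_interior n c P) \<in> null_sets (hyperplane_measure n c)"
    using P n by (intro null_sets_UN' countable_finite convex_minus_relatively_interior_null)
      (auto simp: polytope_imp_convex polytope_imp_closed)
  moreover have "F - relatively_interior n c F \<subseteq> (\<Union>P\<in>\<P>. P - relatively_interior n c P)"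
    unfolding P(3) by (force simp: relatively_interior_def)
  moreover have "F - relatively_interior n c F \<in> sets (hyperplane_measure n c)"
  proof -
    have "closed F"
      unfolding P(3) using P(1,2) by (intro closed_Union) (auto simp: polytope_imp_closed)
    then show ?thesis
      using borel_open[OF open_relatively_interior] by (simp, intro sets.Diff) auto
  qed
  ultimately show ?thesis
    using null_sets_subset by blast
qed

section \<open>Faces: their planes, normals and null sets\<close>

definition face_normal :: "'a::euclidean_space set \<Rightarrow> 'a" where
  "face_normal F = (SOME n. unit_normal F n)"

definition face_level :: "'a::euclidean_space set \<Rightarrow> real" where
  "face_level F = face_normal F \<bullet> (SOME x. x \<in> F)"

text \<open>What a mesh face provides on its own, without reference to the mesh around it; its
  surface measure is then finite and nonzero.\<close>

definition face :: "'a::euclidean_space set \<Rightarrow> bool" where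
  "face F \<longleftrightarrow> closed F \<and> bounded F \<and> polyhedral_set F \<and> (\<exists>n. unit_normal F n) \<and>
     0 < emeasure (surface_measure F) F"

abbreviation face_plane_measure :: "'a::euclidean_space set \<Rightarrow> 'a measure" where
  "face_plane_measure F \<equiv> hyperplane_measure (face_normal F) (face_level F)"

lemma surface_measure_eq: "surface_measure F = restrict_space (face_plane_measure F) F"
  by (simp add: surface_measure_def face_normal_def face_level_def Let_def)

lemma space_surface_measure [simp]: "space (surface_measure F) = F"
  by (simp add: surface_measure_eq space_restrict_space)

lemma measurable_surface_measure: "f \<in> borel_measurable borel \<Longrightarrow> f \<in> borel_measurable (surface_measure F)"
  unfolding surface_measure_eq by (intro measurable_restrict_space1) simp

lemma face_closed: "face F \<Longrightarrow> closed F"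
  and face_bounded: "face F \<Longrightarrow> bounded F"
  and face_borel: "face F \<Longrightarrow> F \<in> sets borel"
  by (simp_all add: face_def)

lemma unit_normal_face_normal: "face F \<Longrightarrow> unit_normal F (face_normal F)"
  unfolding face_normal_def face_def by (blast intro: someI_ex)

lemma norm_face_normal: "face F \<Longrightarrow> norm (face_normal F) = 1"
  using unit_normal_face_normal by (auto simp: unit_normal_def)

lemma face_nonempty: "face F \<Longrightarrow> F \<noteq> {}"
  by (auto simp: face_def)

lemma face_level: "face F \<Longrightarrow> x \<in> F \<Longrightarrow> face_normal F \<bullet> x = face_level F"
  unfolding face_level_def
  by (rule someI2[of "\<lambda>x. x \<in> F" x]) (use unit_normal_face_normal in \<open>auto simp: unit_normal_def\<close>)

lemma AE_surface_measure_iff: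
  assumes "face F"
  shows "(AE x in surface_measure F. P x) \<longleftrightarrow> (AE x in face_plane_measure F. x \<in> F \<longrightarrow> P x)"
  unfolding surface_measure_eq using face_borel[OF assms] by (intro AE_restrict_space_iff) auto

lemma emeasure_surface_measure: "face F \<Longrightarrow> emeasure (surface_measure F) F = emeasure (face_plane_measure F) F"
  unfolding surface_measure_eq by (rule emeasure_restrict_space) (auto simp: face_borel)

lemma face_not_null: "face F \<Longrightarrow> F \<notin> null_sets (face_plane_measure F)"
  using emeasure_surface_measure[of F] by (auto simp: face_def)

text \<open>Positive surface measure turns an almost-everywhere statement into a witness.\<close>

lemma AE_surface_measure_ex:
  assumes "face F" "AE x in surface_measure F. P x"
  obtains x where "x \<in> F" "P x"
proof -
  have "\<exists>x\<in>F. P x"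
  proof (rule ccontr)
    assume *: "\<not> (\<exists>x\<in>F. P x)"
    have "AE x in face_plane_measure F. x \<notin> F"
      using assms(2) unfolding AE_surface_measure_iff[OF assms(1)]
      by eventually_elim (use * in auto)
    then have "F \<in> null_sets (face_plane_measure F)"
      using face_borel[OF assms(1)] by (subst (asm) AE_iff_null_sets[symmetric]) auto
    then show False
      using face_not_null assms(1) by blast
  qed
  then show thesis
    using that by blast
qed

lemma finite_surface_measure:
  assumes "face F"
  shows "finite_measure (surface_measure F)"
proof (rule finite_measureI)
  let ?n = "face_normal F" and ?c = "face_level F"
  obtain B where B: "\<And>x. x \<in> F \<Longrightarrow> norm x \<le> B"
    using face_bounded[OF assms] by (auto simp: bounded_iff)
  \<comment> \<open>A point of the prism has its foot in \<open>F\<close>, of norm at most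
    \<open>B\<close>, and lies at height at most 1 above it.\<close>
  have "{x. x \<in> strip ?n ?c \<and> foot ?n ?c x \<in> F} \<subseteq> cball 0 (B + 1)"
  proof clarsimp
    fix x assume x: "?c \<le> ?n \<bullet> x" "?n \<bullet> x \<le> ?c + 1" "foot ?n ?c x \<in> F"
    have "x = foot ?n ?c x + (?n \<bullet> x - ?c) *\<^sub>R ?n"
      by (simp add: foot_def)
    then have "norm x \<le> norm (foot ?n ?c x) + \<bar>?n \<bullet> x - ?c\<bar> * norm ?n"
      by (metis norm_triangle_ineq norm_scaleR)
    also have "\<dots> \<le> B + 1"
      using x B[OF x(3)] norm_face_normal[OF assms] by simp
    finally show "norm x \<le> B + 1" .
  qed
  then have "emeasure lborel {x. x \<in> strip ?n ?c \<and> foot ?n ?c x \<in> F} < \<infinity>"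
    by (intro emeasure_bounded_finite bounded_subset[OF bounded_cball])
  then show "emeasure (surface_measure F) (space (surface_measure F)) \<noteq> \<infinity>"
    using face_borel[OF assms]
    by (simp add: emeasure_surface_measure[OF assms] emeasure_hyperplane_measure)
qed

text \<open>With a third unit normal the face would lie in two non-parallel hyperplanes and be a
  null set, against its positive measure.\<close>

lemma face_unit_normal_cases:
  assumes F: "face F" and m: "unit_normal F m"
  shows "m = face_normal F \<or> m = - face_normal F"
proof (rule ccontr)
  assume *: "\<not> ?thesis"
  obtain x where x: "x \<in> F"
    using face_nonempty[OF F] by auto
  have sub: "F \<subseteq> {y. m \<bullet> y = m \<bullet> x}"
    using m x unfolding unit_normal_def by blast
  have "{y. m \<bullet> y = m \<bullet> x} \<in> null_sets (face_plane_measure F)"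
    using * m norm_face_normal[OF F]
    by (intro hyperplane_measure_other_hyperplane) (auto simp: unit_normal_def)
  then have "F \<in> null_sets (face_plane_measure F)"
    by (rule null_sets_subset) (simp_all only: sets_hyperplane_measure face_borel[OF F] sub)
  then show False
    using face_not_null[OF F] by blast
qed

lemma face_relatively_interior_null:
  assumes "face F"
  shows "F - relatively_interior (face_normal F) (face_level F) F \<in> null_sets (face_plane_measure F)"
  using assms norm_face_normal by (intro polyhedral_minus_relatively_interior_null) (auto simp: face_def)

lemma relatively_interior_subset_rel_interior:
  assumes "F \<subseteq> {x. n \<bullet> x = c}"
  shows "F \<inter> relatively_interior n c F \<subseteq> rel_interior F"
proof
  fix z assume z: "z \<in> F \<inter> relatively_interior n c F"
  then obtain \<epsilon> where \<epsilon>: "\<epsilon> > 0" "{y. n \<bullet> y = c} \<inter> ball z \<epsilon> \<subseteq> F"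
    by (auto simp: relatively_interior_def)
  have "affine hull F \<subseteq> {x. n \<bullet> x = c}"
    using assms by (intro hull_minimal affine_hyperplane)
  then show "z \<in> rel_interior F"
    using z \<epsilon> unfolding mem_rel_interior_ball by blast
qed

text \<open>If the faces are coplanar, a common point cannot be relatively interior to both, and
  relative boundaries are null. If their planes are parallel but distinct, they do not meet;
  otherwise the second plane cuts a null set out of the first.\<close>

lemma faces_overlap_null:
  assumes F: "face F" "face F'" and disj: "rel_interior F \<inter> rel_interior F' = {}"
  shows "AE x in surface_measure F. x \<notin> F'"
proof -
  let ?n = "face_normal F" and ?c = "face_level F" and ?m = "face_normal F'" and ?d = "face_level F'"
  have "F \<inter> F' \<in> null_sets (face_plane_measure F)"
  proof (cases "F' \<subseteq> {x. ?n \<bullet> x = ?c}")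
    case True
    have F': "F' - relatively_interior ?n ?c F' \<in> null_sets (face_plane_measure F)"
      using F norm_face_normal by (intro polyhedral_minus_relatively_interior_null) (auto simp: face_def)
    have "F \<subseteq> {x. ?n \<bullet> x = ?c}"
      using face_level[OF F(1)] by auto
    then have "F \<inter> F' \<subseteq> (F - relatively_interior ?n ?c F) \<union> (F' - relatively_interior ?n ?c F')"
      using relatively_interior_subset_rel_interior[of F ?n ?c]
        relatively_interior_subset_rel_interior[OF True] disj by blast
    moreover have "(F - relatively_interior ?n ?c F) \<union> (F' - relatively_interior ?n ?c F')
        \<in> null_sets (face_plane_measure F)"
      using face_relatively_interior_null[OF F(1)] F' by auto
    ultimately show ?thesis
      using null_sets_subset[of _ "face_plane_measure F" "F \<inter> F'"] face_borel F by auto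
  next
    case False
    show ?thesis
    proof (cases "?m = ?n \<or> ?m = - ?n")
      case True
      have "F' \<subseteq> {x. ?n \<bullet> x = ?c}" if x: "x \<in> F" "x \<in> F'" for x
      proof
        fix y assume "y \<in> F'"
        then have "?m \<bullet> y = ?m \<bullet> x"
          using face_level[OF F(2)] x by auto
        then have "?n \<bullet> y = ?n \<bullet> x"
          using True by auto
        then show "y \<in> {x. ?n \<bullet> x = ?c}"
          using face_level[OF F(1) x(1)] by simp
      qed
      then have "F \<inter> F' = {}"
        using False by blast
      then show ?thesis by simp
    next
      case neq: False
      have "{x. ?m \<bullet> x = ?d} \<in> null_sets (face_plane_measure F)"
        using neq norm_face_normal F by (intro hyperplane_measure_other_hyperplane) auto
      moreover have "F \<inter> F' \<subseteq> {x. ?m \<bullet> x = ?d}"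
        using face_level[OF F(2)] by auto
      ultimately show ?thesis
        using null_sets_subset[of _ "face_plane_measure F" "F \<inter> F'"] face_borel F by auto
    qed
  qed
  then have "AE x in face_plane_measure F. x \<notin> F \<inter> F'"
    by (rule AE_not_in)
  then show ?thesis
    unfolding AE_surface_measure_iff[OF F(1)] by eventually_elim auto
qed

text \<open>Composed with the projection onto the plane, \<open>p\<close> becomes a polynomial on
  the whole space that vanishes almost everywhere on an open part of the prism over
  \<open>F\<close>, which reduces the claim to the case of open sets.\<close>

lemma face_polynomial_eq_0:
  fixes p :: "'a::euclidean_space \<Rightarrow> real"
  assumes F: "face F" and p: "real_polynomial_function p" and ae: "AE x in surface_measure F. p x = 0"
    and x: "x \<in> F"
  shows "p x = 0"
proof -
  let ?n = "face_normal F" and ?c = "face_level F"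
  have cont: "continuous_on UNIV p"
    using p by (simp add: continuous_at_imp_continuous_on continuous_real_polymonial_function)
  then have [measurable]: "p \<in> borel_measurable borel"
    by (rule borel_measurable_continuous_onI)
  note [measurable] = face_borel[OF F]
  have "{z \<in> F. p z \<noteq> 0} \<in> null_sets (face_plane_measure F)"
  proof -
    have "AE z in face_plane_measure F. z \<notin> {z \<in> F. p z \<noteq> 0}"
      using ae unfolding AE_surface_measure_iff[OF F] by eventually_elim auto
    then show ?thesis
      by (subst (asm) AE_iff_null_sets[symmetric]) auto
  qed
  then have "emeasure lborel {x. x \<in> strip ?n ?c \<and> foot ?n ?c x \<in> {z \<in> F. p z \<noteq> 0}} = 0"
    by (subst emeasure_hyperplane_measure[symmetric]) auto
  moreover have "{x. x \<in> strip ?n ?c \<and> foot ?n ?c x \<in> {z \<in> F. p z \<noteq> 0}} \<in> sets lborel"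
    by (simp, measurable)
  ultimately have "AE x in lborel. x \<notin> {x. x \<in> strip ?n ?c \<and> foot ?n ?c x \<in> {z \<in> F. p z \<noteq> 0}}"
    by (intro AE_not_in) auto
  then have ae': "AE x in lborel. x \<in> strip ?n ?c \<longrightarrow> foot ?n ?c x \<in> F \<longrightarrow> p (foot ?n ?c x) = 0"
    by eventually_elim auto
  obtain z where z: "z \<in> F" "z \<in> relatively_interior ?n ?c F"
    using face_not_null[OF F] face_relatively_interior_null[OF F]
    by (metis Diff_cancel Diff_eq_empty_iff Diff_triv disjoint_iff)
  then obtain \<epsilon> where \<epsilon>: "\<epsilon> > 0" "{y. ?n \<bullet> y = ?c} \<inter> ball z \<epsilon> \<subseteq> F"
    by (auto simp: relatively_interior_def)
  \<comment> \<open>The open prism over a relative ball inside \<open>F\<close>; the point halfway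
    up shows that it is nonempty.\<close>
  define S where "S = {x. ?c < ?n \<bullet> x} \<inter> {x. ?n \<bullet> x < ?c + 1} \<inter> foot ?n ?c -` ball z \<epsilon>"
  have "open S"
    unfolding S_def
    by (intro open_Int open_halfspace_gt open_halfspace_lt open_vimage open_ball continuous_on_foot)
  moreover have "z + (1/2) *\<^sub>R ?n \<in> S"
  proof -
    have nn: "?n \<bullet> ?n = 1"
      using norm_face_normal[OF F] by (simp add: norm_eq_1)
    then show ?thesis
      using face_level[OF F z(1)] \<epsilon>(1) by (simp add: S_def foot_def inner_add_right)
  qed
  moreover have "AE x in lborel. x \<in> S \<longrightarrow> (p \<circ> foot ?n ?c) x = 0"
    using ae'
  proof eventually_elim
    case (elim x)
    show ?case
    proof
      assume x: "x \<in> S"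
      then have "foot ?n ?c x \<in> F"
        using \<epsilon>(2) foot_on[OF norm_face_normal[OF F], of ?c x] by (auto simp: S_def)
      then show "(p \<circ> foot ?n ?c) x = 0"
        using elim x by (auto simp: S_def)
    qed
  qed
  moreover have "real_polynomial_function (p \<circ> foot ?n ?c)"
  proof (rule real_polynomial_function_compose[OF _ p])
    have "polynomial_function (\<lambda>x. ?n \<bullet> x)"
      by (intro polynomial_function_bounded_linear bounded_linear_inner_right)
    then show "polynomial_function (foot ?n ?c)"
      unfolding foot_def[abs_def]
      by (intro polynomial_function_diff polynomial_function_mult polynomial_function_id
          polynomial_function_const)
  qed
  ultimately have "(p \<circ> foot ?n ?c) x = 0"
    by (intro real_polynomial_function_eq_0[of "p \<circ> foot ?n ?c" S]) blast+
  then show ?thesis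
    using foot_id[OF face_level[OF F x]] by simp
qed

section \<open>Crossings of segments with a face\<close>

definition cross_time :: "'a::euclidean_space set \<Rightarrow> 'a \<Rightarrow> 'a \<Rightarrow> real" where
  "cross_time F e y = (face_level F - face_normal F \<bullet> y) / (face_normal F \<bullet> e)"

abbreviation cross_point :: "'a::euclidean_space set \<Rightarrow> 'a \<Rightarrow> 'a \<Rightarrow> 'a" where
  "cross_point F e y \<equiv> y + cross_time F e y *\<^sub>R e"

lemma measurable_cross_time [measurable]: "cross_time F e \<in> borel_measurable borel"
  unfolding cross_time_def[abs_def] by measurable

lemma cross_timeI:
  assumes "face F" "face_normal F \<bullet> e \<noteq> 0" "y + t *\<^sub>R e \<in> F"
  shows "cross_time F e y = t"
  using face_level[OF assms(1,3), symmetric] assms(2) by (simp add: cross_time_def inner_add_right)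

lemma distr_cross_point:
  assumes "face F" "face_normal F \<bullet> e \<noteq> 0"
  shows "distr (restrict_space lborel {y. 0 \<le> cross_time F e y \<and> cross_time F e y \<le> 1}) borel (cross_point F e) =
    density (face_plane_measure F) (\<lambda>_. ennreal \<bar>face_normal F \<bullet> e\<bar>)"
  using distr_slanted_prism[OF norm_face_normal[OF assms(1)] assms(2), of "face_level F"]
  by (simp add: cross_time_def[abs_def])

text \<open>The crossing map pushes volume forward to a multiple of surface measure, so an
  exceptional null set on the face only affects a null set of starting points
  \<open>y\<close>.\<close>

lemma AE_cross_point:
  assumes F: "face F" "face_normal F \<bullet> e \<noteq> 0" and ae: "AE z in surface_measure F. P z"
  shows "AE y in lborel. 0 \<le> cross_time F e y \<and> cross_time F e y \<le> 1 \<and> cross_point F e y \<in> F \<longrightarrow> P (cross_point F e y)"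
proof -
  let ?S = "{y. 0 \<le> cross_time F e y \<and> cross_time F e y \<le> 1}"
  have S: "?S \<in> sets lborel"
    by (simp, measurable)
  have "AE z in density (face_plane_measure F) (\<lambda>_. ennreal \<bar>face_normal F \<bullet> e\<bar>). z \<in> F \<longrightarrow> P z"
    using ae unfolding AE_surface_measure_iff[OF F(1)] by (subst AE_density) auto
  then have "AE z in distr (restrict_space lborel ?S) borel (cross_point F e). z \<in> F \<longrightarrow> P z"
    by (simp only: distr_cross_point[OF F])
  then have "AE y in restrict_space lborel ?S. cross_point F e y \<in> F \<longrightarrow> P (cross_point F e y)"
    by (rule AE_distrD[rotated]) (rule measurable_restrict_space1, measurable)
  then show ?thesis
    using S by (subst (asm) AE_restrict_space_iff) auto
qed

lemma integral_cross_point: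
  fixes g :: "'a::euclidean_space \<Rightarrow> real"
  assumes F: "face F" "face_normal F \<bullet> e \<noteq> 0" and g [measurable]: "g \<in> borel_measurable borel"
    and int: "integrable (surface_measure F) g"
  defines "S \<equiv> {y. 0 \<le> cross_time F e y \<and> cross_time F e y \<le> 1 \<and> cross_point F e y \<in> F}"
  shows "integrable lborel (\<lambda>y. indicator S y * g (cross_point F e y))"
    and "(LINT y|lborel. indicator S y * g (cross_point F e y)) =
      \<bar>face_normal F \<bullet> e\<bar> * (LINT x|surface_measure F. g x)"
proof -
  let ?S = "{y. 0 \<le> cross_time F e y \<and> cross_time F e y \<le> 1}"
  let ?g = "\<lambda>x. indicator F x *\<^sub>R g x"
  let ?D = "distr (restrict_space lborel ?S) borel (cross_point F e)"
  note [measurable] = face_borel[OF F(1)]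
  have S: "?S \<in> sets lborel"
    by (simp, measurable)
  have Z: "cross_point F e \<in> measurable (restrict_space lborel ?S) borel"
    by (rule measurable_restrict_space1, measurable)
  have eq: "indicator ?S y *\<^sub>R ?g (cross_point F e y) = indicator S y * g (cross_point F e y)" for y
    by (auto simp: S_def split: split_indicator)
  have i1: "integrable (face_plane_measure F) ?g"
    using int unfolding surface_measure_eq
    by (subst (asm) integrable_restrict_space) (auto simp: face_borel[OF F(1)])
  then have "integrable ?D ?g"
    unfolding distr_cross_point[OF F] by (subst integrable_density) auto
  then have "integrable (restrict_space lborel ?S) (\<lambda>y. ?g (cross_point F e y))"
    using Z by (rule integrable_distr[rotated])
  then show "integrable lborel (\<lambda>y. indicator S y * g (cross_point F e y))"
    unfolding eq[symmetric] using S by (subst (asm) integrable_restrict_space) auto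
  have "(LINT y|lborel. indicator S y * g (cross_point F e y)) =
      (LINT y|restrict_space lborel ?S. ?g (cross_point F e y))"
    unfolding eq[symmetric] using S by (subst integral_restrict_space) auto
  also have "\<dots> = (LINT z|?D. ?g z)"
    using Z by (subst integral_distr) auto
  also have "\<dots> = \<bar>face_normal F \<bullet> e\<bar> * (LINT z|face_plane_measure F. ?g z)"
    unfolding distr_cross_point[OF F] by (subst integral_density) auto
  also have "(LINT z|face_plane_measure F. ?g z) = (LINT x|surface_measure F. g x)"
    unfolding surface_measure_eq
    by (subst integral_restrict_space) (auto simp: face_borel[OF F(1)])
  finally show "(LINT y|lborel. indicator S y * g (cross_point F e y)) =
      \<bar>face_normal F \<bullet> e\<bar> * (LINT x|surface_measure F. g x)" .
qed

text \<open>Used with the shifts \<open>0\<close> and \<open>e\<close>: the end points of almost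
  every segment miss all faces.\<close>

lemma AE_not_in_face:
  assumes "face F"
  shows "AE y in lborel. y + a \<notin> F"
proof -
  have "face_normal F \<noteq> 0"
    using norm_face_normal[OF assms] by auto
  then have "AE y in lborel. y \<notin> {x. face_normal F \<bullet> x = face_level F - face_normal F \<bullet> a}"
    by (intro AE_not_in hyperplane_null)
  then show ?thesis
    by eventually_elim (use face_level[OF assms] in \<open>force simp: inner_add_right\<close>)
qed

section \<open>The divergence theorem on polyhedral cells\<close>

lemma lborel_integral_translation:
  fixes f :: "'a::euclidean_space \<Rightarrow> 'b::{banach, second_countable_topology}"
  assumes [measurable]: "f \<in> borel_measurable borel"
  shows "(LINT y|lborel. f (y + a)) = (LINT y|lborel. f y)"
    and "integrable lborel f \<Longrightarrow> integrable lborel (\<lambda>y. f (y + a))"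
proof -
  have m: "(+) a \<in> measurable lborel borel"
    by simp
  show "(LINT y|lborel. f (y + a)) = (LINT y|lborel. f y)"
    using integral_distr[OF m assms] by (simp add: lborel_distr_plus add.commute)
  show "integrable lborel f \<Longrightarrow> integrable lborel (\<lambda>y. f (y + a))"
    using integrable_distr[OF m, of f] by (simp add: lborel_distr_plus add.commute)
qed

lemma integrable_bounded_support:
  fixes f :: "'a::euclidean_space \<Rightarrow> real"
  assumes "f \<in> borel_measurable borel" "bounded S" "\<And>x. x \<notin> S \<Longrightarrow> f x = 0" "\<And>x. \<bar>f x\<bar> \<le> B"
  shows "integrable lborel f"
proof -
  obtain r where r: "S \<subseteq> cball 0 r"
    using bounded_subset_ballD[OF assms(2), of 0] ball_subset_cball by blast
  have "integrable lborel (\<lambda>x. B * indicator (cball (0::'a) r) x)"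
    using emeasure_lborel_cball_finite[of "0::'a" r]
    by (intro integrable_mult_right integrable_real_indicator) simp_all
  then show ?thesis
  proof (rule Bochner_Integration.integrable_bound)
    have "\<bar>f x\<bar> \<le> \<bar>B * indicator (cball 0 r) x\<bar>" for x
    proof (cases "x \<in> cball 0 r")
      case True
      then show ?thesis using assms(4)[of x] by (simp add: abs_if)
    next
      case False
      then have "x \<notin> S" using r by blast
      then show ?thesis using assms(3) by simp
    qed
    then show "AE x in lborel. norm (f x) \<le> norm (B * indicator (cball 0 r) x)"
      by simp
  qed (use assms(1) in simp)
qed

text \<open>The local picture of a cell \<open>T\<close> with faces \<open>\<G>\<close> and outward normals \<open>\<nu>\<close> at a generic point \<open>z\<close> of a
  mesh face \<open>F\<close>.\<close>

definition flat_at :: "'a::euclidean_space set \<Rightarrow> 'a set set \<Rightarrow> ('a set \<Rightarrow> 'a) \<Rightarrow> 'a set \<Rightarrow> 'a \<Rightarrow> bool" where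
  "flat_at T \<G> \<nu> F z \<longleftrightarrow>
     (if F \<in> \<G> then \<exists>\<epsilon>>0. \<forall>x\<in>ball z \<epsilon>. (\<nu> F \<bullet> (x - z) < 0 \<longrightarrow> x \<in> T) \<and> (\<nu> F \<bullet> (x - z) > 0 \<longrightarrow> x \<notin> T)
      else z \<notin> frontier T)"

text \<open>What the divergence theorem has to know about a cell: \<open>\<F>\<close> stands for all
  faces of the mesh and covers the boundary of \<open>T\<close>, \<open>\<G>\<close> for those that
  belong to \<open>T\<close>. The condition \<open>flat\<close> lets a generic line ignore the faces
  outside \<open>\<G>\<close>, since it does not meet the boundary of \<open>T\<close>
  there.\<close>

locale polyhedral_cell =
  fixes T :: "'a::euclidean_space set" and \<F> \<G> :: "'a set set" and \<nu> :: "'a set \<Rightarrow> 'a"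
  assumes open_T: "open T" and bounded_T: "bounded T"
    and finite_F: "finite \<F>" and face_F: "\<And>F. F \<in> \<F> \<Longrightarrow> face F"
    and frontier_T: "frontier T \<subseteq> \<Union>\<F>"
    and G_sub: "\<G> \<subseteq> \<F>" and G_frontier: "\<And>F. F \<in> \<G> \<Longrightarrow> F \<subseteq> frontier T"
    and \<nu>: "\<And>F. F \<in> \<G> \<Longrightarrow> \<nu> F = face_normal F \<or> \<nu> F = - face_normal F"
    and overlap: "\<And>F F'. F \<in> \<F> \<Longrightarrow> F' \<in> \<F> \<Longrightarrow> F \<noteq> F' \<Longrightarrow> AE z in surface_measure F. z \<notin> F'"
    and flat: "\<And>F. F \<in> \<F> \<Longrightarrow> AE z in surface_measure F. flat_at T \<G> \<nu> F z"
begin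

lemma finite_G: "finite \<G>"
  using G_sub finite_F finite_subset by blast

text \<open>Along a generic line the indicator of \<open>T\<close> jumps exactly at the faces of \<open>T\<close>. As \<open>T\<close> is open, it
  takes the value \<open>0\<close> at a crossing, which dictates the choice between \<open>\<le>\<close> and \<open><\<close> in \<open>j\<close>.\<close>

lemma transversal_constant:
  assumes e: "\<And>F. F \<in> \<F> \<Longrightarrow> face_normal F \<bullet> e \<noteq> 0"
    and good: "\<And>F. F \<in> \<F> \<Longrightarrow> 0 \<le> cross_time F e y \<Longrightarrow> cross_time F e y \<le> 1 \<Longrightarrow> cross_point F e y \<in> F \<Longrightarrow>
      flat_at T \<G> \<nu> F (cross_point F e y) \<and> (\<forall>F'\<in>\<F>. F' \<noteq> F \<longrightarrow> cross_point F e y \<notin> F')"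
  defines "C \<equiv> {F \<in> \<G>. 0 \<le> cross_time F e y \<and> cross_time F e y \<le> 1 \<and> cross_point F e y \<in> F}"
  defines "j \<equiv> \<lambda>F t. if \<nu> F \<bullet> e > 0 then of_bool (cross_time F e y \<le> t) else - of_bool (cross_time F e y < t) :: real"
  shows "(\<lambda>t. indicator T (y + t *\<^sub>R e) + (\<Sum>F\<in>C. j F t)) constant_on {0..1}"
proof (rule locally_constant_imp_constant)
  let ?h = "\<lambda>t. indicator T (y + t *\<^sub>R e) + (\<Sum>F\<in>C. j F t) :: real"
  have finC: "finite C"
    using finite_G by (simp add: C_def)
  have CF: "F \<in> \<F>" "F \<in> \<G>" if "F \<in> C" for F
    using that G_sub by (auto simp: C_def)
  have \<nu>e: "\<nu> F \<bullet> e \<noteq> 0" if "F \<in> C" for F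
    using \<nu>[OF CF(2)[OF that]] e[OF CF(1)[OF that]] by auto
  have tend: "((\<lambda>t. y + t *\<^sub>R e) \<longlongrightarrow> y + s *\<^sub>R e) (nhds s)" for s
    by (intro tendsto_intros filterlim_ident)
  have j_const: "\<forall>\<^sub>F t in nhds s. j F t = j F s" if "s \<noteq> cross_time F e y" for F s
  proof (cases "s < cross_time F e y")
    case True
    then have "\<forall>\<^sub>F t in nhds s. t < cross_time F e y"
      by (intro eventually_nhds_in_open[of "{..<cross_time F e y}", simplified]) auto
    then show ?thesis
      by eventually_elim (use True in \<open>auto simp: j_def\<close>)
  next
    case False
    then have *: "cross_time F e y < s" using that by simp
    then have "\<forall>\<^sub>F t in nhds s. cross_time F e y < t"
      by (intro eventually_nhds_in_open[of "{cross_time F e y<..}", simplified]) auto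
    then show ?thesis
      by eventually_elim (use * in \<open>auto simp: j_def\<close>)
  qed
  have main: "\<forall>\<^sub>F t in nhds s. ?h t = ?h s" if s: "s \<in> {0..1}" for s
  proof (cases "\<exists>F\<in>C. s = cross_time F e y")
    case True
    then obtain F where F: "F \<in> C" "s = cross_time F e y"
      by blast
    let ?z = "cross_point F e y"
    have z: "?z \<in> F" "flat_at T \<G> \<nu> F ?z" "\<And>F'. F' \<in> \<F> \<Longrightarrow> F' \<noteq> F \<Longrightarrow> ?z \<notin> F'"
      using F(1) good[OF CF(1)[OF F(1)]] by (auto simp: C_def)
    have zT: "?z \<notin> T"
      using G_frontier[OF CF(2)[OF F(1)]] z(1) open_T frontier_disjoint_eq[of T] by auto
    obtain \<epsilon> where \<epsilon>: "\<epsilon> > 0"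
      "\<And>x. x \<in> ball ?z \<epsilon> \<Longrightarrow> (\<nu> F \<bullet> (x - ?z) < 0 \<longrightarrow> x \<in> T) \<and> (\<nu> F \<bullet> (x - ?z) > 0 \<longrightarrow> x \<notin> T)"
      using z(2) CF(2)[OF F(1)] by (auto simp: flat_at_def)
    have ev1: "\<forall>\<^sub>F t in nhds s. y + t *\<^sub>R e \<in> ball ?z \<epsilon>"
      using topological_tendstoD[OF tend[of s] open_ball[of ?z \<epsilon>]] \<epsilon>(1) F(2) by simp
    have "\<forall>\<^sub>F t in nhds s. \<forall>F'\<in>C - {F}. j F' t = j F' s"
    proof (rule eventually_ball_finite)
      show "\<forall>F'\<in>C - {F}. \<forall>\<^sub>F t in nhds s. j F' t = j F' s"
      proof
        fix F' assume F': "F' \<in> C - {F}"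
        have "s \<noteq> cross_time F' e y"
        proof
          assume "s = cross_time F' e y"
          then have "?z \<in> F'"
            using F' F(2) by (auto simp: C_def)
          then show False
            using z(3)[of F'] F' CF by auto
        qed
        then show "\<forall>\<^sub>F t in nhds s. j F' t = j F' s"
          by (rule j_const)
      qed
    qed (use finC in auto)
    then show ?thesis
      using ev1
    proof eventually_elim
      case (elim t)
      have sum: "(\<Sum>F\<in>C. j F r) = j F r + (\<Sum>F'\<in>C - {F}. j F' r)" for r
        using finC F(1) by (rule sum.remove)
      have eq: "(\<Sum>F'\<in>C - {F}. j F' t) = (\<Sum>F'\<in>C - {F}. j F' s)"
        using elim by (intro sum.cong) auto
      \<comment> \<open>The sign of this product tells on which side of the face the line is at time
        \<open>t\<close>, hence whether it is inside \<open>T\<close> just before or just after the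
        crossing.\<close>
      have d: "\<nu> F \<bullet> ((y + t *\<^sub>R e) - ?z) = (t - s) * (\<nu> F \<bullet> e)"
        using F(2) by (simp add: algebra_simps inner_diff_right)
      have inout: "(t - s) * (\<nu> F \<bullet> e) < 0 \<Longrightarrow> y + t *\<^sub>R e \<in> T" "(t - s) * (\<nu> F \<bullet> e) > 0 \<Longrightarrow> y + t *\<^sub>R e \<notin> T"
        using \<epsilon>(2)[OF elim(2)] unfolding d by auto
      have sT: "y + s *\<^sub>R e \<notin> T"
        using zT F(2) by simp
      have "indicator T (y + t *\<^sub>R e) + j F t = indicator T (y + s *\<^sub>R e) + j F s"
      proof (cases "\<nu> F \<bullet> e > 0")
        case True
        then show ?thesis
          using inout sT F(2) by (cases t s rule: linorder_cases) (auto simp: j_def mult_less_0_iff zero_less_mult_iff)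
      next
        case False
        then have "\<nu> F \<bullet> e < 0" using \<nu>e[OF F(1)] by auto
        then show ?thesis
          using inout sT F(2) by (cases t s rule: linorder_cases) (auto simp: j_def mult_less_0_iff zero_less_mult_iff)
      qed
      then show ?case
        unfolding sum eq by simp
    qed
  next
    case False
    let ?x = "y + s *\<^sub>R e"
    \<comment> \<open>A boundary point lies on some mesh face. If that face were in
      \<open>\<G>\<close>, then \<open>s\<close> would be one of the crossing times; if not,
      \<open>flat_at\<close> says that the point is no boundary point.\<close>
    have notfr: "?x \<notin> frontier T"
    proof
      assume fr: "?x \<in> frontier T"
      then obtain F where F: "F \<in> \<F>" "?x \<in> F"
        using frontier_T by auto
      have t: "cross_time F e y = s"
        using cross_timeI[OF face_F[OF F(1)] e[OF F(1)] F(2)] .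
      then have "flat_at T \<G> \<nu> F ?x"
        using good[OF F(1)] F(2) s by auto
      moreover have "F \<notin> \<G>"
        using False t F(2) s by (auto simp: C_def)
      ultimately show False
        using fr by (simp add: flat_at_def)
    qed
    have "\<forall>\<^sub>F t in nhds s. (indicator T (y + t *\<^sub>R e) :: real) = indicator T ?x"
    proof (cases "?x \<in> T")
      case True
      have "\<forall>\<^sub>F t in nhds s. y + t *\<^sub>R e \<in> T"
        using topological_tendstoD[OF tend[of s] open_T True] .
      then show ?thesis
        by eventually_elim (use True in auto)
    next
      case False
      then have "?x \<in> - closure T"
        using notfr open_T by (auto simp: frontier_def interior_open)
      then have "\<forall>\<^sub>F t in nhds s. y + t *\<^sub>R e \<in> - closure T"
        using topological_tendstoD[OF tend[of s], of "- closure T"] by auto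
      then show ?thesis
        by eventually_elim (use False closure_subset in \<open>force simp: indicator_def\<close>)
    qed
    moreover have "\<forall>\<^sub>F t in nhds s. \<forall>F\<in>C. j F t = j F s"
      using False finC by (intro eventually_ball_finite ballI j_const) auto
    ultimately show ?thesis
      by eventually_elim (auto intro!: sum.cong arg_cong2[where f = "(+)"])
  qed
  fix s :: real assume s: "s \<in> {0..1}"
  obtain U where U: "open U" "s \<in> U" "\<And>t. t \<in> U \<Longrightarrow> ?h t = ?h s"
    using main[OF s] unfolding eventually_nhds by blast
  show "\<exists>V. openin (top_of_set {0..1}) V \<and> s \<in> V \<and> (\<forall>t\<in>V. ?h t = ?h s)"
  proof (intro exI conjI ballI)
    show "openin (top_of_set {0..1}) ({0..1} \<inter> U)"
      using U(1) by (rule openin_open_Int)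
    show "?h t = ?h s" if "t \<in> {0..1} \<inter> U" for t
      using U(3) that by blast
  qed (use U(2) s in blast)
qed simp

text \<open>On the segment the indicator of \<open>T\<close> is a constant \<open>h\<close> minus
  step functions, so its integral against the derivative is a combination of differences of
  \<open>\<phi>\<close>. The values at the two end points then eliminate \<open>h\<close>.\<close>

lemma transversal_integral:
  fixes \<phi> :: "'a \<Rightarrow> real"
  assumes e: "\<And>F. F \<in> \<F> \<Longrightarrow> face_normal F \<bullet> e \<noteq> 0"
    and good: "\<And>F. F \<in> \<F> \<Longrightarrow> 0 \<le> cross_time F e y \<Longrightarrow> cross_time F e y \<le> 1 \<Longrightarrow> cross_point F e y \<in> F \<Longrightarrow>
      flat_at T \<G> \<nu> F (cross_point F e y) \<and> (\<forall>F'\<in>\<F>. F' \<noteq> F \<longrightarrow> cross_point F e y \<notin> F')"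
    and ends: "\<And>F. F \<in> \<F> \<Longrightarrow> y \<notin> F \<and> y + e \<notin> F"
    and \<phi>: "\<And>x. (\<phi> has_derivative \<phi>' x) (at x)" "continuous_on UNIV (\<lambda>x. \<phi>' x e)"
  shows "(LINT t|lborel. indicator {0..1} t * (indicator T (y + t *\<^sub>R e) * \<phi>' (y + t *\<^sub>R e) e)) =
    indicator T (y + e) * \<phi> (y + e) - indicator T y * \<phi> y +
    (\<Sum>F\<in>\<G>. sgn (\<nu> F \<bullet> e) *
      (indicator {y. 0 \<le> cross_time F e y \<and> cross_time F e y \<le> 1 \<and> cross_point F e y \<in> F} y * \<phi> (cross_point F e y)))"
proof -
  define C where "C = {F \<in> \<G>. 0 \<le> cross_time F e y \<and> cross_time F e y \<le> 1 \<and> cross_point F e y \<in> F}"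
  define j where "j = (\<lambda>F t. if \<nu> F \<bullet> e > 0 then of_bool (cross_time F e y \<le> t) else - of_bool (cross_time F e y < t) :: real)"
  define \<psi> where "\<psi> = (\<lambda>t. \<phi> (y + t *\<^sub>R e))"
  define D where "D = (\<lambda>t. \<phi>' (y + t *\<^sub>R e) e)"
  have finC: "finite C"
    using finite_G by (simp add: C_def)
  have CF: "F \<in> \<F>" "F \<in> \<G>" if "F \<in> C" for F
    using that G_sub by (auto simp: C_def)
  have \<nu>e: "\<nu> F \<bullet> e \<noteq> 0" if "F \<in> C" for F
    using \<nu>[OF CF(2)[OF that]] e[OF CF(1)[OF that]] by auto
  \<comment> \<open>Both ends avoid all faces, so the crossings are strictly inside; otherwise an
    end value of \<open>j\<close> would depend on its choice between \<open>\<le>\<close> and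
    \<open><\<close>.\<close>
  have inner01: "0 < cross_time F e y" "cross_time F e y < 1" if "F \<in> C" for F
  proof -
    have "cross_time F e y \<noteq> 0" "cross_time F e y \<noteq> 1"
      using that ends[OF CF(1)[OF that]] by (auto simp: C_def)
    then show "0 < cross_time F e y" "cross_time F e y < 1"
      using that by (auto simp: C_def)
  qed
  have "(\<lambda>t. indicator T (y + t *\<^sub>R e) + (\<Sum>F\<in>C. j F t)) constant_on {0..1}"
    unfolding C_def j_def by (rule transversal_constant[OF e good])
  then obtain h where h: "\<And>t. t \<in> {0..1} \<Longrightarrow> indicator T (y + t *\<^sub>R e) + (\<Sum>F\<in>C. j F t) = h"
    unfolding constant_on_def by metis
  have ftc: "(D has_integral (\<psi> b - \<psi> a)) {a..b}" if "a \<le> b" for a b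
  proof (rule fundamental_theorem_of_calculus[OF that])
    fix t assume "t \<in> {a..b}"
    have lin: "linear (\<phi>' (y + t *\<^sub>R e))"
      using \<phi>(1) has_derivative_linear by blast
    have "((\<lambda>t. \<phi> (y + t *\<^sub>R e)) has_derivative (\<lambda>h. \<phi>' (y + t *\<^sub>R e) (h *\<^sub>R e))) (at t)"
      by (rule has_derivative_compose[OF _ \<phi>(1)]) (auto intro!: derivative_eq_intros)
    then have "(\<psi> has_vector_derivative D t) (at t)"
      unfolding has_vector_derivative_def \<psi>_def D_def by (simp add: linear_cmul[OF lin])
    then show "(\<psi> has_vector_derivative D t) (at t within {a..b})"
      by (rule has_vector_derivative_at_within)
  qed
  have j_int: "((\<lambda>t. j F t * D t) has_integral (sgn (\<nu> F \<bullet> e) * (\<psi> 1 - \<psi> (cross_time F e y)))) {0..1}"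
    if "F \<in> C" for F
  proof -
    let ?\<tau> = "cross_time F e y"
    have "((\<lambda>t. if t \<in> {?\<tau>..1} then D t else 0) has_integral (\<psi> 1 - \<psi> ?\<tau>)) {0..1}"
      using inner01[OF that] ftc[of ?\<tau> 1] by (subst has_integral_restrict) auto
    then have "((\<lambda>t. sgn (\<nu> F \<bullet> e) * (if t \<in> {?\<tau>..1} then D t else 0)) has_integral
        (sgn (\<nu> F \<bullet> e) * (\<psi> 1 - \<psi> ?\<tau>))) {0..1}"
      by (rule has_integral_mult_right)
    \<comment> \<open>The two variants of \<open>j\<close> differ only in their value at the
      crossing time itself, a single point that the integral ignores.\<close>
    then show ?thesis
      by (rule has_integral_spike_finite[of "{?\<tau>}", rotated 2])
        (use \<nu>e[OF that] in \<open>auto simp: j_def sgn_if\<close>)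
  qed
  have total: "((\<lambda>t. indicator T (y + t *\<^sub>R e) * D t) has_integral
      (h * (\<psi> 1 - \<psi> 0) - (\<Sum>F\<in>C. sgn (\<nu> F \<bullet> e) * (\<psi> 1 - \<psi> (cross_time F e y))))) {0..1}"
  proof (rule has_integral_eq)
    show "((\<lambda>t. h * D t - (\<Sum>F\<in>C. j F t * D t)) has_integral
        (h * (\<psi> 1 - \<psi> 0) - (\<Sum>F\<in>C. sgn (\<nu> F \<bullet> e) * (\<psi> 1 - \<psi> (cross_time F e y))))) {0..1}"
      using ftc[of 0 1] j_int finC
      by (intro has_integral_diff has_integral_mult_right has_integral_sum) auto
    fix t :: real assume "t \<in> {0..1}"
    then show "h * D t - (\<Sum>F\<in>C. j F t * D t) = indicator T (y + t *\<^sub>R e) * D t"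
      by (simp only: sum_distrib_right[symmetric] h[symmetric] distrib_right add_diff_cancel_right')
  qed
  have jval: "(\<Sum>F\<in>C. j F 0) = 0" "(\<Sum>F\<in>C. j F 1) = (\<Sum>F\<in>C. sgn (\<nu> F \<bullet> e))"
  proof -
    show "(\<Sum>F\<in>C. j F 0) = 0"
      using inner01 by (intro sum.neutral ballI) (force simp: j_def)
    show "(\<Sum>F\<in>C. j F 1) = (\<Sum>F\<in>C. sgn (\<nu> F \<bullet> e))"
    proof (rule sum.cong)
      fix F assume "F \<in> C"
      then show "j F 1 = sgn (\<nu> F \<bullet> e)"
        using inner01[of F] \<nu>e[of F] by (auto simp: j_def sgn_if)
    qed simp
  qed
  have val: "h * (\<psi> 1 - \<psi> 0) - (\<Sum>F\<in>C. sgn (\<nu> F \<bullet> e) * (\<psi> 1 - \<psi> (cross_time F e y))) =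
     indicator T (y + e) * \<phi> (y + e) - indicator T y * \<phi> y + (\<Sum>F\<in>C. sgn (\<nu> F \<bullet> e) * \<phi> (cross_point F e y))"
  proof -
    have "(\<Sum>F\<in>C. sgn (\<nu> F \<bullet> e) * (\<psi> 1 - \<psi> (cross_time F e y))) =
        (\<Sum>F\<in>C. sgn (\<nu> F \<bullet> e)) * \<psi> 1 - (\<Sum>F\<in>C. sgn (\<nu> F \<bullet> e) * \<psi> (cross_time F e y))"
      by (simp add: sum_distrib_right right_diff_distrib sum_subtractf)
    \<comment> \<open>At time 0 no step has occurred and at time 1 all have, so \<open>h\<close> has
      two expressions. The first is used in front of \<open>\<psi> 0\<close>, the second in front of
      \<open>\<psi> 1\<close>, and the sum of the signs cancels.\<close>
    moreover have "h = indicator T y" "h = indicator T (y + e) + (\<Sum>F\<in>C. sgn (\<nu> F \<bullet> e))"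
      using h[of 0] h[of 1] jval by auto
    then have "h * \<psi> 0 = indicator T y * \<psi> 0"
      "h * \<psi> 1 = indicator T (y + e) * \<psi> 1 + (\<Sum>F\<in>C. sgn (\<nu> F \<bullet> e)) * \<psi> 1"
      by (simp_all only: distrib_right[symmetric])
    moreover have "h * (\<psi> 1 - \<psi> 0) = h * \<psi> 1 - h * \<psi> 0"
      by (rule right_diff_distrib)
    ultimately show ?thesis
      by (simp add: \<psi>_def)
  qed
  have sumC: "(\<Sum>F\<in>C. sgn (\<nu> F \<bullet> e) * \<phi> (cross_point F e y)) = (\<Sum>F\<in>\<G>. sgn (\<nu> F \<bullet> e) *
      (indicator {y. 0 \<le> cross_time F e y \<and> cross_time F e y \<le> 1 \<and> cross_point F e y \<in> F} y * \<phi> (cross_point F e y)))"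
    unfolding C_def using finite_G by (intro sum.mono_neutral_cong_left) auto
  have contD: "continuous_on UNIV D"
    unfolding D_def by (rule continuous_on_compose2[OF \<phi>(2)]) (auto intro!: continuous_intros)
  have [measurable]: "D \<in> borel_measurable borel" "T \<in> sets borel"
    using contD open_T by (auto intro: borel_measurable_continuous_onI)
  have "compact (D ` {0..1})"
    using contD by (intro compact_continuous_image) (auto intro: continuous_on_subset)
  then obtain B where B: "\<And>t. t \<in> {0..1} \<Longrightarrow> \<bar>D t\<bar> \<le> B"
    by (force dest!: compact_imp_bounded simp: bounded_iff)
  then have B0: "0 \<le> B"
    using order_trans[OF abs_ge_zero B[of 0]] by simp
  let ?f = "\<lambda>t. indicator {0..1} t * (indicator T (y + t *\<^sub>R e) * D t)"
  have "integrable lborel ?f"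
    by (rule integrable_bounded_support[of _ "{0..1}" B])
      (use B B0 in \<open>auto split: split_indicator\<close>)
  then have "(?f has_integral (LINT t|lborel. ?f t)) UNIV"
    by (rule has_integral_integral_lborel)
  then have "((\<lambda>t. if t \<in> {0..1} then indicator T (y + t *\<^sub>R e) * D t else 0) has_integral (LINT t|lborel. ?f t)) UNIV"
    by (rule has_integral_eq[rotated]) auto
  then have "((\<lambda>t. indicator T (y + t *\<^sub>R e) * D t) has_integral (LINT t|lborel. ?f t)) {0..1}"
    by (simp only: has_integral_restrict_UNIV)
  then have "(LINT t|lborel. ?f t) = h * (\<psi> 1 - \<psi> 0) - (\<Sum>F\<in>C. sgn (\<nu> F \<bullet> e) * (\<psi> 1 - \<psi> (cross_time F e y)))"
    using total by (rule has_integral_unique)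
  then show ?thesis
    unfolding val sumC D_def .
qed

lemma AE_good_line:
  assumes e: "\<forall>F\<in>\<F>. face_normal F \<bullet> e \<noteq> 0"
  shows "AE y in lborel. \<forall>F\<in>\<F>. y \<notin> F \<and> y + e \<notin> F \<and>
    (0 \<le> cross_time F e y \<and> cross_time F e y \<le> 1 \<and> cross_point F e y \<in> F \<longrightarrow>
      flat_at T \<G> \<nu> F (cross_point F e y) \<and> (\<forall>F'\<in>\<F>. F' \<noteq> F \<longrightarrow> cross_point F e y \<notin> F'))"
proof (rule AE_finite_allI[OF finite_F])
  fix F assume F: "F \<in> \<F>"
  have "AE z in surface_measure F. \<forall>F'\<in>\<F>. F' \<noteq> F \<longrightarrow> z \<notin> F'"
  proof (rule AE_finite_allI[OF finite_F])
    fix F' assume F': "F' \<in> \<F>"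
    show "AE z in surface_measure F. F' \<noteq> F \<longrightarrow> z \<notin> F'"
      using overlap[OF F F'] by (cases "F' = F") auto
  qed
  then have "AE z in surface_measure F. flat_at T \<G> \<nu> F z \<and> (\<forall>F'\<in>\<F>. F' \<noteq> F \<longrightarrow> z \<notin> F')"
    using flat[OF F] by eventually_elim auto
  then have "AE y in lborel. 0 \<le> cross_time F e y \<and> cross_time F e y \<le> 1 \<and> cross_point F e y \<in> F \<longrightarrow>
      flat_at T \<G> \<nu> F (cross_point F e y) \<and> (\<forall>F'\<in>\<F>. F' \<noteq> F \<longrightarrow> cross_point F e y \<notin> F')"
    by (rule AE_cross_point[OF face_F[OF F] e[rule_format, OF F]])
  moreover have "AE y in lborel. y \<notin> F" "AE y in lborel. y + e \<notin> F"
    using AE_not_in_face[OF face_F[OF F], of 0] AE_not_in_face[OF face_F[OF F], of e] by simp_all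
  ultimately show "AE y in lborel. y \<notin> F \<and> y + e \<notin> F \<and>
    (0 \<le> cross_time F e y \<and> cross_time F e y \<le> 1 \<and> cross_point F e y \<in> F \<longrightarrow>
      flat_at T \<G> \<nu> F (cross_point F e y) \<and> (\<forall>F'\<in>\<F>. F' \<noteq> F \<longrightarrow> cross_point F e y \<notin> F'))"
    by eventually_elim auto
qed

lemma bounded_on_cell:
  assumes "continuous_on UNIV (g :: 'a \<Rightarrow> real)"
  obtains B where "B \<ge> 0" "\<And>x. x \<in> closure T \<Longrightarrow> \<bar>g x\<bar> \<le> B"
proof -
  have "compact (g ` closure T)"
    using bounded_T assms by (intro compact_continuous_image)
      (auto intro: continuous_on_subset simp: compact_closure)
  then obtain B where "\<And>x. x \<in> closure T \<Longrightarrow> \<bar>g x\<bar> \<le> B"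
    by (force dest!: compact_imp_bounded simp: bounded_iff)
  then have "\<And>x. x \<in> closure T \<Longrightarrow> \<bar>g x\<bar> \<le> max 0 B"
    by (metis max.coboundedI2)
  then show thesis
    using that[of "max 0 B"] by auto
qed

lemma integrable_on_face:
  assumes "F \<in> \<F>" "continuous_on UNIV (g :: 'a \<Rightarrow> real)"
  shows "integrable (surface_measure F) g"
proof -
  interpret finite_measure "surface_measure F"
    using finite_surface_measure face_F assms(1) by blast
  have "compact (g ` F)"
    using face_F[OF assms(1)] assms(2) by (intro compact_continuous_image)
      (auto intro: continuous_on_subset simp: face_def compact_eq_bounded_closed)
  then obtain B where "\<And>x. x \<in> F \<Longrightarrow> norm (g x) \<le> B"
    by (force dest!: compact_imp_bounded simp: bounded_iff)
  then show ?thesis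
    using assms(2)
    by (intro integrable_const_bound[of _ B])
      (auto intro: measurable_surface_measure borel_measurable_continuous_onI)
qed

lemma divergence_transversal:
  fixes \<phi> :: "'a \<Rightarrow> real"
  assumes e: "\<And>F. F \<in> \<F> \<Longrightarrow> face_normal F \<bullet> e \<noteq> 0"
    and \<phi>: "\<And>x. (\<phi> has_derivative \<phi>' x) (at x)" "continuous_on UNIV (\<lambda>x. \<phi>' x e)"
  shows "(LINT x|lborel. indicator T x * \<phi>' x e) = (\<Sum>F\<in>\<G>. (\<nu> F \<bullet> e) * (LINT x|surface_measure F. \<phi> x))"
proof -
  define D where "D = (\<lambda>x. \<phi>' x e)"
  have e': "\<forall>F\<in>\<F>. face_normal F \<bullet> e \<noteq> 0"
    using e by blast
  have cont\<phi>: "continuous_on UNIV \<phi>"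
    by (intro continuous_at_imp_continuous_on ballI has_derivative_continuous[OF \<phi>(1)])
  have contD: "continuous_on UNIV D"
    using \<phi>(2) by (simp add: D_def)
  have [measurable]: "\<phi> \<in> borel_measurable borel" "D \<in> borel_measurable borel" "T \<in> sets borel"
    using cont\<phi> contD open_T by (auto intro: borel_measurable_continuous_onI)
  have cell_int: "integrable lborel (\<lambda>x. indicator T x * g x)" if g: "continuous_on UNIV g" for g :: "'a \<Rightarrow> real"
  proof -
    obtain B where B: "B \<ge> 0" "\<And>x. x \<in> closure T \<Longrightarrow> \<bar>g x\<bar> \<le> B"
      using bounded_on_cell[OF g] by blast
    have [measurable]: "g \<in> borel_measurable borel"
      using g by (rule borel_measurable_continuous_onI)
    show ?thesis
      by (rule integrable_bounded_support[OF _ bounded_T, of _ B])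
        (use B closure_subset[of T] in \<open>auto split: split_indicator\<close>)
  qed
  obtain BD where BD: "BD \<ge> 0" "\<And>x. x \<in> closure T \<Longrightarrow> \<bar>D x\<bar> \<le> BD"
    using bounded_on_cell[OF contD] by blast
  obtain r where r: "T \<subseteq> ball 0 r"
    using bounded_subset_ballD[OF bounded_T, of 0] by blast
  let ?G = "\<lambda>y t. indicator {0..1::real} t * (indicator T (y + t *\<^sub>R e) * D (y + t *\<^sub>R e))"
  have intG: "integrable (lborel \<Otimes>\<^sub>M lborel) (\<lambda>(y, t). ?G y t)"
    unfolding lborel_prod
  proof (rule integrable_bounded_support)
    have m: "(\<lambda>z::'a \<times> real. fst z + snd z *\<^sub>R e) \<in> borel_measurable borel"
      by (intro borel_measurable_continuous_onI continuous_intros)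
    have "(\<lambda>z::'a \<times> real. indicator ({0..1} :: real set) (snd z) * (indicator T (fst z + snd z *\<^sub>R e) * D (fst z + snd z *\<^sub>R e)) :: real)
        \<in> borel_measurable borel"
    proof -
      have "snd \<in> borel_measurable (borel :: ('a \<times> real) measure)"
        by (intro borel_measurable_continuous_onI continuous_intros)
      moreover have "(indicator {0..1} :: real \<Rightarrow> real) \<in> borel_measurable borel"
        by measurable
      ultimately have "(\<lambda>z::'a \<times> real. indicator ({0..1} :: real set) (snd z) :: real) \<in> borel_measurable borel"
        by (rule measurable_compose)
      moreover have "(\<lambda>z::'a \<times> real. indicator T (fst z + snd z *\<^sub>R e) * D (fst z + snd z *\<^sub>R e)) \<in> borel_measurable borel"
        by (rule measurable_compose[OF m, of "\<lambda>x. indicator T x * D x"]) measurable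
      ultimately show ?thesis
        by (rule borel_measurable_times)
    qed
    then show "(\<lambda>(y, t). ?G y t) \<in> borel_measurable borel"
      by (simp add: split_def)
    \<comment> \<open>A segment of length \<open>norm e\<close> that reaches \<open>T\<close> starts
      at distance less than \<open>r + norm e\<close> from the origin.\<close>
    show "bounded (ball (0::'a) (r + norm e) \<times> {0..1::real})"
      by (intro bounded_Times) auto
    fix z :: "'a \<times> real"
    show "\<bar>(\<lambda>(y, t). ?G y t) z\<bar> \<le> BD"
      using BD closure_subset[of T] by (auto split: prod.split split_indicator)
    assume z: "z \<notin> ball (0::'a) (r + norm e) \<times> {0..1::real}"
    show "(\<lambda>(y, t). ?G y t) z = 0"
    proof (rule ccontr)
      assume "(\<lambda>(y, t). ?G y t) z \<noteq> 0"
      then have z': "snd z \<in> {0..1}" "fst z + snd z *\<^sub>R e \<in> T"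
        by (auto split: prod.splits split_indicator_asm)
      have "norm (fst z) \<le> norm (fst z + snd z *\<^sub>R e) + norm (snd z *\<^sub>R e)"
        by (metis add_diff_cancel_right' norm_triangle_ineq4)
      also have "norm (snd z *\<^sub>R e) \<le> norm e"
        using z'(1) by (simp add: mult_left_le_one_le)
      also have "norm (fst z + snd z *\<^sub>R e) < r"
        using z'(2) r by auto
      finally have "fst z \<in> ball 0 (r + norm e)"
        by simp
      then show False
        using z z'(1) by (auto simp: mem_Times_iff)
    qed
  qed
  define I where "I = (LINT x|lborel. indicator T x * D x)"
  \<comment> \<open>Every time slice of the double integral is a translate of the integral over
    \<open>T\<close>; since the time interval has length 1, the double integral equals
    \<open>I\<close>.\<close>
  have "(LINT t|lborel. LINT y|lborel. ?G y t) = (LINT t|lborel. indicator {0..1::real} t * I)"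
  proof (rule Bochner_Integration.integral_cong)
    fix t
    have "(LINT y|lborel. indicator T (y + t *\<^sub>R e) * D (y + t *\<^sub>R e)) = I"
      unfolding I_def by (rule lborel_integral_translation(1)[of "\<lambda>x. indicator T x * D x"]) measurable
    then show "(LINT y|lborel. ?G y t) = indicator {0..1} t * I"
      by simp
  qed simp
  then have "I = (LINT t|lborel. LINT y|lborel. ?G y t)"
    by simp
  also have "\<dots> = (LINT y|lborel. LINT t|lborel. ?G y t)"
    by (rule lborel_pair.Fubini_integral[OF intG])
  also have "\<dots> = (LINT y|lborel. indicator T (y + e) * \<phi> (y + e) - indicator T y * \<phi> y +
    (\<Sum>F\<in>\<G>. sgn (\<nu> F \<bullet> e) *
      (indicator {y. 0 \<le> cross_time F e y \<and> cross_time F e y \<le> 1 \<and> cross_point F e y \<in> F} y * \<phi> (cross_point F e y))))"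
    (is "_ = (LINT y|lborel. ?a y - ?b y + (\<Sum>F\<in>\<G>. _ * ?s F y))")
  proof (rule integral_cong_AE)
    show "(\<lambda>y. LINT t|lborel. ?G y t) \<in> borel_measurable lborel"
      using lborel_pair.integrable_fst'[OF intG] by auto
    have "\<And>F. F \<in> \<G> \<Longrightarrow> F \<in> sets borel"
      using G_sub face_F face_borel by blast
    then show "(\<lambda>y. ?a y - ?b y + (\<Sum>F\<in>\<G>. sgn (\<nu> F \<bullet> e) * ?s F y)) \<in> borel_measurable lborel"
      by measurable
    show "AE y in lborel. (LINT t|lborel. ?G y t) = ?a y - ?b y + (\<Sum>F\<in>\<G>. sgn (\<nu> F \<bullet> e) * ?s F y)"
      using AE_good_line[OF e']
    proof eventually_elim
      case (elim y)
      then show ?case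
        unfolding D_def by (intro transversal_integral[OF e _ _ \<phi>]) blast+
    qed
  qed
  also have "\<dots> = (\<Sum>F\<in>\<G>. sgn (\<nu> F \<bullet> e) * (\<bar>face_normal F \<bullet> e\<bar> * (LINT x|surface_measure F. \<phi> x)))"
  proof -
    have s: "integrable lborel (?s F)" "(LINT y|lborel. ?s F y) = \<bar>face_normal F \<bullet> e\<bar> * (LINT x|surface_measure F. \<phi> x)"
      if "F \<in> \<G>" for F
    proof -
      have F: "F \<in> \<F>" using that G_sub by auto
      show "integrable lborel (?s F)" "(LINT y|lborel. ?s F y) = \<bar>face_normal F \<bullet> e\<bar> * (LINT x|surface_measure F. \<phi> x)"
        using integral_cross_point[OF face_F[OF F] e[OF F] _ integrable_on_face[OF F cont\<phi>]] by simp_all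
    qed
    have b: "integrable lborel ?b"
      by (rule cell_int[OF cont\<phi>])
    have a: "integrable lborel ?a" "(LINT y|lborel. ?a y) = (LINT y|lborel. ?b y)"
      using lborel_integral_translation[of "\<lambda>x. indicator T x * \<phi> x" e] b by auto
    show ?thesis
      using a b s by (simp add: integral_sum integrable_sum)
  qed
  also have "\<dots> = (\<Sum>F\<in>\<G>. (\<nu> F \<bullet> e) * (LINT x|surface_measure F. \<phi> x))"
  proof (rule sum.cong)
    fix F assume "F \<in> \<G>"
    \<comment> \<open>The surface weight does not see the orientation of the face; the sign from the
      crossing restores that of the outward normal.\<close>
    then have "\<bar>face_normal F \<bullet> e\<bar> = \<bar>\<nu> F \<bullet> e\<bar>"
      using \<nu>[of F] by auto
    then show "sgn (\<nu> F \<bullet> e) * (\<bar>face_normal F \<bullet> e\<bar> * (LINT x|surface_measure F. \<phi> x)) =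
      (\<nu> F \<bullet> e) * (LINT x|surface_measure F. \<phi> x)"
      by (simp add: mult.assoc[symmetric] sgn_mult_abs)
  qed simp
  finally show ?thesis
    by (simp add: I_def D_def)
qed

text \<open>The directions that fail lie in finitely many hyperplanes, a null set, while the whole
  space is not null.\<close>

lemma exists_transversal: "\<exists>e. \<forall>F\<in>\<F>. face_normal F \<bullet> e \<noteq> 0"
proof -
  have "AE e in lborel. \<forall>F\<in>\<F>. e \<notin> {x. face_normal F \<bullet> x = 0}"
  proof (rule AE_finite_allI[OF finite_F])
    fix F assume "F \<in> \<F>"
    then have "face_normal F \<noteq> 0"
      using norm_face_normal[OF face_F] by fastforce
    then show "AE e in lborel. e \<notin> {x. face_normal F \<bullet> x = 0}"
      by (intro AE_not_in hyperplane_null)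
  qed
  moreover have "ae_filter (lborel :: 'a measure) \<noteq> bot"
    by (simp add: ae_filter_eq_bot_iff)
  ultimately have "\<exists>e. \<forall>F\<in>\<F>. e \<notin> {x. face_normal F \<bullet> x = 0}"
    by (rule eventually_happens'[rotated])
  then show ?thesis by simp
qed

text \<open>Both sides are linear in the direction, and every direction is a combination of two
  directions that are transversal to all faces.\<close>

theorem divergence:
  fixes \<phi> :: "'a \<Rightarrow> real"
  assumes \<phi>: "\<And>x. (\<phi> has_derivative \<phi>' x) (at x)" "\<And>e. continuous_on UNIV (\<lambda>x. \<phi>' x e)"
  shows "(LINT x|lebesgue_on T. \<phi>' x a) = (\<Sum>F\<in>\<G>. (\<nu> F \<bullet> a) * (LINT x|surface_measure F. \<phi> x))"
proof -
  obtain e where e: "\<And>F. F \<in> \<F> \<Longrightarrow> face_normal F \<bullet> e \<noteq> 0"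
    using exists_transversal by blast
  \<comment> \<open>On the line \<open>a + s e\<close> each face rules out a single value of
    \<open>s\<close>, because \<open>e\<close> is transversal to it; hence some \<open>s\<close>
    makes \<open>a + s e\<close> transversal to all faces.\<close>
  have "finite {s. \<exists>F\<in>\<F>. face_normal F \<bullet> (a + s *\<^sub>R e) = 0}"
  proof (rule finite_subset)
    show "{s. \<exists>F\<in>\<F>. face_normal F \<bullet> (a + s *\<^sub>R e) = 0} \<subseteq> (\<lambda>F. - (face_normal F \<bullet> a) / (face_normal F \<bullet> e)) ` \<F>"
      using e by (auto simp: inner_add_right field_simps image_iff add_eq_0_iff)
  qed (use finite_F in simp)
  then obtain s where s: "\<And>F. F \<in> \<F> \<Longrightarrow> face_normal F \<bullet> (a + s *\<^sub>R e) \<noteq> 0"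
    using ex_new_if_finite[OF infinite_UNIV_char_0] by blast
  let ?J = "\<lambda>v. LINT x|lborel. indicator T x * \<phi>' x v"
  have lin: "\<phi>' x (a + s *\<^sub>R e) = \<phi>' x a + s * \<phi>' x e" for x
    using has_derivative_linear[OF \<phi>(1)[of x]] by (simp add: linear_add linear_cmul)
  have int: "integrable lborel (\<lambda>x. indicator T x * \<phi>' x v)" for v
  proof -
    obtain B where B: "B \<ge> 0" "\<And>x. x \<in> closure T \<Longrightarrow> \<bar>\<phi>' x v\<bar> \<le> B"
      using bounded_on_cell[OF \<phi>(2)] by blast
    have [measurable]: "(\<lambda>x. \<phi>' x v) \<in> borel_measurable borel" "T \<in> sets borel"
      using \<phi>(2) open_T by (auto intro: borel_measurable_continuous_onI)
    show ?thesis
      by (rule integrable_bounded_support[OF _ bounded_T, of _ B])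
        (use B closure_subset[of T] in \<open>auto split: split_indicator\<close>)
  qed
  have "?J (a + s *\<^sub>R e) = ?J a + s * ?J e"
    unfolding lin using int[of a] int[of e]
    by (subst integral_mult_right_zero[symmetric], subst Bochner_Integration.integral_add[symmetric])
      (auto simp: algebra_simps intro!: Bochner_Integration.integral_cong)
  then have "?J a = ?J (a + s *\<^sub>R e) - s * ?J e"
    by simp
  also have "\<dots> = (\<Sum>F\<in>\<G>. (\<nu> F \<bullet> a) * (LINT x|surface_measure F. \<phi> x))"
    using divergence_transversal[of e \<phi> \<phi>', OF e \<phi>(1) \<phi>(2)]
      divergence_transversal[of "a + s *\<^sub>R e" \<phi> \<phi>', OF s \<phi>(1) \<phi>(2)]
    by (simp add: inner_add_right algebra_simps sum.distrib sum_distrib_left)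
  finally have J: "?J a = (\<Sum>F\<in>\<G>. (\<nu> F \<bullet> a) * (LINT x|surface_measure F. \<phi> x))" .
  have "(LINT x|lebesgue_on T. \<phi>' x a) = (LINT x|lebesgue. indicator T x *\<^sub>R \<phi>' x a)"
    using open_T by (intro integral_restrict_space) auto
  also have "\<dots> = (LINT x|lborel. indicator T x *\<^sub>R \<phi>' x a)"
    using int[of a] by (intro integral_completion) auto
  finally show ?thesis
    using J by simp
qed

end

section \<open>Geometry of polyhedral meshes\<close>

text \<open>A point outside \<open>\<Omega>\<close> lies on or above the Lipschitz graph, so points above it are arbitrarily close.\<close>

lemma interior_closure_lipschitz:
  fixes \<Omega> :: "'a::euclidean_space set"
  assumes "open \<Omega>" "lipschitz_boundary \<Omega>"
  shows "interior (closure \<Omega>) = \<Omega>"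
proof
  show "\<Omega> \<subseteq> interior (closure \<Omega>)"
    using assms(1) by (simp add: closure_subset interior_maximal)
  show "interior (closure \<Omega>) \<subseteq> \<Omega>"
  proof (rule subsetI, rule ccontr)
    fix x assume x: "x \<in> interior (closure \<Omega>)" "x \<notin> \<Omega>"
    then have "x \<in> frontier \<Omega>"
      using assms(1) interior_subset by (auto simp: frontier_def interior_open)
    then obtain r e g L where r: "r > 0" and e: "norm e = 1" and g: "L-lipschitz_on {y. e \<bullet> y = 0} g"
      and sub: "\<Omega> \<inter> ball x r = {y \<in> ball x r. e \<bullet> y < g (y - (e \<bullet> y) *\<^sub>R e)}"
      using assms(2) unfolding lipschitz_boundary_def by blast
    let ?p = "\<lambda>y. y - (e \<bullet> y) *\<^sub>R e"
    have ee: "e \<bullet> e = 1"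
      using e by (simp add: norm_eq_1)
    have above: "e \<bullet> x \<ge> g (?p x)"
      using sub x(2) r by force
    have "continuous_on UNIV (\<lambda>y. g (?p y))"
      by (rule continuous_on_compose2[OF lipschitz_on_continuous_on[OF g]])
        (auto intro!: continuous_intros simp: inner_diff_right ee)
    then have "open {y. g (?p y) < e \<bullet> y}"
      by (intro open_Collect_less continuous_intros)
    then have U: "open (ball x r \<inter> {y. g (?p y) < e \<bullet> y})" (is "open ?U")
      by (intro open_Int open_ball)
    have "?U \<inter> \<Omega> = {}"
      using sub by force
    then have disj: "?U \<inter> closure \<Omega> = {}"
      using U open_Int_closure_eq_empty by blast
    obtain \<delta> where \<delta>: "\<delta> > 0" "ball x \<delta> \<subseteq> closure \<Omega>"
      using x(1) by (meson mem_interior)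
    define s where "s = min \<delta> r / 2"
    have s: "0 < s" "s < \<delta>" "s < r"
      using \<delta>(1) r by (auto simp: s_def)
    let ?x = "x + s *\<^sub>R e"
    have "dist x ?x = s"
      using s(1) e by (simp add: dist_norm)
    moreover have p: "?p ?x = ?p x"
      using ee by (simp add: inner_add_right algebra_simps)
    have "g (?p ?x) < e \<bullet> ?x"
      unfolding p using above s(1) ee by (simp add: inner_add_right)
    ultimately have "?x \<in> ?U" "?x \<in> closure \<Omega>"
      using s \<delta>(2) by auto
    then show False
      using disj by blast
  qed
qed

lemma open_not_in_hyperplane:
  assumes "open U" "U \<noteq> {}" "(n::'a::euclidean_space) \<noteq> 0"
  obtains x where "x \<in> U" "n \<bullet> (x - z) \<noteq> 0"
proof -
  have "\<not> U \<subseteq> {x. n \<bullet> x = n \<bullet> z}"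
    using assms interior_maximal[of U "{x. n \<bullet> x = n \<bullet> z}"] interior_hyperplane[OF assms(3)] by auto
  then show thesis
    using that by (auto simp: inner_diff_right)
qed

locale polyhedral_mesh_on =
  fixes \<Omega> :: "'a::euclidean_space set" and \<T> \<F> :: "'a set set"
  assumes domain: "polyhedral_lipschitz_domain \<Omega>" and mesh: "polyhedral_mesh \<Omega> \<T> \<F>"
begin

lemma open_\<Omega>: "open \<Omega>" and bounded_\<Omega>: "bounded \<Omega>"
  and interior_closure_\<Omega>: "interior (closure \<Omega>) = \<Omega>"
  using domain interior_closure_lipschitz by (auto simp: polyhedral_lipschitz_domain_def)

lemma finite_T: "finite \<T>" and finite_F: "finite \<F>"
  using mesh by (auto simp: polyhedral_mesh_def)

lemma element:
  assumes "T \<in> \<T>"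
  shows "open T" "connected T" "T \<noteq> {}" "T \<subseteq> \<Omega>" "bounded T" "frontier T \<subseteq> \<Union>\<F>"
proof -
  show o: "open T" and "connected T" "T \<noteq> {}" "frontier T \<subseteq> \<Union>\<F>"
    using mesh assms by (auto simp: polyhedral_mesh_def)
  have "T \<subseteq> closure \<Omega>"
    using mesh assms closure_subset by (fastforce simp: polyhedral_mesh_def)
  \<comment> \<open>An open subset of the closure of \<open>\<Omega>\<close> lies in the interior of
    that closure, which is \<open>\<Omega>\<close> because of the Lipschitz boundary; a slit in
    \<open>\<Omega>\<close> would break this.\<close>
  then show "T \<subseteq> \<Omega>"
    using o interior_maximal interior_closure_\<Omega> by blast
  then show "bounded T"
    using bounded_\<Omega> bounded_subset by blast
qed

lemma elements_disjoint: "T \<in> \<T> \<Longrightarrow> T' \<in> \<T> \<Longrightarrow> T \<noteq> T' \<Longrightarrow> T \<inter> T' = {}"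
  using mesh by (auto simp: polyhedral_mesh_def)

lemma mesh_facesD: "F \<in> mesh_faces \<F> T \<Longrightarrow> F \<in> \<F>" "F \<in> mesh_faces \<F> T \<Longrightarrow> F \<subseteq> frontier T"
  by (auto simp: mesh_faces_def)

lemma finite_mesh_faces: "finite (mesh_faces \<F> T)"
  using finite_F by (simp add: mesh_faces_def)

lemma face_mesh:
  assumes "F \<in> \<F>"
  shows "face F"
proof -
  have "mesh_face \<Omega> \<T> F"
    using mesh assms by (auto simp: polyhedral_mesh_def)
  moreover have "bounded F"
    using calculation bounded_closure[OF bounded_\<Omega>] bounded_subset by (auto simp: mesh_face_def)
  ultimately show ?thesis
    by (auto simp: mesh_face_def face_def)
qed

lemma face_kind:
  assumes "F \<in> \<F>"
  shows "is_interface \<T> F \<or> is_boundary_face \<Omega> \<T> F"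
  using mesh assms by (auto simp: polyhedral_mesh_def mesh_face_def)

lemma overlap_null:
  assumes "F \<in> \<F>" "F' \<in> \<F>" "F \<noteq> F'"
  shows "AE z in surface_measure F. z \<notin> F'"
proof (rule faces_overlap_null)
  show "rel_interior F \<inter> rel_interior F' = {}"
    using mesh assms unfolding polyhedral_mesh_def by blast
qed (use assms face_mesh in auto)

lemma AE_not_in_other_faces:
  assumes "F \<in> \<F>"
  shows "AE z in surface_measure F. \<forall>F'\<in>\<F>. F' \<noteq> F \<longrightarrow> z \<notin> F'"
proof (rule AE_finite_allI[OF finite_F])
  fix F' assume "F' \<in> \<F>"
  then show "AE z in surface_measure F. F' \<noteq> F \<longrightarrow> z \<notin> F'"
    using overlap_null[OF assms, of F'] by (cases "F' = F") auto
qed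

text \<open>\<open>normal\<close> is a definite description. Only two opposite unit normals qualify,
  and both cannot be outward: at almost every point a common small step would end both inside and
  outside \<open>T\<close>.\<close>

lemma outward_normal_normal:
  assumes "T \<in> \<T>" "F \<in> mesh_faces \<F> T"
  shows "outward_normal T F (normal T F)"
proof -
  have F: "face F"
    using face_mesh mesh_facesD assms(2) by blast
  have "\<exists>n. outward_normal T F n"
    using mesh assms unfolding polyhedral_mesh_def by blast
  moreover have "m = n" if mn: "outward_normal T F m" "outward_normal T F n" for m n
  proof (rule ccontr)
    assume "m \<noteq> n"
    then have m: "m = - n"
      using face_unit_normal_cases[OF F, of m] face_unit_normal_cases[OF F, of n] mn
      by (auto simp: outward_normal_def)
    have "AE x in surface_measure F. False"
    proof -
      have "AE x in surface_measure F. \<exists>\<epsilon>>0. \<forall>t. 0 < t \<and> t < \<epsilon> \<longrightarrow> x - t *\<^sub>R m \<in> T \<and> x + t *\<^sub>R m \<notin> T"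
        "AE x in surface_measure F. \<exists>\<epsilon>>0. \<forall>t. 0 < t \<and> t < \<epsilon> \<longrightarrow> x - t *\<^sub>R n \<in> T \<and> x + t *\<^sub>R n \<notin> T"
        using mn by (auto simp: outward_normal_def)
      then show ?thesis
      proof eventually_elim
        case (elim x)
        then obtain \<delta> \<epsilon> where *: "\<delta> > 0" "\<And>t. 0 < t \<Longrightarrow> t < \<delta> \<Longrightarrow> x - t *\<^sub>R m \<in> T \<and> x + t *\<^sub>R m \<notin> T"
          "\<epsilon> > 0" "\<And>t. 0 < t \<Longrightarrow> t < \<epsilon> \<Longrightarrow> x - t *\<^sub>R n \<in> T \<and> x + t *\<^sub>R n \<notin> T"
          by metis
        have "0 < min \<delta> \<epsilon> / 2" "min \<delta> \<epsilon> / 2 < \<delta>" "min \<delta> \<epsilon> / 2 < \<epsilon>"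
          using *(1,3) by auto
        then show ?case
          using *(2)[of "min \<delta> \<epsilon> / 2"] *(4)[of "min \<delta> \<epsilon> / 2"] m by simp
      qed
    qed
    then show False
      using AE_surface_measure_ex[OF F] by blast
  qed
  ultimately show ?thesis
    unfolding normal_def by (metis theI)
qed

lemma normal_cases:
  assumes "T \<in> \<T>" "F \<in> mesh_faces \<F> T"
  shows "normal T F = face_normal F \<or> normal T F = - face_normal F"
  using outward_normal_normal[OF assms] face_unit_normal_cases[of F] face_mesh mesh_facesD(1)[OF assms(2)]
  by (auto simp: outward_normal_def)

text \<open>Near a point of \<open>F\<close> that is on no other face, an open half ball bounded by
  the plane of \<open>F\<close> is connected and meets no mesh face, hence no element
  boundary.\<close>

lemma half_ball_in_or_out:
  assumes F: "F \<in> \<F>" and z: "z \<in> F" "\<forall>F'\<in>\<F>. F' \<noteq> F \<longrightarrow> z \<notin> F'"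
  obtains \<epsilon> where "\<epsilon> > 0"
    "\<And>T m. T \<in> \<T> \<Longrightarrow> m = face_normal F \<or> m = - face_normal F \<Longrightarrow>
      ball z \<epsilon> \<inter> {x. m \<bullet> (x - z) > 0} \<subseteq> T \<or> ball z \<epsilon> \<inter> {x. m \<bullet> (x - z) > 0} \<inter> T = {}"
proof -
  have "closed (\<Union>(\<F> - {F}))"
    using finite_F face_mesh face_closed by (intro closed_Union) auto
  moreover have "z \<notin> \<Union>(\<F> - {F})"
    using z(2) by blast
  ultimately obtain \<epsilon> where \<epsilon>: "\<epsilon> > 0" "ball z \<epsilon> \<subseteq> - \<Union>(\<F> - {F})"
    by (meson ComplI open_Compl open_contains_ball)
  have "H \<subseteq> T \<or> H \<inter> T = {}"
    if T: "T \<in> \<T>" and m: "m = face_normal F \<or> m = - face_normal F" and H: "H = ball z \<epsilon> \<inter> {x. m \<bullet> (x - z) > 0}"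
    for T m H
  proof -
    have conv: "convex {x. m \<bullet> (x - z) > 0}"
      using convex_halfspace_gt[of "m \<bullet> z" m] by (simp add: inner_diff_right)
    have conn: "connected H"
      unfolding H by (intro convex_connected convex_Int convex_ball conv)
    have "H \<inter> frontier T = {}"
    proof (rule ccontr)
      assume "H \<inter> frontier T \<noteq> {}"
      then obtain x where x: "x \<in> H" "x \<in> frontier T" by auto
      then have "x \<in> \<Union>\<F>"
        using element(6)[OF T] by auto
      then have "x \<in> F"
        using \<epsilon>(2) x(1) by (auto simp: H)
      then have "m \<bullet> (x - z) = 0"
        using face_level[OF face_mesh[OF F]] z(1) m by (auto simp: inner_diff_right)
      then show False
        using x(1) by (simp add: H)
    qed
    then show ?thesis
      using connected_Int_frontier[OF conn, of T] by blast
  qed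
  then show thesis
    using that[OF \<epsilon>(1)] by blast
qed

text \<open>Almost every point of \<open>F\<close> has a ball that the plane of \<open>F\<close>
  cuts into two halves, each inside or outside any given element. One sample point on either side,
  supplied by the outward normal, settles the case of \<open>T\<close>; any other element that
  reaches the point must then fill the opposite half.\<close>

lemma sides_of_face:
  assumes T: "T \<in> \<T>" "F \<in> mesh_faces \<F> T"
  shows "AE z in surface_measure F. \<exists>\<epsilon>>0.
    ball z \<epsilon> \<inter> {x. normal T F \<bullet> (x - z) < 0} \<subseteq> T \<and>
    ball z \<epsilon> \<inter> {x. normal T F \<bullet> (x - z) > 0} \<inter> T = {} \<and>
    (\<forall>T'\<in>\<T>. T' \<noteq> T \<longrightarrow> z \<in> closure T' \<longrightarrow> ball z \<epsilon> \<inter> {x. normal T F \<bullet> (x - z) > 0} \<subseteq> T')"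
proof -
  let ?\<nu> = "normal T F"
  have F: "F \<in> \<F>" "face F"
    using mesh_facesD(1)[OF T(2)] face_mesh by auto
  have on: "outward_normal T F ?\<nu>"
    by (rule outward_normal_normal[OF T])
  then have \<nu>: "norm ?\<nu> = 1"
    by (auto simp: outward_normal_def unit_normal_def)
  then have \<nu>0: "?\<nu> \<noteq> 0" "?\<nu> \<bullet> ?\<nu> = 1"
    by (auto simp: norm_eq_1)
  have ae1: "AE x in surface_measure F. \<exists>\<epsilon>>0. \<forall>t. 0 < t \<and> t < \<epsilon> \<longrightarrow> x - t *\<^sub>R ?\<nu> \<in> T \<and> x + t *\<^sub>R ?\<nu> \<notin> T"
    using on by (auto simp: outward_normal_def)
  have ae2: "AE x in surface_measure F. x \<in> F"
    using AE_space[of "surface_measure F"] by simp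
  show ?thesis
    using ae1 ae2 AE_not_in_other_faces[OF F(1)]
  proof eventually_elim
    case (elim z)
    from elim(1) obtain \<delta> where \<delta>: "\<delta> > 0" "\<And>t. 0 < t \<Longrightarrow> t < \<delta> \<Longrightarrow> z - t *\<^sub>R ?\<nu> \<in> T \<and> z + t *\<^sub>R ?\<nu> \<notin> T"
      by blast
    obtain \<epsilon> where \<epsilon>: "\<epsilon> > 0" "\<And>T m. T \<in> \<T> \<Longrightarrow> m = face_normal F \<or> m = - face_normal F \<Longrightarrow>
      ball z \<epsilon> \<inter> {x. m \<bullet> (x - z) > 0} \<subseteq> T \<or> ball z \<epsilon> \<inter> {x. m \<bullet> (x - z) > 0} \<inter> T = {}"
      by (rule half_ball_in_or_out[OF F(1) elim(2,3)]) blast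
    have m: "?\<nu> = face_normal F \<or> ?\<nu> = - face_normal F" "- ?\<nu> = face_normal F \<or> - ?\<nu> = - face_normal F"
      using normal_cases[OF T] by auto
    have minus: "{x. - ?\<nu> \<bullet> (x - z) > 0} = {x. ?\<nu> \<bullet> (x - z) < 0}"
      by auto
    define t where "t = min \<delta> \<epsilon> / 2"
    have t: "0 < t" "t < \<delta>" "t < \<epsilon>"
      using \<delta>(1) \<epsilon>(1) by (auto simp: t_def)
    have in_minus: "z - t *\<^sub>R ?\<nu> \<in> ball z \<epsilon> \<inter> {x. ?\<nu> \<bullet> (x - z) < 0}"
      and in_plus: "z + t *\<^sub>R ?\<nu> \<in> ball z \<epsilon> \<inter> {x. ?\<nu> \<bullet> (x - z) > 0}"
      using t \<nu> \<nu>0 by (auto simp: dist_norm)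
    have A: "ball z \<epsilon> \<inter> {x. ?\<nu> \<bullet> (x - z) < 0} \<subseteq> T"
      using \<epsilon>(2)[OF T(1) m(2)] in_minus \<delta>(2)[OF t(1,2)] unfolding minus by blast
    have B: "ball z \<epsilon> \<inter> {x. ?\<nu> \<bullet> (x - z) > 0} \<inter> T = {}"
      using \<epsilon>(2)[OF T(1) m(1)] in_plus \<delta>(2)[OF t(1,2)] by blast
    \<comment> \<open>The open intersection of \<open>T'\<close> with the ball contains a point off
      the plane. As this point is not on the side filled by \<open>T\<close>, the element
      \<open>T'\<close> owns the other half.\<close>
    have C: "ball z \<epsilon> \<inter> {x. ?\<nu> \<bullet> (x - z) > 0} \<subseteq> T'" if T': "T' \<in> \<T>" "T' \<noteq> T" "z \<in> closure T'" for T'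
    proof -
      have "ball z \<epsilon> \<inter> T' \<noteq> {}"
        using T'(3) \<epsilon>(1) open_Int_closure_eq_empty[of "ball z \<epsilon>" T'] by (metis centre_in_ball disjoint_iff open_ball)
      moreover have "open (ball z \<epsilon> \<inter> T')"
        using element(1)[OF T'(1)] by (intro open_Int open_ball)
      ultimately obtain x where x: "x \<in> ball z \<epsilon> \<inter> T'" "?\<nu> \<bullet> (x - z) \<noteq> 0"
        using open_not_in_hyperplane \<nu>0(1) by blast
      have "x \<notin> T"
        using x(1) elements_disjoint[OF T(1) T'(1)] T'(2) by blast
      then have "\<not> ?\<nu> \<bullet> (x - z) < 0"
        using A x(1) by blast
      then have "x \<in> ball z \<epsilon> \<inter> {x. ?\<nu> \<bullet> (x - z) > 0}"
        using x by auto
      then show ?thesis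
        using \<epsilon>(2)[OF T'(1) m(1)] x(1) by blast
    qed
    show ?case
      using \<epsilon>(1) A B C by (intro exI[of _ \<epsilon>]) blast
  qed
qed

text \<open>\<open>T\<close> and \<open>T'\<close> fill the two half balls, which leaves no room for
  a third element. Together they are dense in the ball, so its centre is interior to the closure of
  \<open>\<Omega>\<close> and hence in \<open>\<Omega>\<close>.\<close>

lemma two_elements_at_face:
  assumes T: "T \<in> \<T>" "F \<in> mesh_faces \<F> T"
  shows "AE z in surface_measure F. \<forall>T'\<in>\<T>. T' \<noteq> T \<longrightarrow> z \<in> closure T' \<longrightarrow>
    z \<in> \<Omega> \<and> (\<forall>T''\<in>\<T>. z \<in> closure T'' \<longrightarrow> T'' = T \<or> T'' = T')"
  using sides_of_face[OF T]
proof eventually_elim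
  case (elim z)
  let ?\<nu> = "normal T F"
  let ?P = "\<lambda>\<epsilon>. ball z \<epsilon> \<inter> {x. ?\<nu> \<bullet> (x - z) > 0}"
  have "norm ?\<nu> = 1"
    using outward_normal_normal[OF T] by (auto simp: outward_normal_def unit_normal_def)
  then have \<nu>0: "?\<nu> \<noteq> 0" "?\<nu> \<bullet> ?\<nu> = 1" "norm ?\<nu> = 1"
    by (auto simp: norm_eq_1)
  obtain \<epsilon> where \<epsilon>: "\<epsilon> > 0" and A: "ball z \<epsilon> \<inter> {x. ?\<nu> \<bullet> (x - z) < 0} \<subseteq> T"
    and C: "\<And>T'. T' \<in> \<T> \<Longrightarrow> T' \<noteq> T \<Longrightarrow> z \<in> closure T' \<Longrightarrow> ?P \<epsilon> \<subseteq> T'"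
    using elim by metis
  have "z + (\<epsilon> / 2) *\<^sub>R ?\<nu> \<in> ?P \<epsilon>"
    using \<epsilon> \<nu>0 by (auto simp: dist_norm)
  then have ne: "?P \<epsilon> \<noteq> {}"
    by blast
  show ?case
  proof (intro ballI impI conjI)
    fix T' assume T': "T' \<in> \<T>" "T' \<noteq> T" "z \<in> closure T'"
    show "T'' = T \<or> T'' = T'" if "T'' \<in> \<T>" "z \<in> closure T''" for T''
      using C[of T''] C[OF T'] ne elements_disjoint[of T' T''] that T'(1) by blast
    have "ball z \<epsilon> \<subseteq> closure \<Omega>"
    proof (rule ccontr)
      assume "\<not> ball z \<epsilon> \<subseteq> closure \<Omega>"
      then have "ball z \<epsilon> \<inter> - closure \<Omega> \<noteq> {}"
        by blast
      moreover have "open (ball z \<epsilon> \<inter> - closure \<Omega>)"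
        by (intro open_Int open_ball open_Compl closed_closure)
      ultimately obtain x where x: "x \<in> ball z \<epsilon> \<inter> - closure \<Omega>" "?\<nu> \<bullet> (x - z) \<noteq> 0"
        using open_not_in_hyperplane \<nu>0(1) by blast
      then have "x \<in> T \<or> x \<in> T'"
        using A C[OF T'] by (cases "?\<nu> \<bullet> (x - z) < 0") auto
      then have "x \<in> \<Omega>"
        using element(4)[OF T(1)] element(4)[OF T'(1)] by blast
      then show False
        using x(1) closure_subset by blast
    qed
    then have "z \<in> interior (closure \<Omega>)"
      using \<epsilon> by (meson mem_interior)
    then show "z \<in> \<Omega>"
      by (simp add: interior_closure_\<Omega>)
  qed
qed

text \<open>Both facts serve the law of action and reaction: a test unknown living on
  \<open>F\<close> alone satisfies the boundary condition, and only \<open>T1\<close> and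
  \<open>T2\<close> notice it.\<close>

lemma interface_faces:
  assumes "T1 \<in> \<T>" "T2 \<in> \<T>" "T1 \<noteq> T2" "F \<in> mesh_faces \<F> T1" "F \<in> mesh_faces \<F> T2"
  shows "\<not> is_boundary_face \<Omega> \<T> F"
    and "\<And>T. T \<in> \<T> \<Longrightarrow> F \<in> mesh_faces \<F> T \<Longrightarrow> T = T1 \<or> T = T2"
proof -
  have "face F"
    using assms(4) face_mesh mesh_facesD(1) by blast
  then obtain z where z: "z \<in> F"
    "\<forall>T'\<in>\<T>. T' \<noteq> T1 \<longrightarrow> z \<in> closure T' \<longrightarrow> z \<in> \<Omega> \<and> (\<forall>T''\<in>\<T>. z \<in> closure T'' \<longrightarrow> T'' = T1 \<or> T'' = T')"
    by (rule AE_surface_measure_ex[OF _ two_elements_at_face[OF assms(1,4)]])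
  have cl: "z \<in> closure T" if "F \<in> mesh_faces \<F> T" for T
    using mesh_facesD(2)[OF that] z(1) by (auto simp: frontier_def)
  have *: "z \<in> \<Omega> \<and> (\<forall>T''\<in>\<T>. z \<in> closure T'' \<longrightarrow> T'' = T1 \<or> T'' = T2)"
    using z(2) assms(2,3) cl[OF assms(5)] by blast
  show "\<not> is_boundary_face \<Omega> \<T> F"
  proof
    assume "is_boundary_face \<Omega> \<T> F"
    then have "z \<in> frontier \<Omega>"
      using z(1) by (auto simp: is_boundary_face_def)
    then show False
      using * open_\<Omega> by (simp add: frontier_def interior_open)
  qed
  show "T = T1 \<or> T = T2" if "T \<in> \<T>" "F \<in> mesh_faces \<F> T" for T
    using * that cl by blast
qed

text \<open>The point at issue is a mesh face that is not a face of \<open>T\<close>. On an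
  interface the two adjacent elements leave no room for \<open>T\<close>; on a boundary face a
  second element reaching \<open>z\<close> would put \<open>z\<close> into
  \<open>\<Omega>\<close>.\<close>

lemma polyhedral_cell_mesh:
  assumes T: "T \<in> \<T>"
  shows "polyhedral_cell T \<F> (mesh_faces \<F> T) (normal T)"
proof
  show "AE z in surface_measure F. flat_at T (mesh_faces \<F> T) (normal T) F z" if F: "F \<in> \<F>" for F
  proof (cases "F \<in> mesh_faces \<F> T")
    case True
    show ?thesis
      using sides_of_face[OF T True]
    proof eventually_elim
      case (elim z)
      then obtain \<epsilon> where \<epsilon>: "\<epsilon> > 0" "ball z \<epsilon> \<inter> {x. normal T F \<bullet> (x - z) < 0} \<subseteq> T"
        "ball z \<epsilon> \<inter> {x. normal T F \<bullet> (x - z) > 0} \<inter> T = {}"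
        by blast
      have "(normal T F \<bullet> (x - z) < 0 \<longrightarrow> x \<in> T) \<and> (normal T F \<bullet> (x - z) > 0 \<longrightarrow> x \<notin> T)"
        if "x \<in> ball z \<epsilon>" for x
        using \<epsilon>(2,3) that by blast
      then show ?case
        unfolding flat_at_def if_P[OF True] using \<epsilon>(1) by blast
    qed
  next
    case False
    have ae: "AE z in surface_measure F. z \<in> F"
      using AE_space[of "surface_measure F"] by simp
    consider "is_interface \<T> F" | "is_boundary_face \<Omega> \<T> F"
      using face_kind[OF F] by blast
    then show ?thesis
    proof cases
      case 1
      then obtain T1 T2 where T12: "T1 \<in> \<T>" "T2 \<in> \<T>" "T1 \<noteq> T2" "F \<in> mesh_faces \<F> T1" "F \<in> mesh_faces \<F> T2"
        using F by (auto simp: is_interface_def mesh_faces_def)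
      then have neq: "T \<noteq> T1" "T \<noteq> T2"
        using False by auto
      show ?thesis
        using two_elements_at_face[OF T12(1,4)] ae
      proof eventually_elim
        case (elim z)
        then have "z \<in> closure T2"
          using mesh_facesD(2)[OF T12(5)] by (auto simp: frontier_def)
        then have "z \<notin> closure T"
          using elim(1) T T12(2,3) neq by blast
        then show ?case
          using False by (simp add: flat_at_def frontier_def)
      qed
    next
      case 2
      then obtain T1 where T1: "T1 \<in> \<T>" "F \<in> mesh_faces \<F> T1" "F \<subseteq> frontier \<Omega>"
        using F by (auto simp: is_boundary_face_def mesh_faces_def)
      then have neq: "T \<noteq> T1"
        using False by auto
      show ?thesis
        using two_elements_at_face[OF T1(1,2)] ae
      proof eventually_elim
        case (elim z)
        then have "z \<notin> \<Omega>"
          using T1(3) open_\<Omega> by (auto simp: frontier_def interior_open)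
        then have "z \<notin> closure T"
          using elim(1) T neq by blast
        then show ?case
          using False by (simp add: flat_at_def frontier_def)
      qed
    qed
  qed
  show "open T" "bounded T" "frontier T \<subseteq> \<Union>\<F>"
    using element[OF T] by blast+
  show "finite \<F>"
    by (rule finite_F)
  show "face F" if "F \<in> \<F>" for F
    using that by (rule face_mesh)
  show "mesh_faces \<F> T \<subseteq> \<F>"
    using mesh_facesD(1) by blast
  show "F \<subseteq> frontier T" if "F \<in> mesh_faces \<F> T" for F
    using that by (rule mesh_facesD(2))
  show "normal T F = face_normal F \<or> normal T F = - face_normal F" if "F \<in> mesh_faces \<F> T" for F
    using T that by (rule normal_cases)
  show "AE z in surface_measure F. z \<notin> F'" if "F \<in> \<F>" "F' \<in> \<F>" "F \<noteq> F'" for F F'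
    using that by (rule overlap_null)
qed

end

section \<open>Projectors and differential operators on polynomial spaces\<close>

lemma subspace_sym_matrices: "subspace (sym_matrices :: (real^'d::finite^'d) set)"
  by (auto simp: subspace_def sym_matrices_def transpose_def vec_eq_iff)

text \<open>Covers elements with Lebesgue measure and faces with surface measure at once. The
  condition \<open>definite\<close> makes the integral of \<open>p x \<bullet> q x\<close> an inner
  product on \<open>poly_space\<close> in which zero norm means the zero function.\<close>

locale cell =
  fixes M :: "(real^'d::finite) measure" and X :: "(real^'d) set"
  assumes finite_M: "finite_measure M" and space_M: "space M \<subseteq> closure X" and bounded_X: "bounded X"
    and id_measurable: "(\<lambda>x. x) \<in> borel_measurable M"
    and definite: "\<And>p. real_polynomial_function p \<Longrightarrow> AE x in M. p x = 0 \<Longrightarrow> x \<in> closure X \<Longrightarrow> p x = 0"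

text \<open>Cut-off polynomials may jump at the edge of their support, so continuity is asked only
  on the space of the measure, through a representative. On bounded sets of finite measure this
  still gives integrability.\<close>

definition continuous_rep :: "'a::euclidean_space measure \<Rightarrow> ('a \<Rightarrow> 'b::real_normed_vector) \<Rightarrow> bool" where
  "continuous_rep M g \<longleftrightarrow> (\<exists>G. continuous_on UNIV G \<and> (\<forall>x\<in>space M. g x = G x))"

lemma continuous_repI: "continuous_on UNIV G \<Longrightarrow> (\<And>x. x \<in> space M \<Longrightarrow> g x = G x) \<Longrightarrow> continuous_rep M g"
  by (auto simp: continuous_rep_def)

lemma continuous_rep_inner:
  assumes "continuous_rep M f" "continuous_rep M g"
  shows "continuous_rep M (\<lambda>x. f x \<bullet> g x)"
proof -
  obtain F G where "continuous_on UNIV F" "\<forall>x\<in>space M. f x = F x" "continuous_on UNIV G" "\<forall>x\<in>space M. g x = G x"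
    using assms by (auto simp: continuous_rep_def)
  then show ?thesis
    by (intro continuous_repI[of "\<lambda>x. F x \<bullet> G x"] continuous_intros) auto
qed

lemma continuous_rep_add:
  assumes "continuous_rep M f" "continuous_rep M g"
  shows "continuous_rep M (\<lambda>x. f x + g x)"
proof -
  obtain F G where "continuous_on UNIV F" "\<forall>x\<in>space M. f x = F x" "continuous_on UNIV G" "\<forall>x\<in>space M. g x = G x"
    using assms by (auto simp: continuous_rep_def)
  then show ?thesis
    by (intro continuous_repI[of "\<lambda>x. F x + G x"] continuous_intros) auto
qed

lemma continuous_rep_linear:
  assumes "bounded_linear A" "continuous_rep M f"
  shows "continuous_rep M (\<lambda>x. A (f x))"
proof -
  obtain F where "continuous_on UNIV F" "\<forall>x\<in>space M. f x = F x"
    using assms by (auto simp: continuous_rep_def)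
  then show ?thesis
    using bounded_linear.continuous_on[OF assms(1)]
    by (intro continuous_repI[of "\<lambda>x. A (F x)"]) auto
qed

lemma continuous_rep_scale: "continuous_rep M f \<Longrightarrow> continuous_rep M (\<lambda>x. a *\<^sub>R f x)"
  by (rule continuous_rep_linear[OF bounded_linear_scaleR_right])

lemma continuous_rep_diff: "continuous_rep M f \<Longrightarrow> continuous_rep M g \<Longrightarrow> continuous_rep M (\<lambda>x. f x - g x)"
  using continuous_rep_add[of M f "\<lambda>x. (-1) *\<^sub>R g x"] continuous_rep_scale[of M g "-1"] by simp

lemma continuous_rep_poly:
  assumes "p \<in> poly_space l X (V::'v::real_normed_vector set)" "space M \<subseteq> closure X"
  shows "continuous_rep M p"
proof -
  obtain P where "P \<in> polynomials l V" "p = restr (closure X) P"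
    using assms(1) by (rule poly_spaceE)
  then show ?thesis
    using assms(2) by (intro continuous_repI[of P] polynomials_continuous) (auto simp: restr_def)
qed

context cell
begin

lemma integrable_rep:
  fixes g :: "real^'d \<Rightarrow> 'b::euclidean_space"
  assumes "continuous_rep M g"
  shows "integrable M g"
proof -
  interpret finite_measure M by (rule finite_M)
  obtain G where G: "continuous_on UNIV G" "\<And>x. x \<in> space M \<Longrightarrow> g x = G x"
    using assms by (auto simp: continuous_rep_def)
  have "compact (G ` closure X)"
    using G(1) bounded_X by (intro compact_continuous_image) (auto intro: continuous_on_subset simp: compact_closure)
  then obtain B where "\<And>x. x \<in> closure X \<Longrightarrow> norm (G x) \<le> B"
    by (force dest!: compact_imp_bounded simp: bounded_iff)
  then have "AE x in M. norm (G x) \<le> B"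
    using space_M by (intro AE_I2) auto
  moreover have "G \<in> borel_measurable M"
    using measurable_compose[OF id_measurable borel_measurable_continuous_onI[OF G(1)]] .
  ultimately have "integrable M G"
    by (intro integrable_const_bound)
  then show ?thesis
    using G(2) by (subst Bochner_Integration.integrable_cong[of M M g G]) auto
qed

text \<open>Only one factor has to be regular: this admits the stress and the load, which are merely
  integrable, against polynomials.\<close>

lemma integrable_inner_rep:
  fixes g :: "real^'d \<Rightarrow> 'b::euclidean_space"
  assumes g: "integrable M g" and q: "continuous_rep M q"
  shows "integrable M (\<lambda>x. g x \<bullet> q x)"
proof -
  obtain G where G: "continuous_on UNIV G" "\<And>x. x \<in> space M \<Longrightarrow> q x = G x"
    using q by (auto simp: continuous_rep_def)
  have "compact (G ` closure X)"
    using G(1) bounded_X by (intro compact_continuous_image) (auto intro: continuous_on_subset simp: compact_closure)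
  then obtain B where B: "\<And>x. x \<in> closure X \<Longrightarrow> norm (G x) \<le> B"
    by (force dest!: compact_imp_bounded simp: bounded_iff)
  have [measurable]: "G \<in> borel_measurable M" "g \<in> borel_measurable M"
    using measurable_compose[OF id_measurable borel_measurable_continuous_onI[OF G(1)]] g by auto
  have "integrable M (\<lambda>x. g x \<bullet> G x)"
  proof (rule Bochner_Integration.integrable_bound)
    show "integrable M (\<lambda>x. B * norm (g x))"
      using g by (intro integrable_mult_right integrable_norm)
    have "norm (g x \<bullet> G x) \<le> norm (B * norm (g x))" if "x \<in> space M" for x
    proof -
      have "\<bar>g x \<bullet> G x\<bar> \<le> norm (g x) * norm (G x)"
        by (rule Cauchy_Schwarz_ineq2)
      also have "\<dots> \<le> norm (g x) * B"
        using B that space_M by (intro mult_left_mono) auto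
      finally show ?thesis by (simp add: ac_simps)
    qed
    then show "AE x in M. norm (g x \<bullet> G x) \<le> norm (B * norm (g x))"
      by (rule AE_I2)
  qed measurable
  then show ?thesis
    using G(2) by (subst Bochner_Integration.integrable_cong[of M M _ "\<lambda>x. g x \<bullet> G x"]) auto
qed

lemma poly_rep: "p \<in> poly_space l X (V::'v::real_normed_vector set) \<Longrightarrow> continuous_rep M p"
  using continuous_rep_poly space_M by blast

lemma poly_eq_0:
  fixes p :: "real^'d \<Rightarrow> 'v::euclidean_space"
  assumes p: "p \<in> poly_space l X V" and ae: "AE x in M. p x = 0"
  shows "p = (\<lambda>x. 0)"
proof
  fix x
  obtain P where P: "P \<in> polynomials l V" "p = restr (closure X) P"
    using p by (rule poly_spaceE)
  show "p x = 0"
  proof (cases "x \<in> closure X")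
    case True
    have "P x \<bullet> b = 0" for b
    proof (rule definite[OF polynomials_inner_real_polynomial_function[OF P(1)] _ True])
      show "AE x in M. P x \<bullet> b = 0"
        using ae AE_space by eventually_elim (use P(2) space_M in \<open>auto simp: restr_def split: if_splits\<close>)
    qed
    then show ?thesis
      using P(2) by (auto simp: restr_def intro: euclidean_eqI)
  qed (use P(2) in \<open>simp add: restr_def\<close>)
qed

lemma poly_inner_self_eq_0:
  fixes p :: "real^'d \<Rightarrow> 'v::euclidean_space"
  assumes p: "p \<in> poly_space l X V" and 0: "(LINT x|M. p x \<bullet> p x) = 0"
  shows "p = (\<lambda>x. 0)"
proof (rule poly_eq_0[OF p])
  have "AE x in M. p x \<bullet> p x = 0"
    using 0 integrable_rep[OF continuous_rep_inner[OF poly_rep[OF p] poly_rep[OF p]]]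
    by (subst (asm) integral_nonneg_eq_0_iff_AE) auto
  then show "AE x in M. p x = 0"
    by simp
qed

lemma riesz_poly:
  fixes V :: "'v::euclidean_space set"
  assumes V: "subspace V"
    and L_add: "\<And>p q. p \<in> poly_space l X V \<Longrightarrow> q \<in> poly_space l X V \<Longrightarrow> L (\<lambda>x. p x + q x) = L p + L q"
    and L_scale: "\<And>a p. p \<in> poly_space l X V \<Longrightarrow> L (\<lambda>x. a *\<^sub>R p x) = a * (L p :: real)"
  shows "\<exists>!p. p \<in> poly_space l X V \<and> (\<forall>q\<in>poly_space l X V. (LINT x|M. p x \<bullet> q x) = L q)"
proof -
  obtain b :: "('d \<Rightarrow> nat) \<times> 'v \<Rightarrow> real^'d \<Rightarrow> 'v" and I where b: "finite I" "poly_space l X V = fspan b I"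
    using poly_space_fspan[OF V] .
  note int = integrable_rep[OF continuous_rep_inner[OF poly_rep poly_rep]]
  show ?thesis
  proof (rule riesz[OF b, of "\<lambda>p q. LINT x|M. p x \<bullet> q x" L])
    show "(LINT x|M. (p x + q x) \<bullet> r x) = (LINT x|M. p x \<bullet> r x) + (LINT x|M. q x \<bullet> r x)"
      if "p \<in> poly_space l X V" "q \<in> poly_space l X V" "r \<in> poly_space l X V" for p q r
      using int[OF that(1,3)] int[OF that(2,3)] by (simp add: inner_add_left)
  qed (use L_add L_scale poly_inner_self_eq_0 in \<open>auto simp: inner_commute\<close>)
qed

text \<open>An equivalence serves twice: from right to left it identifies a projection, from left to
  right it yields its moments. Integrability of the moments of \<open>g\<close> allows the defining
  integral of \<open>(g x - p x) \<bullet> q x\<close> to be split.\<close>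

lemma L2_proj_characterization:
  fixes g :: "real^'d \<Rightarrow> 'v::euclidean_space"
  assumes g: "\<And>q. q \<in> poly_space l X UNIV \<Longrightarrow> integrable M (\<lambda>x. g x \<bullet> q x)"
  shows "p = L2_proj M l X g \<longleftrightarrow>
    p \<in> poly_space l X UNIV \<and> (\<forall>q\<in>poly_space l X UNIV. (LINT x|M. p x \<bullet> q x) = (LINT x|M. g x \<bullet> q x))"
proof -
  let ?P = "\<lambda>p. p \<in> poly_space l X UNIV \<and> (\<forall>q\<in>poly_space l X UNIV. (LINT x|M. p x \<bullet> q x) = (LINT x|M. g x \<bullet> q x))"
  have ex1: "\<exists>!p. ?P p"
  proof (rule riesz_poly)
    show "(LINT x|M. g x \<bullet> (p x + q x)) = (LINT x|M. g x \<bullet> p x) + (LINT x|M. g x \<bullet> q x)"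
      if "p \<in> poly_space l X UNIV" "q \<in> poly_space l X UNIV" for p q
      using g that by (simp add: inner_add_right Bochner_Integration.integral_add)
  qed auto
  have the: "L2_proj M l X g = (THE p. ?P p)"
  proof -
    have "(LINT x|M. (g x - p x) \<bullet> q x) = (LINT x|M. g x \<bullet> q x) - (LINT x|M. p x \<bullet> q x)"
      if "p \<in> poly_space l X UNIV" "q \<in> poly_space l X UNIV" for p q
      using g[OF that(2)] integrable_rep[OF continuous_rep_inner[OF poly_rep[OF that(1)] poly_rep[OF that(2)]]]
      by (simp add: inner_diff_left)
    then have "(\<lambda>p. p \<in> poly_space l X UNIV \<and> (\<forall>q\<in>poly_space l X UNIV. (LINT x|M. (g x - p x) \<bullet> q x) = 0)) = ?P"
      by (intro ext) auto
    then show ?thesis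
      unfolding L2_proj_def by simp
  qed
  show ?thesis
    unfolding the using theI'[OF ex1] the1_equality[OF ex1, of p] by blast
qed

end

lemma cell_face:
  assumes "face (F :: (real^'d::finite) set)"
  shows "cell (surface_measure F) F"
proof (rule cell.intro)
  show "finite_measure (surface_measure F)"
    using assms by (rule finite_surface_measure)
  show "(\<lambda>x. x) \<in> borel_measurable (surface_measure F)"
    by (rule measurable_surface_measure) simp
  show "p x = 0" if "real_polynomial_function p" "AE x in surface_measure F. p x = 0" "x \<in> closure F" for p x
    using face_polynomial_eq_0[OF assms that(1,2)] that(3) face_closed[OF assms] by simp
qed (use assms face_bounded closure_subset in auto)

lemma cell_element:
  assumes "open T" "bounded T" "(T :: (real^'d::finite) set) \<noteq> {}"
  shows "cell (lebesgue_on T) T"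
proof (rule cell.intro)
  have T: "T \<in> sets lebesgue"
    using assms(1) by auto
  show "finite_measure (lebesgue_on T)"
  proof (rule finite_measureI)
    have "emeasure lborel T < \<infinity>"
      using assms(2) by (rule emeasure_bounded_finite)
    then show "emeasure (lebesgue_on T) (space (lebesgue_on T)) \<noteq> \<infinity>"
      using T assms(1) by (simp add: emeasure_restrict_space)
  qed
  show "(\<lambda>x. x) \<in> borel_measurable (lebesgue_on T)"
    by (intro measurable_restrict_space1 measurable_completion) simp
  show "p x = 0" if p: "real_polynomial_function p" and ae: "AE x in lebesgue_on T. p x = 0" for p x
  proof (rule real_polynomial_function_eq_0[OF p assms(1,3)])
    have "AE x in lebesgue. x \<in> T \<longrightarrow> p x = 0"
      using ae T by (subst (asm) AE_restrict_space_iff) auto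
    then show "AE x in lborel. x \<in> T \<longrightarrow> p x = 0"
      by (simp add: AE_completion_iff)
  qed
qed (use assms closure_subset in auto)

text \<open>Near a point of the open set the cut-off agrees with the polynomial \<open>P\<close>, so
  the derivatives there are those of \<open>P\<close>. \<open>P\<close> and \<open>D\<close> are
  returned as global functions, as the divergence theorem is stated for functions on the whole
  space.\<close>

lemma poly_space_derivative:
  assumes T: "open T" and V: "subspace V" and p: "p \<in> poly_space l T (V::'v::real_normed_vector set)"
  obtains P D where "P \<in> polynomials l V" "\<forall>j. D j \<in> polynomials l V" "p = restr (closure T) P"
    "\<forall>x. (P has_derivative (\<lambda>h. \<Sum>j\<in>UNIV. h $ j *\<^sub>R D j x)) (at x)"
    "\<forall>x\<in>T. p x = P x"
    "\<forall>x\<in>T. (p has_derivative (\<lambda>h. \<Sum>j\<in>UNIV. h $ j *\<^sub>R D j x)) (at x)"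
proof -
  obtain P where P: "P \<in> polynomials l V" "p = restr (closure T) P"
    using p by (rule poly_spaceE)
  obtain D where D: "\<forall>j. D j \<in> polynomials l V"
    "\<forall>x. (P has_derivative (\<lambda>h. \<Sum>j\<in>UNIV. h $ j *\<^sub>R D j x)) (at x)"
    by (rule polynomials_has_derivative[OF V P(1)])
  have eq: "p x = P x" if "x \<in> T" for x
    using that closure_subset P(2) by (auto simp: restr_def)
  have "(p has_derivative (\<lambda>h. \<Sum>j\<in>UNIV. h $ j *\<^sub>R D j x)) (at x)" if "x \<in> T" for x
    by (rule has_derivative_transform_within_open[OF D(2)[rule_format] T that]) (simp add: eq)
  then show thesis
    using that P D eq by blast
qed

lemma jacobian_has_derivative:
  fixes p :: "real^'d::finite \<Rightarrow> real^'d"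
  assumes "(p has_derivative (\<lambda>h. \<Sum>j\<in>UNIV. h $ j *\<^sub>R D j)) (at x)"
  shows "jacobian p (at x) $ i $ j = D j $ i"
proof -
  have "frechet_derivative p (at x) = (\<lambda>h. \<Sum>j\<in>UNIV. h $ j *\<^sub>R D j)"
    using frechet_derivative_at[OF assms] by simp
  moreover have "(\<Sum>j'\<in>UNIV. axis j 1 $ j' * D j' $ i) = D j $ i"
    by (simp add: axis_def if_distrib[of "\<lambda>c. c * _"] cong: if_cong)
  ultimately show ?thesis
    by (simp add: jacobian_def matrix_def)
qed

lemma sym_grad_has_derivative:
  fixes p :: "real^'d::finite \<Rightarrow> real^'d"
  assumes "(p has_derivative (\<lambda>h. \<Sum>j\<in>UNIV. h $ j *\<^sub>R D j)) (at x)"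
  shows "sym_grad p x = (\<chi> i j. (D j $ i + D i $ j) / 2)"
  by (simp add: sym_grad_def vec_eq_iff jacobian_has_derivative[OF assms] transpose_def)

lemma sym_grad_zero: "sym_grad (\<lambda>x. 0) x = (0 :: real^'d::finite^'d)"
  using sym_grad_has_derivative[of "\<lambda>x. 0 :: real^'d" "\<lambda>j. 0" x] by (simp add: vec_eq_iff)

lemma skew_grad_has_derivative:
  fixes p :: "real^'d::finite \<Rightarrow> real^'d"
  assumes "(p has_derivative (\<lambda>h. \<Sum>j\<in>UNIV. h $ j *\<^sub>R D j)) (at x)"
  shows "skew_grad p x = (\<chi> i j. (D i $ j - D j $ i) / 2)"
  by (simp add: skew_grad_def vec_eq_iff jacobian_has_derivative[OF assms])

lemma tensor_div_has_derivative:
  fixes p :: "real^'d::finite \<Rightarrow> real^'d^'d"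
  assumes "(p has_derivative (\<lambda>h. \<Sum>j\<in>UNIV. h $ j *\<^sub>R D j)) (at x)"
  shows "tensor_div p x = (\<chi> i. \<Sum>j\<in>UNIV. D j $ i $ j)"
proof -
  have "frechet_derivative p (at x) = (\<lambda>h. \<Sum>j\<in>UNIV. h $ j *\<^sub>R D j)"
    using frechet_derivative_at[OF assms] by simp
  moreover have "(\<Sum>j'\<in>UNIV. axis j 1 $ j' *\<^sub>R D j') = D j" for j
    by (simp add: axis_def if_distrib[of "\<lambda>c. c *\<^sub>R _"] cong: if_cong)
  ultimately show ?thesis
    by (simp add: tensor_div_def)
qed

lemma has_derivative_sum_add:
  fixes p q :: "real^'d::finite \<Rightarrow> 'v::real_normed_vector"
  assumes "(p has_derivative (\<lambda>h. \<Sum>j\<in>UNIV. h $ j *\<^sub>R D j)) (at x)"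
    "(q has_derivative (\<lambda>h. \<Sum>j\<in>UNIV. h $ j *\<^sub>R E j)) (at x)"
  shows "((\<lambda>x. a *\<^sub>R p x + q x) has_derivative (\<lambda>h. \<Sum>j\<in>UNIV. h $ j *\<^sub>R (a *\<^sub>R D j + E j))) (at x)"
proof -
  have "((\<lambda>x. a *\<^sub>R p x + q x) has_derivative
      (\<lambda>h. a *\<^sub>R (\<Sum>j\<in>UNIV. h $ j *\<^sub>R D j) + (\<Sum>j\<in>UNIV. h $ j *\<^sub>R E j))) (at x)"
    by (intro has_derivative_add has_derivative_scaleR_right assms)
  then show ?thesis
    by (simp add: scaleR_add_right sum.distrib scaleR_sum_right ac_simps)
qed

text \<open>Only points of \<open>T\<close> are claimed, since a cut-off polynomial may fail to be
  differentiable elsewhere.\<close>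

lemma poly_grad_linear:
  fixes p q :: "real^'d::finite \<Rightarrow> real^'d"
  assumes "open T" "p \<in> poly_space l T UNIV" "q \<in> poly_space l T UNIV" "x \<in> T"
  shows "sym_grad (\<lambda>x. a *\<^sub>R p x + q x) x = a *\<^sub>R sym_grad p x + sym_grad q x"
    and "skew_grad (\<lambda>x. a *\<^sub>R p x + q x) x = a *\<^sub>R skew_grad p x + skew_grad q x"
proof -
  obtain P D' where D': "\<forall>x\<in>T. (p has_derivative (\<lambda>h. \<Sum>j\<in>UNIV. h $ j *\<^sub>R D' j x)) (at x)"
    by (rule poly_space_derivative[OF assms(1) subspace_UNIV assms(2)])
  obtain Q E' where E': "\<forall>x\<in>T. (q has_derivative (\<lambda>h. \<Sum>j\<in>UNIV. h $ j *\<^sub>R E' j x)) (at x)"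
    by (rule poly_space_derivative[OF assms(1) subspace_UNIV assms(3)])
  define D E where "D = (\<lambda>j. D' j x)" and "E = (\<lambda>j. E' j x)"
  have D: "(p has_derivative (\<lambda>h. \<Sum>j\<in>UNIV. h $ j *\<^sub>R D j)) (at x)"
    "(q has_derivative (\<lambda>h. \<Sum>j\<in>UNIV. h $ j *\<^sub>R E j)) (at x)"
    using D' E' assms(4) by (auto simp: D_def E_def)
  note DE = has_derivative_sum_add[OF D, of a]
  show "sym_grad (\<lambda>x. a *\<^sub>R p x + q x) x = a *\<^sub>R sym_grad p x + sym_grad q x"
    unfolding sym_grad_has_derivative[OF DE] sym_grad_has_derivative[OF D(1)] sym_grad_has_derivative[OF D(2)]
    by (simp add: vec_eq_iff field_simps)
  show "skew_grad (\<lambda>x. a *\<^sub>R p x + q x) x = a *\<^sub>R skew_grad p x + skew_grad q x"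
    unfolding skew_grad_has_derivative[OF DE] skew_grad_has_derivative[OF D(1)] skew_grad_has_derivative[OF D(2)]
    by (simp add: vec_eq_iff field_simps)
qed

lemma poly_div_linear:
  fixes p q :: "real^'d::finite \<Rightarrow> real^'d^'d"
  assumes "open T" "p \<in> poly_space l T V" "q \<in> poly_space l T V" "x \<in> T"
  shows "tensor_div (\<lambda>x. a *\<^sub>R p x + q x) x = a *\<^sub>R tensor_div p x + tensor_div q x"
proof -
  have pq: "p \<in> poly_space l T UNIV" "q \<in> poly_space l T UNIV"
    using assms poly_space_mono[of V UNIV] by auto
  obtain P D' where D': "\<forall>x\<in>T. (p has_derivative (\<lambda>h. \<Sum>j\<in>UNIV. h $ j *\<^sub>R D' j x)) (at x)"
    by (rule poly_space_derivative[OF assms(1) subspace_UNIV pq(1)])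
  obtain Q E' where E': "\<forall>x\<in>T. (q has_derivative (\<lambda>h. \<Sum>j\<in>UNIV. h $ j *\<^sub>R E' j x)) (at x)"
    by (rule poly_space_derivative[OF assms(1) subspace_UNIV pq(2)])
  define D E where "D = (\<lambda>j. D' j x)" and "E = (\<lambda>j. E' j x)"
  have D: "(p has_derivative (\<lambda>h. \<Sum>j\<in>UNIV. h $ j *\<^sub>R D j)) (at x)"
    "(q has_derivative (\<lambda>h. \<Sum>j\<in>UNIV. h $ j *\<^sub>R E j)) (at x)"
    using D' E' assms(4) by (auto simp: D_def E_def)
  note DE = has_derivative_sum_add[OF D, of a]
  show ?thesis
    unfolding tensor_div_has_derivative[OF DE] tensor_div_has_derivative[OF D(1)] tensor_div_has_derivative[OF D(2)]
    by (simp add: vec_eq_iff sum.distrib sum_distrib_left)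
qed

lemma poly_grad_rep:
  fixes p :: "real^'d::finite \<Rightarrow> real^'d"
  assumes "open T" "p \<in> poly_space l T UNIV"
  shows "continuous_rep (lebesgue_on T) (sym_grad p)" "continuous_rep (lebesgue_on T) (skew_grad p)"
proof -
  obtain P D where D: "\<forall>j. D j \<in> polynomials l UNIV"
    "\<forall>x\<in>T. (p has_derivative (\<lambda>h. \<Sum>j\<in>UNIV. h $ j *\<^sub>R D j x)) (at x)"
    by (rule poly_space_derivative[OF assms(1) subspace_UNIV assms(2)])
  have c: "continuous_on UNIV (D j)" for j
    using D(1) polynomials_continuous by blast
  show "continuous_rep (lebesgue_on T) (sym_grad p)"
    by (rule continuous_repI[of "\<lambda>x. \<chi> i j. (D j x $ i + D i x $ j) / 2"])
      (use c in \<open>auto intro!: continuous_intros simp: sym_grad_has_derivative[OF D(2)[rule_format]]\<close>)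
  show "continuous_rep (lebesgue_on T) (skew_grad p)"
    by (rule continuous_repI[of "\<lambda>x. \<chi> i j. (D i x $ j - D j x $ i) / 2"])
      (use c in \<open>auto intro!: continuous_intros simp: skew_grad_has_derivative[OF D(2)[rule_format]]\<close>)
qed

lemma poly_div_rep:
  fixes p :: "real^'d::finite \<Rightarrow> real^'d^'d"
  assumes "open T" "p \<in> poly_space l T V"
  shows "continuous_rep (lebesgue_on T) (tensor_div p)"
proof -
  have p: "p \<in> poly_space l T UNIV"
    using assms poly_space_mono[of V UNIV] by auto
  obtain P D where D: "\<forall>j. D j \<in> polynomials l UNIV"
    "\<forall>x\<in>T. (p has_derivative (\<lambda>h. \<Sum>j\<in>UNIV. h $ j *\<^sub>R D j x)) (at x)"
    by (rule poly_space_derivative[OF assms(1) subspace_UNIV p])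
  have c: "continuous_on UNIV (D j)" for j
    using D(1) polynomials_continuous by blast
  show ?thesis
    by (rule continuous_repI[of "\<lambda>x. \<chi> i. \<Sum>j\<in>UNIV. D j x $ i $ j"])
      (use c in \<open>auto intro!: continuous_intros simp: tensor_div_has_derivative[OF D(2)[rule_format]]\<close>)
qed

text \<open>\<open>sym_grad p\<close> need not have the cut-off form outside \<open>T\<close>, so a
  member of \<open>poly_space\<close> with the same values on \<open>T\<close> stands in for it as a
  test tensor.\<close>

lemma sym_grad_poly_space:
  fixes p :: "real^'d::finite \<Rightarrow> real^'d"
  assumes "open T" "p \<in> poly_space l T UNIV"
  obtains s where "s \<in> poly_space l T sym_matrices" "\<forall>x\<in>T. s x = sym_grad p x"
proof -
  obtain P D where D: "\<forall>j. D j \<in> polynomials l UNIV"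
    "\<forall>x\<in>T. (p has_derivative (\<lambda>h. \<Sum>j\<in>UNIV. h $ j *\<^sub>R D j x)) (at x)"
    by (rule poly_space_derivative[OF assms(1) subspace_UNIV assms(2)])
  \<comment> \<open>\<open>?A j v\<close> is the symmetric part of the tensor product of
    \<open>v\<close> with the \<open>j\<close>-th coordinate vector, so the sum of
    \<open>?A j (D j x)\<close> over \<open>j\<close> is the symmetric gradient, now with symmetric
    coefficients.\<close>
  let ?A = "\<lambda>j v. (\<chi> i' j'. ((if j' = j then v $ i' else 0) + (if i' = j then v $ j' else 0)) / 2) :: real^'d^'d"
  have lin: "linear (?A j)" for j
    by (rule linearI) (auto simp: vec_eq_iff field_simps)
  have sym: "?A j v \<in> sym_matrices" for j v
    by (simp add: sym_matrices_def transpose_def vec_eq_iff)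
  let ?S = "\<lambda>x. \<Sum>j\<in>UNIV. ?A j (D j x)"
  have "?S \<in> polynomials l sym_matrices"
    using D(1) sym
    by (intro polynomials_sum[OF subspace_sym_matrices] polynomials_linear_image[OF lin, of _ UNIV]) auto
  then have "restr (closure T) ?S \<in> poly_space l T sym_matrices"
    by (rule poly_spaceI)
  moreover have "restr (closure T) ?S x = sym_grad p x" if "x \<in> T" for x
  proof -
    have "?S x = (\<chi> i j. (D j x $ i + D i x $ j) / 2)"
      by (simp add: vec_eq_iff sum_divide_distrib[symmetric] sum.distrib if_distrib[of "\<lambda>v. v / 2"] cong: if_cong)
    then show ?thesis
      using that closure_subset by (auto simp: restr_def sym_grad_has_derivative[OF D(2)[rule_format, OF that]])
  qed
  ultimately show thesis
    using that by blast
qed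

section \<open>Reconstruction operators\<close>

lemma polynomials_degree_mono:
  assumes "0 \<in> V" "l \<le> m"
  shows "polynomials l V \<subseteq> polynomials m V"
proof
  fix p assume "p \<in> polynomials l V"
  then obtain c where c: "\<forall>\<alpha>. c \<alpha> \<in> V" "\<forall>x. p x = (\<Sum>\<alpha> | sum \<alpha> UNIV \<le> l. mpower \<alpha> x *\<^sub>R c \<alpha>)"
    by (rule polynomialsE)
  have "p x = (\<Sum>\<alpha> | sum \<alpha> UNIV \<le> m. mpower \<alpha> x *\<^sub>R (if sum \<alpha> UNIV \<le> l then c \<alpha> else 0))" for x
    unfolding c(2)[rule_format] using assms(2) finite_multi_indices[of m]
    by (intro sum.mono_neutral_cong_left) auto
  then show "p \<in> polynomials m V"
    using c(1) assms(1) by (intro polynomialsI[where c = "\<lambda>\<alpha>. if sum \<alpha> UNIV \<le> l then c \<alpha> else 0"]) auto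
qed

lemma poly_space_degree_mono: "0 \<in> V \<Longrightarrow> l \<le> m \<Longrightarrow> poly_space l X V \<subseteq> poly_space m X V"
  unfolding poly_space_def by (intro image_mono polynomials_degree_mono)

lemma inner_transpose: "transpose (A :: real^'d::finite^'d) \<bullet> transpose B = A \<bullet> B"
  unfolding inner_vec_def transpose_def by (subst sum.swap) simp

lemma sym_matrix_inner_transpose:
  assumes "A \<in> sym_matrices" shows "A \<bullet> transpose B = A \<bullet> (B :: real^'d::finite^'d)"
  using inner_transpose[of A B] assms by (simp add: sym_matrices_def)

text \<open>Integrating along segments gives \<open>(P x - P y) \<bullet> (x - y) = 0\<close>; polarization then shows that
  \<open>x \<mapsto> P x - P 0\<close> is skew, and a skew map is automatically linear.\<close>

lemma skew_rigid:
  fixes P :: "real^'d::finite \<Rightarrow> real^'d"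
  assumes deriv: "\<And>x. (P has_derivative P' x) (at x)" and skew: "\<And>x h. P' x h \<bullet> h = 0"
  obtains c W where "linear W" "\<forall>x. P x = c + W x" "\<forall>x y. W x \<bullet> y = - (x \<bullet> W y)"
proof -
  have orth: "(P x - P y) \<bullet> (x - y) = 0" for x y
  proof -
    let ?f = "\<lambda>t. P (y + t *\<^sub>R (x - y)) \<bullet> (x - y)"
    have "(?f has_derivative (\<lambda>s. P' (y + t *\<^sub>R (x - y)) (s *\<^sub>R (x - y)) \<bullet> (x - y))) (at t)" for t
      by (intro has_derivative_inner_left has_derivative_compose[OF _ deriv])
        (auto intro!: derivative_eq_intros)
    moreover have "P' z (s *\<^sub>R (x - y)) \<bullet> (x - y) = 0" for z s
      using skew has_derivative_linear[OF deriv] by (simp add: linear_cmul)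
    ultimately have "(?f has_derivative (\<lambda>s. 0)) (at t)" for t
      by simp
    then have "?f 1 = ?f 0"
      using has_derivative_zero_constant[of UNIV ?f] by (metis UNIV_I convex_UNIV has_derivative_at_withinI)
    then show ?thesis
      by (simp add: inner_diff_left)
  qed
  define W where "W x = P x - P 0" for x
  have self: "W x \<bullet> x = 0" for x
    using orth[of x 0] by (simp add: W_def)
  have anti: "W x \<bullet> y = - (x \<bullet> W y)" for x y
  proof -
    have "(W x - W y) \<bullet> (x - y) = 0"
      using orth[of x y] by (simp add: W_def)
    then show ?thesis
      using self[of x] self[of y] by (simp add: inner_diff_left inner_diff_right inner_commute)
  qed
  have "linear W"
  proof (rule linearI)
    show "W (x + y) = W x + W y" for x y
      by (rule vector_eq_rdot[THEN iffD1]) (simp add: anti inner_add_left)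
    show "W (a *\<^sub>R x) = a *\<^sub>R W x" for a x
      by (rule vector_eq_rdot[THEN iffD1]) (simp add: anti)
  qed
  then show thesis
    using anti by (intro that[of W "P 0"]) (auto simp: W_def)
qed

lemma poly_space_values:
  assumes V: "subspace V" and p: "p \<in> poly_space l X V"
  shows "p x \<in> V"
proof -
  obtain c where c: "\<forall>\<alpha>. c \<alpha> \<in> V"
    and p: "p = restr (closure X) (\<lambda>x. \<Sum>\<alpha> | sum \<alpha> UNIV \<le> l. mpower \<alpha> x *\<^sub>R c \<alpha>)"
    using p by (auto simp: poly_space_def polynomials_eq)
  then show ?thesis
    using V by (auto simp: restr_def intro!: subspace_sum subspace_scale subspace_0)
qed

locale hho_element = polyhedral_mesh_on \<Omega> \<T> \<F>
  for \<Omega> :: "(real^'d::finite) set" and \<T> \<F> +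
  fixes T :: "(real^'d) set" and k :: nat
  assumes T: "T \<in> \<T>"
begin

abbreviation "faces \<equiv> mesh_faces \<F> T"
abbreviation "vol \<equiv> lebesgue_on T"
abbreviation "srf \<equiv> surface_measure"
abbreviation "\<nu> \<equiv> normal T"

lemma open_T: "open T"
  by (rule element(1)[OF T])

sublocale E: cell vol T
  by (rule cell_element) (use element[OF T] in auto)

lemma face_faces: "F \<in> faces \<Longrightarrow> face F"
  using face_mesh mesh_facesD by blast

lemma face_cell: "F \<in> faces \<Longrightarrow> cell (srf F) F"
  by (rule cell_face[OF face_faces])

lemma face_closure: "F \<in> faces \<Longrightarrow> F \<subseteq> closure T"
  using mesh_facesD(2)[of F T] by (auto simp: frontier_def)

lemma closed_faces: "F \<in> faces \<Longrightarrow> closed F"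
  using face_closed face_faces by blast

lemma face_int: "F \<in> faces \<Longrightarrow> continuous_rep (srf F) (g :: _ \<Rightarrow> 'b::euclidean_space) \<Longrightarrow> integrable (srf F) g"
  using cell.integrable_rep[OF face_cell] by blast

lemma face_rep: "F \<in> faces \<Longrightarrow> p \<in> poly_space l F V \<Longrightarrow> continuous_rep (srf F) p"
  for V :: "'v::real_normed_vector set"
  using cell.poly_rep[OF face_cell] by blast

lemma trace_rep: "F \<in> faces \<Longrightarrow> p \<in> poly_space l T V \<Longrightarrow> continuous_rep (srf F) p"
  for V :: "'v::real_normed_vector set"
  using face_closure by (intro continuous_rep_poly) auto

lemma trace_poly: "F \<in> faces \<Longrightarrow> p \<in> poly_space l T V \<Longrightarrow> restr F p \<in> poly_space l F V"
  for V :: "'v::real_normed_vector set"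
  using face_closure closed_faces by (intro poly_space_restr)

lemma scalar_divergence:
  fixes \<phi> :: "real^'d \<Rightarrow> real"
  assumes "\<And>x. (\<phi> has_derivative \<phi>' x) (at x)" "\<And>e. continuous_on UNIV (\<lambda>x. \<phi>' x e)"
  shows "(LINT x|vol. \<phi>' x a) = (\<Sum>F\<in>faces. (\<nu> F \<bullet> a) * (LINT x|srf F. \<phi> x))"
  using polyhedral_cell.divergence[OF polyhedral_cell_mesh[OF T], of \<phi> \<phi>' a] assms by blast

text \<open>The scalar divergence theorem is applied, in the \<open>j\<close>-th coordinate
  direction, to each product of the entry \<open>i j\<close> of \<open>\<tau>\<close> with the
  component \<open>i\<close> of \<open>v\<close>. Symmetry of \<open>\<tau>\<close> then allows the
  full gradient to be replaced by \<open>sym_grad\<close>.\<close>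

theorem green:
  assumes \<tau>: "\<tau> \<in> poly_space l T sym_matrices" and v: "v \<in> poly_space m T UNIV"
  shows "(LINT x|vol. \<tau> x \<bullet> sym_grad v x) =
    - (LINT x|vol. v x \<bullet> tensor_div \<tau> x) + (\<Sum>F\<in>faces. LINT x|srf F. v x \<bullet> (\<tau> x *v \<nu> F))"
proof -
  obtain P D where P: "P \<in> polynomials m UNIV" "\<forall>j. D j \<in> polynomials m UNIV" "v = restr (closure T) P"
    "\<forall>x. (P has_derivative (\<lambda>h. \<Sum>j\<in>UNIV. h $ j *\<^sub>R D j x)) (at x)" "\<forall>x\<in>T. v x = P x"
    "\<forall>x\<in>T. (v has_derivative (\<lambda>h. \<Sum>j\<in>UNIV. h $ j *\<^sub>R D j x)) (at x)"
    by (rule poly_space_derivative[OF open_T subspace_UNIV v])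
  obtain Q E where Q: "Q \<in> polynomials l sym_matrices" "\<forall>j. E j \<in> polynomials l sym_matrices" "\<tau> = restr (closure T) Q"
    "\<forall>x. (Q has_derivative (\<lambda>h. \<Sum>j\<in>UNIV. h $ j *\<^sub>R E j x)) (at x)" "\<forall>x\<in>T. \<tau> x = Q x"
    "\<forall>x\<in>T. (\<tau> has_derivative (\<lambda>h. \<Sum>j\<in>UNIV. h $ j *\<^sub>R E j x)) (at x)"
    by (rule poly_space_derivative[OF open_T subspace_sym_matrices \<tau>])
  have cont [continuous_intros]: "continuous_on UNIV P" "continuous_on UNIV Q" "\<And>j. continuous_on UNIV (D j)" "\<And>j. continuous_on UNIV (E j)"
    using P(1,2) Q(1,2) polynomials_continuous by blast+
  define \<phi> where "\<phi> i j x = Q x $ i $ j * P x $ i" for i j x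
  define \<phi>' where "\<phi>' i j x h = Q x $ i $ j * (\<Sum>j'\<in>UNIV. h $ j' *\<^sub>R D j' x) $ i + (\<Sum>j'\<in>UNIV. h $ j' *\<^sub>R E j' x) $ i $ j * P x $ i"
    for i j x h
  have \<phi>: "(\<phi> i j has_derivative \<phi>' i j x) (at x)" for i j x
    unfolding \<phi>_def[abs_def] \<phi>'_def[abs_def]
    by (intro has_derivative_mult bounded_linear.has_derivative[OF bounded_linear_vec_nth]
        P(4)[rule_format] Q(4)[rule_format])
  have cont': "continuous_on UNIV (\<lambda>x. \<phi>' i j x e)" for i j e
    unfolding \<phi>'_def by (intro continuous_intros)
  have cont\<phi>: "continuous_on UNIV (\<phi> i j)" for i j
    unfolding \<phi>_def[abs_def] by (intro continuous_intros)
  have axis: "\<phi>' i j x (axis j 1) = Q x $ i $ j * D j x $ i + E j x $ i $ j * P x $ i" for i j x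
    by (simp add: \<phi>'_def axis_def if_distrib[of "\<lambda>c. c * _"] cong: if_cong)
  have intT: "integrable vol (\<lambda>x. \<phi>' i j x e)" for i j e
    using cont' by (intro E.integrable_rep continuous_repI[of "\<lambda>x. \<phi>' i j x e"]) auto
  have intF: "integrable (srf F) (\<phi> i j)" if "F \<in> faces" for F i j
    using cont\<phi> that by (intro face_int continuous_repI[of "\<phi> i j"]) auto
  have vol_eq: "(\<Sum>i\<in>UNIV. \<Sum>j\<in>UNIV. \<phi>' i j x (axis j 1)) = \<tau> x \<bullet> sym_grad v x + v x \<bullet> tensor_div \<tau> x"
    if x: "x \<in> T" for x
  proof -
    let ?J = "(\<chi> i j. D j x $ i) :: real^'d^'d"
    have "sym_grad v x = (1/2) *\<^sub>R (?J + transpose ?J)"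
      by (simp add: sym_grad_has_derivative[OF P(6)[rule_format, OF x]] vec_eq_iff transpose_def)
    then have "\<tau> x \<bullet> sym_grad v x = \<tau> x \<bullet> ?J"
      using sym_matrix_inner_transpose[OF poly_space_values[OF subspace_sym_matrices \<tau>, of x], of ?J]
      by (simp add: inner_add_right)
    then show ?thesis
      using x P(5) Q(5)
      by (simp add: tensor_div_has_derivative[OF Q(6)[rule_format, OF x]] axis inner_vec_def sum.distrib
          sum_distrib_left ac_simps)
  qed
  have face_eq: "(\<Sum>i\<in>UNIV. \<Sum>j\<in>UNIV. (\<nu> F \<bullet> axis j 1) * \<phi> i j x) = v x \<bullet> (\<tau> x *v \<nu> F)"
    if "F \<in> faces" "x \<in> F" for F x
  proof -
    have "v x = P x" "\<tau> x = Q x"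
      using face_closure[OF that(1)] that(2) P(3) Q(3) by (auto simp: restr_def)
    then show ?thesis
      by (simp add: \<phi>_def inner_vec_def[of "P x"] matrix_vector_mult_def inner_axis sum_distrib_left ac_simps)
  qed
  have "(LINT x|vol. \<tau> x \<bullet> sym_grad v x) + (LINT x|vol. v x \<bullet> tensor_div \<tau> x) =
      (LINT x|vol. \<tau> x \<bullet> sym_grad v x + v x \<bullet> tensor_div \<tau> x)"
    by (intro Bochner_Integration.integral_add[symmetric] E.integrable_rep continuous_rep_inner
        E.poly_rep[OF \<tau>] E.poly_rep[OF v] poly_grad_rep[OF open_T v] poly_div_rep[OF open_T \<tau>])
  also have "\<dots> = (LINT x|vol. (\<Sum>i\<in>UNIV. \<Sum>j\<in>UNIV. \<phi>' i j x (axis j 1)))"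
    by (rule Bochner_Integration.integral_cong) (simp_all add: vol_eq)
  also have "\<dots> = (\<Sum>i\<in>UNIV. \<Sum>j\<in>UNIV. LINT x|vol. \<phi>' i j x (axis j 1))"
    using intT by (simp add: Bochner_Integration.integral_sum Bochner_Integration.integrable_sum)
  also have "\<dots> = (\<Sum>i\<in>UNIV. \<Sum>j\<in>UNIV. \<Sum>F\<in>faces. (\<nu> F \<bullet> axis j 1) * (LINT x|srf F. \<phi> i j x))"
    by (intro sum.cong refl scalar_divergence \<phi> cont')
  also have "\<dots> = (\<Sum>i\<in>UNIV. \<Sum>F\<in>faces. \<Sum>j\<in>UNIV. (\<nu> F \<bullet> axis j 1) * (LINT x|srf F. \<phi> i j x))"
    by (intro sum.cong refl sum.swap)
  also have "\<dots> = (\<Sum>F\<in>faces. \<Sum>i\<in>UNIV. \<Sum>j\<in>UNIV. (\<nu> F \<bullet> axis j 1) * (LINT x|srf F. \<phi> i j x))"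
    by (rule sum.swap)
  also have "\<dots> = (\<Sum>F\<in>faces. LINT x|srf F. (\<Sum>i\<in>UNIV. \<Sum>j\<in>UNIV. (\<nu> F \<bullet> axis j 1) * \<phi> i j x))"
    using intF by (intro sum.cong refl) (simp add: Bochner_Integration.integral_sum Bochner_Integration.integrable_sum)
  also have "\<dots> = (\<Sum>F\<in>faces. LINT x|srf F. v x \<bullet> (\<tau> x *v \<nu> F))"
    by (intro sum.cong refl Bochner_Integration.integral_cong) (simp_all add: face_eq)
  finally show ?thesis
    by simp
qed

text \<open>The divergence theorem, entry by entry. It says that the traces of a polynomial satisfy
  the condition on the skew gradient in the definition of \<open>disp_rec\<close>.\<close>

lemma integral_skew_grad:
  assumes v: "v \<in> poly_space m T UNIV"
  shows "(LINT x|vol. skew_grad v x) =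
    (\<Sum>F\<in>faces. LINT x|srf F. (1/2) *\<^sub>R (outer (\<nu> F) (v x) - outer (v x) (\<nu> F)))"
proof -
  obtain P D where P: "P \<in> polynomials m UNIV" "\<forall>j. D j \<in> polynomials m UNIV" "v = restr (closure T) P"
    "\<forall>x. (P has_derivative (\<lambda>h. \<Sum>j\<in>UNIV. h $ j *\<^sub>R D j x)) (at x)" "\<forall>x\<in>T. v x = P x"
    "\<forall>x\<in>T. (v has_derivative (\<lambda>h. \<Sum>j\<in>UNIV. h $ j *\<^sub>R D j x)) (at x)"
    by (rule poly_space_derivative[OF open_T subspace_UNIV v])
  have cont [continuous_intros]: "continuous_on UNIV P" "\<And>j. continuous_on UNIV (D j)"
    using P(1,2) polynomials_continuous by blast+
  have entry: "bounded_linear (\<lambda>A :: real^'d^'d. A $ i $ j)" for i j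
    by (intro bounded_linear_compose[OF bounded_linear_vec_nth] bounded_linear_vec_nth)
  have div: "(LINT x|vol. D j x $ i) = (\<Sum>F\<in>faces. \<nu> F $ j * (LINT x|srf F. P x $ i))" for i j
  proof -
    have "((\<lambda>x. P x $ i) has_derivative (\<lambda>h. (\<Sum>j\<in>UNIV. h $ j *\<^sub>R D j x) $ i)) (at x)" for x
      by (intro bounded_linear.has_derivative[OF bounded_linear_vec_nth] P(4)[rule_format])
    then have "(LINT x|vol. (\<Sum>j'\<in>UNIV. axis j 1 $ j' *\<^sub>R D j' x) $ i) =
        (\<Sum>F\<in>faces. (\<nu> F \<bullet> axis j 1) * (LINT x|srf F. P x $ i))"
      by (rule scalar_divergence) (intro continuous_intros)
    then show ?thesis
      by (simp add: axis_def if_distrib[of "\<lambda>c. c * _"] inner_axis[unfolded axis_def] cong: if_cong)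
  qed
  have intT: "integrable vol (\<lambda>x. D j x $ i)" for i j
    by (intro E.integrable_rep continuous_repI[of "\<lambda>x. D j x $ i"] continuous_intros) auto
  have intF: "integrable (srf F) (\<lambda>x. P x $ i)" if "F \<in> faces" for F i
    using that by (intro face_int continuous_repI[of "\<lambda>x. P x $ i"] continuous_intros) auto
  have intS: "integrable vol (skew_grad v)"
    by (intro E.integrable_rep poly_grad_rep[OF open_T v])
  have intO: "integrable (srf F) (\<lambda>x. (1/2) *\<^sub>R (outer (\<nu> F) (v x) - outer (v x) (\<nu> F)))" if "F \<in> faces" for F
  proof (intro face_int[OF that] continuous_repI[of "\<lambda>x. (1/2) *\<^sub>R (outer (\<nu> F) (P x) - outer (P x) (\<nu> F))"])
    show "continuous_on UNIV (\<lambda>x. (1/2) *\<^sub>R (outer (\<nu> F) (P x) - outer (P x) (\<nu> F)))"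
      unfolding outer_def by (intro continuous_intros)
    show "(1/2) *\<^sub>R (outer (\<nu> F) (v x) - outer (v x) (\<nu> F)) = (1/2) *\<^sub>R (outer (\<nu> F) (P x) - outer (P x) (\<nu> F))"
      if "x \<in> space (srf F)" for x
      using face_closure[OF \<open>F \<in> faces\<close>] that P(3) by (auto simp: restr_def)
  qed
  show ?thesis
  proof (intro vec_eq_iff[THEN iffD2] allI)
    fix i j
    have "(LINT x|vol. skew_grad v x) $ i $ j = (LINT x|vol. skew_grad v x $ i $ j)"
      by (rule integral_bounded_linear[OF entry intS, symmetric])
    also have "\<dots> = (LINT x|vol. (D i x $ j - D j x $ i) / 2)"
      by (rule Bochner_Integration.integral_cong) (simp_all add: skew_grad_has_derivative[OF P(6)[rule_format]])
    also have "\<dots> = (\<Sum>F\<in>faces. (\<nu> F $ i * (LINT x|srf F. P x $ j) - \<nu> F $ j * (LINT x|srf F. P x $ i)) / 2)"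
      using intT by (simp add: div sum_subtractf sum_divide_distrib[symmetric])
    also have "\<dots> = (\<Sum>F\<in>faces. LINT x|srf F. ((1/2) *\<^sub>R (outer (\<nu> F) (v x) - outer (v x) (\<nu> F))) $ i $ j)"
    proof (intro sum.cong refl)
      fix F assume F: "F \<in> faces"
      have "(LINT x|srf F. ((1/2) *\<^sub>R (outer (\<nu> F) (v x) - outer (v x) (\<nu> F))) $ i $ j) =
          (LINT x|srf F. (\<nu> F $ i * P x $ j - \<nu> F $ j * P x $ i) / 2)"
        using face_closure[OF F] P(3)
        by (intro Bochner_Integration.integral_cong) (auto simp: outer_def restr_def ac_simps)
      then show "(\<nu> F $ i * (LINT x|srf F. P x $ j) - \<nu> F $ j * (LINT x|srf F. P x $ i)) / 2 =
          (LINT x|srf F. ((1/2) *\<^sub>R (outer (\<nu> F) (v x) - outer (v x) (\<nu> F))) $ i $ j)"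
        using intF[OF F] by simp
    qed
    also have "\<dots> = (\<Sum>F\<in>faces. (LINT x|srf F. (1/2) *\<^sub>R (outer (\<nu> F) (v x) - outer (v x) (\<nu> F))) $ i $ j)"
      by (intro sum.cong refl integral_bounded_linear[OF entry intO])
    finally show "(LINT x|vol. skew_grad v x) $ i $ j =
        (\<Sum>F\<in>faces. LINT x|srf F. (1/2) *\<^sub>R (outer (\<nu> F) (v x) - outer (v x) (\<nu> F))) $ i $ j"
      by simp
  qed
qed

text \<open>Under a zero measure everything holds almost everywhere, even \<open>1 = 0\<close>,
  which contradicts \<open>definite\<close>.\<close>

lemma vol_nonzero: "measure vol T \<noteq> 0"
proof
  interpret finite_measure vol by (rule E.finite_M)
  assume "measure vol T = 0"
  then have "emeasure vol (space vol) = 0"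
    by (simp add: emeasure_eq_measure)
  then have bot: "ae_filter vol = bot"
    by (simp add: ae_filter_eq_bot_iff)
  have "AE x in vol. (1::real) = 0"
    unfolding bot by (rule eventually_bot)
  moreover obtain x where "x \<in> T"
    using element(3)[OF T] by auto
  ultimately show False
    using E.definite[of "\<lambda>_. 1" x] closure_subset[of T] real_polynomial_function.intros(2)[of 1] by auto
qed

text \<open>A field without strain is a rigid motion; the mean of the skew gradient then removes the
  rotation and the mean of the field removes the translation.\<close>

lemma grad_zero_imp_zero:
  assumes r: "r \<in> poly_space m T UNIV"
    and sym: "(LINT x|vol. sym_grad r x \<bullet> sym_grad r x) = 0"
    and mean: "(LINT x|vol. r x) = 0" and skew: "(LINT x|vol. skew_grad r x) = 0"
  shows "r = (\<lambda>x. 0)"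
proof -
  obtain P D where P: "P \<in> polynomials m UNIV" "\<forall>j. D j \<in> polynomials m UNIV" "r = restr (closure T) P"
    "\<forall>x. (P has_derivative (\<lambda>h. \<Sum>j\<in>UNIV. h $ j *\<^sub>R D j x)) (at x)" "\<forall>x\<in>T. r x = P x"
    "\<forall>x\<in>T. (r has_derivative (\<lambda>h. \<Sum>j\<in>UNIV. h $ j *\<^sub>R D j x)) (at x)"
    by (rule poly_space_derivative[OF open_T subspace_UNIV r])
  obtain s where s: "s \<in> poly_space m T sym_matrices" "\<forall>x\<in>T. s x = sym_grad r x"
    by (rule sym_grad_poly_space[OF open_T r])
  have "(LINT x|vol. s x \<bullet> s x) = (LINT x|vol. sym_grad r x \<bullet> sym_grad r x)"
    using s(2) by (intro Bochner_Integration.integral_cong) auto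
  then have "s = (\<lambda>x. 0)"
    using E.poly_inner_self_eq_0[OF s(1)] sym by simp
  then have zero: "sym_grad r x = 0" if "x \<in> T" for x
    using s(2) that by simp
  \<comment> \<open>\<open>T\<close> need not be convex, so the absence of strain is first extended
    from \<open>T\<close> to the whole space, where the segment between any two points is
    available.\<close>
  have anti: "D j x $ i + D i x $ j = 0" for i j x
  proof (rule real_polynomial_function_eq_0[of "\<lambda>x. D j x $ i + D i x $ j", OF _ open_T element(3)[OF T]])
    have "real_polynomial_function (\<lambda>x. D j x \<bullet> axis i 1 + D i x \<bullet> axis j 1)"
      using P(2) polynomials_inner_real_polynomial_function by (intro real_polynomial_function.intros(3)) blast+
    then show "real_polynomial_function (\<lambda>x. D j x $ i + D i x $ j)"
      by (simp add: inner_axis)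
    have "D j x $ i + D i x $ j = 0" if "x \<in> T" for x
      using zero[OF that] by (simp add: sym_grad_has_derivative[OF P(6)[rule_format, OF that]] vec_eq_iff)
    then show "AE x in lborel. x \<in> T \<longrightarrow> D j x $ i + D i x $ j = 0"
      by simp
  qed
  \<comment> \<open>Exchanging the two summation indices changes the sign of the quadratic form
    \<open>?A\<close>.\<close>
  have skew_D: "(\<Sum>j\<in>UNIV. h $ j *\<^sub>R D j x) \<bullet> h = 0" for x h
  proof -
    let ?A = "\<Sum>i\<in>UNIV. \<Sum>j\<in>UNIV. h $ j * D j x $ i * h $ i"
    have neg: "h $ j * D j x $ i * h $ i = - (h $ i * D i x $ j * h $ j)" for i j
    proof -
      have "D j x $ i = - D i x $ j"
        using anti[of j x i] by simp
      then show ?thesis by simp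
    qed
    have "?A = (\<Sum>i\<in>UNIV. \<Sum>j\<in>UNIV. - (h $ i * D i x $ j * h $ j))"
      by (intro sum.cong refl neg)
    also have "\<dots> = (\<Sum>j\<in>UNIV. \<Sum>i\<in>UNIV. - (h $ i * D i x $ j * h $ j))"
      by (rule sum.swap)
    also have "\<dots> = - ?A"
      by (simp only: sum_negf)
    finally have "?A = 0"
      by linarith
    moreover have "(\<Sum>j\<in>UNIV. h $ j *\<^sub>R D j x) \<bullet> h = ?A"
      by (simp add: inner_vec_def sum_distrib_right)
    ultimately show ?thesis
      by (simp only:)
  qed
  obtain c W where W': "linear W" "\<forall>x. P x = c + W x" "\<forall>x y. W x \<bullet> y = - (x \<bullet> W y)"
    by (rule skew_rigid[OF P(4)[rule_format] skew_D])
  note W = W'(1) W'(2)[rule_format] W'(3)[rule_format]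
  have blW: "bounded_linear W"
    using W(1) by (simp add: linear_conv_bounded_linear)
  have D: "D j x = W (axis j 1)" for j x
  proof -
    have "((\<lambda>x. c + W x) has_derivative (\<lambda>h. 0 + W h)) (at x)"
      by (intro has_derivative_add has_derivative_const bounded_linear_imp_has_derivative[OF blW])
    moreover have "P = (\<lambda>x. c + W x)"
      using W(2) by (rule ext)
    ultimately have "(P has_derivative W) (at x)"
      by simp
    then have eq: "W = (\<lambda>h. \<Sum>j\<in>UNIV. h $ j *\<^sub>R D j x)"
      by (rule has_derivative_unique) (rule P(4)[rule_format])
    have "W (axis j 1) = (\<Sum>j'\<in>UNIV. axis j 1 $ j' *\<^sub>R D j' x)"
      by (subst eq) (rule refl)
    then show ?thesis
      by (simp add: axis_def if_distrib[of "\<lambda>c. c *\<^sub>R _"] cong: if_cong)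
  qed
  interpret finite_measure vol by (rule E.finite_M)
  have "skew_grad r x = (\<chi> i j. W (axis i 1) $ j)" if "x \<in> T" for x
  proof -
    have "(\<chi> i j. (W (axis i 1) $ j - W (axis j 1) $ i) / 2) $ i $ j = (\<chi> i j. W (axis i 1) $ j) $ i $ j" for i j
      using W(3)[of "axis j 1" "axis i 1"] by (simp add: inner_axis inner_axis')
    then show ?thesis
      unfolding skew_grad_has_derivative[OF P(6)[rule_format, OF that]] D by (simp only: vec_eq_iff) blast
  qed
  then have "(LINT x|vol. skew_grad r x) = (LINT x|vol. (\<chi> i j. W (axis i 1) $ j))"
    by (intro Bochner_Integration.integral_cong) auto
  also have "\<dots> = measure vol T *\<^sub>R (\<chi> i j. W (axis i 1) $ j)"
    by simp
  finally have W_axis: "W (axis i 1) = 0" for i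
    using skew vol_nonzero by (simp add: vec_eq_iff)
  have W0: "W x = 0" for x
  proof -
    have "W x \<bullet> axis i 1 = 0" for i
      using W(3)[of x "axis i 1"] W_axis by simp
    then show ?thesis
      by (simp add: vec_eq_iff inner_axis)
  qed
  have Pc: "P x = c" for x
    unfolding W(2)[of x] W0 by simp
  have "(LINT x|vol. r x) = (LINT x|vol. c)"
    using P(5) Pc by (intro Bochner_Integration.integral_cong) auto
  also have "\<dots> = measure vol T *\<^sub>R c"
    by simp
  finally have "c = 0"
    using mean vol_nonzero by simp
  then show ?thesis
    using P(3) Pc by (auto simp: restr_def)
qed

text \<open>Nothing is asked of \<open>snd v\<close> off \<open>faces\<close>: restricted tuples and
  total functions both qualify, and \<open>reconstruction_cong\<close> shows that the difference is
  invisible.\<close>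

definition local_space :: "'d local_unknown set" where
  "local_space = {v. fst v \<in> poly_space k T UNIV \<and> (\<forall>F\<in>faces. snd v F \<in> poly_space k F UNIV)}"

definition lincomb :: "real \<Rightarrow> 'd local_unknown \<Rightarrow> 'd local_unknown \<Rightarrow> 'd local_unknown" where
  "lincomb a u v = ((\<lambda>x. a *\<^sub>R fst u x + fst v x), (\<lambda>F x. a *\<^sub>R snd u F x + snd v F x))"

text \<open>A polynomial of degree at most \<open>k\<close> and its traces are their own
  projections, so for such \<open>p\<close> this is the usual interpolant.\<close>

definition interpolant :: "'d vec_field \<Rightarrow> 'd local_unknown" where
  "interpolant p = (p, \<lambda>F. restr F p)"

lemma local_spaceD:
  assumes "v \<in> local_space"
  shows "fst v \<in> poly_space k T UNIV" "\<And>F. F \<in> faces \<Longrightarrow> snd v F \<in> poly_space k F UNIV"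
  using assms by (auto simp: local_space_def)

lemma lincomb_local_space: "u \<in> local_space \<Longrightarrow> v \<in> local_space \<Longrightarrow> lincomb a u v \<in> local_space"
  by (auto simp: local_space_def lincomb_def intro!: poly_space_add poly_space_scale)

lemma interpolant_local_space: "p \<in> poly_space k T UNIV \<Longrightarrow> interpolant p \<in> local_space"
  by (auto simp: local_space_def interpolant_def intro: trace_poly)

lemma poly_space_lincomb:
  "subspace V \<Longrightarrow> p \<in> poly_space l X V \<Longrightarrow> q \<in> poly_space l X V \<Longrightarrow> (\<lambda>x. a *\<^sub>R p x + q x) \<in> poly_space l X V"
  by (intro poly_space_add poly_space_scale)

lemma integral_lincomb:
  fixes f g :: "'b \<Rightarrow> 'c::euclidean_space"
  assumes "integrable M f" "integrable M g"
  shows "(LINT x|M. a *\<^sub>R f x + g x) = a *\<^sub>R (LINT x|M. f x) + (LINT x|M. g x)"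
  using assms by (subst Bochner_Integration.integral_add) auto

section \<open>Gradient reconstruction and prescribed mean rotation\<close>

definition grad_form :: "'d local_unknown \<Rightarrow> 'd tensor_field \<Rightarrow> real" where
  "grad_form v \<tau> = - (LINT x|vol. fst v x \<bullet> tensor_div \<tau> x) +
     (\<Sum>F\<in>faces. LINT x|srf F. snd v F x \<bullet> (\<tau> x *v \<nu> F))"

lemma trace_normal_rep:
  fixes \<tau> :: "'d tensor_field"
  assumes "F \<in> faces" "\<tau> \<in> poly_space l T V"
  shows "continuous_rep (srf F) (\<lambda>x. \<tau> x *v \<nu> F)"
proof -
  have "bounded_linear (\<lambda>A :: real^'d^'d. A *v \<nu> F)"
    by (auto simp: linear_conv_bounded_linear[symmetric] intro!: linearI
        simp: matrix_vector_mult_add_rdistrib scaleR_matrix_vector_assoc)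
  from continuous_rep_linear[OF this trace_rep[OF assms]] show ?thesis .
qed

lemma grad_form_integrable:
  assumes "v \<in> local_space" "\<tau> \<in> poly_space l T V"
  shows "integrable vol (\<lambda>x. fst v x \<bullet> tensor_div \<tau> x)"
    and "F \<in> faces \<Longrightarrow> integrable (srf F) (\<lambda>x. snd v F x \<bullet> (\<tau> x *v \<nu> F))"
proof -
  show "integrable vol (\<lambda>x. fst v x \<bullet> tensor_div \<tau> x)"
    by (intro E.integrable_rep continuous_rep_inner E.poly_rep[OF local_spaceD(1)[OF assms(1)]]
        poly_div_rep[OF open_T assms(2)])
  show "integrable (srf F) (\<lambda>x. snd v F x \<bullet> (\<tau> x *v \<nu> F))" if "F \<in> faces"
    using that by (intro face_int continuous_rep_inner face_rep[OF that local_spaceD(2)[OF assms(1)]]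
        trace_normal_rep[OF that assms(2)])
qed

lemma grad_form_lincomb_right:
  assumes v: "v \<in> local_space" and \<tau>: "\<tau> \<in> poly_space l T V" "\<eta> \<in> poly_space l T V" and V: "subspace V"
  shows "grad_form v (\<lambda>x. a *\<^sub>R \<tau> x + \<eta> x) = a * grad_form v \<tau> + grad_form v \<eta>"
proof -
  note int = grad_form_integrable[OF v \<tau>(1)] grad_form_integrable[OF v \<tau>(2)]
  have "(LINT x|vol. fst v x \<bullet> tensor_div (\<lambda>x. a *\<^sub>R \<tau> x + \<eta> x) x) =
      (LINT x|vol. a *\<^sub>R (fst v x \<bullet> tensor_div \<tau> x) + fst v x \<bullet> tensor_div \<eta> x)"
    by (rule Bochner_Integration.integral_cong)
      (simp_all add: poly_div_linear[OF open_T \<tau>] inner_add_right)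
  also have "\<dots> = a * (LINT x|vol. fst v x \<bullet> tensor_div \<tau> x) + (LINT x|vol. fst v x \<bullet> tensor_div \<eta> x)"
    using integral_lincomb[OF int(1,3), of a] by simp
  finally have 1: "(LINT x|vol. fst v x \<bullet> tensor_div (\<lambda>x. a *\<^sub>R \<tau> x + \<eta> x) x) =
    a * (LINT x|vol. fst v x \<bullet> tensor_div \<tau> x) + (LINT x|vol. fst v x \<bullet> tensor_div \<eta> x)" .
  have 2: "(LINT x|srf F. snd v F x \<bullet> ((a *\<^sub>R \<tau> x + \<eta> x) *v \<nu> F)) =
    a * (LINT x|srf F. snd v F x \<bullet> (\<tau> x *v \<nu> F)) + (LINT x|srf F. snd v F x \<bullet> (\<eta> x *v \<nu> F))"
    if "F \<in> faces" for F
  proof -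
    have "(LINT x|srf F. snd v F x \<bullet> ((a *\<^sub>R \<tau> x + \<eta> x) *v \<nu> F)) =
        (LINT x|srf F. a *\<^sub>R (snd v F x \<bullet> (\<tau> x *v \<nu> F)) + snd v F x \<bullet> (\<eta> x *v \<nu> F))"
      by (rule Bochner_Integration.integral_cong)
        (simp_all add: matrix_vector_mult_add_rdistrib inner_add_right scaleR_matrix_vector_assoc[symmetric])
    then show ?thesis
      using integral_lincomb[OF int(2,4)[OF that], of a] by simp
  qed
  have "(\<Sum>F\<in>faces. LINT x|srf F. snd v F x \<bullet> ((a *\<^sub>R \<tau> x + \<eta> x) *v \<nu> F)) =
    a * (\<Sum>F\<in>faces. LINT x|srf F. snd v F x \<bullet> (\<tau> x *v \<nu> F)) + (\<Sum>F\<in>faces. LINT x|srf F. snd v F x \<bullet> (\<eta> x *v \<nu> F))"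
    unfolding sum_distrib_left sum.distrib[symmetric] by (intro sum.cong refl 2)
  then show ?thesis
    unfolding grad_form_def 1 by (simp add: right_diff_distrib distrib_left)
qed

lemma grad_form_lincomb_left:
  assumes u: "u \<in> local_space" and v: "v \<in> local_space" and \<tau>: "\<tau> \<in> poly_space l T V"
  shows "grad_form (lincomb a u v) \<tau> = a * grad_form u \<tau> + grad_form v \<tau>"
proof -
  note int = grad_form_integrable[OF u \<tau>] grad_form_integrable[OF v \<tau>]
  have 1: "(LINT x|vol. fst (lincomb a u v) x \<bullet> tensor_div \<tau> x) =
      a * (LINT x|vol. fst u x \<bullet> tensor_div \<tau> x) + (LINT x|vol. fst v x \<bullet> tensor_div \<tau> x)"
    using integral_lincomb[OF int(1,3), of a] by (simp add: lincomb_def inner_add_left)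
  have 2: "(LINT x|srf F. snd (lincomb a u v) F x \<bullet> (\<tau> x *v \<nu> F)) =
    a * (LINT x|srf F. snd u F x \<bullet> (\<tau> x *v \<nu> F)) + (LINT x|srf F. snd v F x \<bullet> (\<tau> x *v \<nu> F))"
    if "F \<in> faces" for F
    using integral_lincomb[OF int(2,4)[OF that], of a] by (simp add: lincomb_def inner_add_left)
  show ?thesis
    unfolding grad_form_def 1 by (simp add: 2 sum.distrib sum_distrib_left algebra_simps)
qed

lemma grad_rec_characterization:
  assumes v: "v \<in> local_space"
  shows "G = grad_rec k \<F> T v \<longleftrightarrow> G \<in> poly_space k T sym_matrices \<and>
    (\<forall>\<tau>\<in>poly_space k T sym_matrices. (LINT x|vol. G x \<bullet> \<tau> x) = grad_form v \<tau>)"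
proof -
  let ?P = "\<lambda>G. G \<in> poly_space k T sym_matrices \<and>
    (\<forall>\<tau>\<in>poly_space k T sym_matrices. (LINT x|vol. G x \<bullet> \<tau> x) = grad_form v \<tau>)"
  have ex1: "\<exists>!G. ?P G"
  proof (rule E.riesz_poly[OF subspace_sym_matrices])
    fix p q :: "'d tensor_field" and a :: real
    assume p: "p \<in> poly_space k T sym_matrices"
    have z: "(\<lambda>x. 0) \<in> poly_space k T (sym_matrices :: (real^'d^'d) set)"
      by (intro poly_space_0 subspace_sym_matrices)
    have "grad_form v (\<lambda>x. 0) = 0"
      using grad_form_lincomb_right[OF v z z subspace_sym_matrices, of 1] by simp
    then show "grad_form v (\<lambda>x. a *\<^sub>R p x) = a * grad_form v p"
      using grad_form_lincomb_right[OF v p z subspace_sym_matrices, of a] by simp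
    assume q: "q \<in> poly_space k T sym_matrices"
    show "grad_form v (\<lambda>x. p x + q x) = grad_form v p + grad_form v q"
      using grad_form_lincomb_right[OF v p q subspace_sym_matrices, of 1] by simp
  qed
  have the: "grad_rec k \<F> T v = (THE G. ?P G)"
    unfolding grad_rec_def grad_form_def ..
  show ?thesis
    unfolding the using theI'[OF ex1] the1_equality[OF ex1, of G] by blast
qed

lemmas grad_rec_spec = grad_rec_characterization[THEN iffD1, OF _ refl]

lemma grad_rec_lincomb:
  assumes u: "u \<in> local_space" and v: "v \<in> local_space"
  shows "grad_rec k \<F> T (lincomb a u v) = (\<lambda>x. a *\<^sub>R grad_rec k \<F> T u x + grad_rec k \<F> T v x)"
proof (rule sym, rule grad_rec_characterization[OF lincomb_local_space[OF u v], THEN iffD2], intro conjI ballI)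
  note U = grad_rec_spec[OF u] and V = grad_rec_spec[OF v]
  show "(\<lambda>x. a *\<^sub>R grad_rec k \<F> T u x + grad_rec k \<F> T v x) \<in> poly_space k T sym_matrices"
    using U V by (intro poly_space_lincomb subspace_sym_matrices) auto
  fix \<tau> :: "'d tensor_field" assume \<tau>: "\<tau> \<in> poly_space k T sym_matrices"
  have "integrable vol (\<lambda>x. grad_rec k \<F> T w x \<bullet> \<tau> x)" if "w \<in> local_space" for w
    using grad_rec_spec[OF that] \<tau> by (intro E.integrable_rep continuous_rep_inner E.poly_rep) auto
  then have "(LINT x|vol. a *\<^sub>R (grad_rec k \<F> T u x \<bullet> \<tau> x) + grad_rec k \<F> T v x \<bullet> \<tau> x) =
      a * grad_form u \<tau> + grad_form v \<tau>"
    using U V u v \<tau> by (subst integral_lincomb) auto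
  then show "(LINT x|vol. (a *\<^sub>R grad_rec k \<F> T u x + grad_rec k \<F> T v x) \<bullet> \<tau> x) = grad_form (lincomb a u v) \<tau>"
    using grad_form_lincomb_left[OF u v \<tau>] by (simp add: inner_add_left)
qed

text \<open>With traces as face unknowns, the right-hand side that defines \<open>grad_rec\<close>
  is Green's formula read backwards.\<close>

lemma grad_form_interpolant:
  assumes p: "p \<in> poly_space k T UNIV" and \<tau>: "\<tau> \<in> poly_space l T sym_matrices"
  shows "grad_form (interpolant p) \<tau> = (LINT x|vol. \<tau> x \<bullet> sym_grad p x)"
proof -
  have "(LINT x|srf F. restr F p x \<bullet> (\<tau> x *v \<nu> F)) = (LINT x|srf F. p x \<bullet> (\<tau> x *v \<nu> F))" for F
    by (rule Bochner_Integration.integral_cong) (auto simp: restr_def)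
  then show ?thesis
    unfolding green[OF \<tau> p] grad_form_def interpolant_def by simp
qed

lemma grad_rec_interpolant:
  assumes p: "p \<in> poly_space k T UNIV" and x: "x \<in> T"
  shows "grad_rec k \<F> T (interpolant p) x = sym_grad p x"
proof -
  obtain s where s: "s \<in> poly_space k T sym_matrices" "\<forall>x\<in>T. s x = sym_grad p x"
    by (rule sym_grad_poly_space[OF open_T p])
  have "(LINT x|vol. s x \<bullet> \<tau> x) = grad_form (interpolant p) \<tau>" if "\<tau> \<in> poly_space k T sym_matrices" for \<tau>
    unfolding grad_form_interpolant[OF p that]
    by (rule Bochner_Integration.integral_cong) (simp_all add: s(2) inner_commute)
  then have "s = grad_rec k \<F> T (interpolant p)"
    using s(1) grad_rec_characterization[OF interpolant_local_space[OF p]] by blast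
  then show ?thesis
    using s(2) x by auto
qed

definition mean_skew :: "'d local_unknown \<Rightarrow> real^'d^'d" where
  "mean_skew v = (\<Sum>F\<in>faces. LINT x|srf F. (1/2) *\<^sub>R (outer (\<nu> F) (snd v F x) - outer (snd v F x) (\<nu> F)))"

lemma outer_rep:
  fixes p :: "'d vec_field"
  assumes "continuous_rep M p"
  shows "continuous_rep M (\<lambda>x. (1/2) *\<^sub>R (outer n (p x) - outer (p x) n))"
proof (rule continuous_rep_linear[OF _ assms])
  show "bounded_linear (\<lambda>v. (1/2) *\<^sub>R (outer n v - outer v n))"
    by (auto simp: linear_conv_bounded_linear[symmetric] outer_def vec_eq_iff algebra_simps intro!: linearI)
qed

text \<open>Existence of \<open>disp_rec\<close> needs this: the mean of a skew gradient is skew, so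
  only a skew matrix can be prescribed.\<close>

lemma mean_skew_skew: assumes v: "v \<in> local_space" shows "transpose (mean_skew v) = - mean_skew v"
proof -
  have bl: "bounded_linear (transpose :: real^'d^'d \<Rightarrow> real^'d^'d)"
    by (auto simp: linear_conv_bounded_linear[symmetric] transpose_def vec_eq_iff intro!: linearI)
  then have lin: "linear (transpose :: real^'d^'d \<Rightarrow> real^'d^'d)"
    by (rule bounded_linear.linear)
  have "transpose (LINT x|srf F. (1/2) *\<^sub>R (outer (\<nu> F) (snd v F x) - outer (snd v F x) (\<nu> F))) =
      - (LINT x|srf F. (1/2) *\<^sub>R (outer (\<nu> F) (snd v F x) - outer (snd v F x) (\<nu> F)))" if F: "F \<in> faces" for F
  proof -
    have "transpose (LINT x|srf F. (1/2) *\<^sub>R (outer (\<nu> F) (snd v F x) - outer (snd v F x) (\<nu> F))) =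
        (LINT x|srf F. transpose ((1/2) *\<^sub>R (outer (\<nu> F) (snd v F x) - outer (snd v F x) (\<nu> F))))"
      using F by (intro integral_bounded_linear[OF bl, symmetric] face_int outer_rep face_rep[OF F local_spaceD(2)[OF v F]])
    also have "\<dots> = (LINT x|srf F. - ((1/2) *\<^sub>R (outer (\<nu> F) (snd v F x) - outer (snd v F x) (\<nu> F))))"
      by (rule Bochner_Integration.integral_cong) (auto simp: transpose_def outer_def vec_eq_iff algebra_simps)
    finally show ?thesis by simp
  qed
  then show ?thesis
    unfolding mean_skew_def linear_sum[OF lin] by (simp add: sum_negf)
qed

lemma mean_skew_lincomb:
  assumes u: "u \<in> local_space" and v: "v \<in> local_space"
  shows "mean_skew (lincomb a u v) = a *\<^sub>R mean_skew u + mean_skew v"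
proof -
  have "(LINT x|srf F. (1/2) *\<^sub>R (outer (\<nu> F) (snd (lincomb a u v) F x) - outer (snd (lincomb a u v) F x) (\<nu> F))) =
      a *\<^sub>R (LINT x|srf F. (1/2) *\<^sub>R (outer (\<nu> F) (snd u F x) - outer (snd u F x) (\<nu> F))) +
      (LINT x|srf F. (1/2) *\<^sub>R (outer (\<nu> F) (snd v F x) - outer (snd v F x) (\<nu> F)))" if F: "F \<in> faces" for F
  proof -
    have int: "integrable (srf F) (\<lambda>x. (1/2) *\<^sub>R (outer (\<nu> F) (snd w F x) - outer (snd w F x) (\<nu> F)))"
      if "w \<in> local_space" for w
      using F by (intro face_int outer_rep face_rep[OF F local_spaceD(2)[OF that F]])
    have "(1/2) *\<^sub>R (outer (\<nu> F) (snd (lincomb a u v) F x) - outer (snd (lincomb a u v) F x) (\<nu> F)) =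
      a *\<^sub>R ((1/2) *\<^sub>R (outer (\<nu> F) (snd u F x) - outer (snd u F x) (\<nu> F))) +
      (1/2) *\<^sub>R (outer (\<nu> F) (snd v F x) - outer (snd v F x) (\<nu> F))" for x
      by (simp add: lincomb_def outer_def vec_eq_iff algebra_simps)
    then show ?thesis
      using integral_lincomb[OF int[OF u] int[OF v], of a] by simp
  qed
  then show ?thesis
    by (simp add: mean_skew_def sum.distrib scaleR_sum_right)
qed

end

context cell
begin

lemmas L2_proj_spec = L2_proj_characterization[THEN iffD1, OF _ refl]

lemma L2_proj_lincomb:
  fixes g h :: "real^'d \<Rightarrow> 'v::euclidean_space"
  assumes g: "continuous_rep M g" and h: "continuous_rep M h"
  shows "L2_proj M l X (\<lambda>x. a *\<^sub>R g x + h x) = (\<lambda>x. a *\<^sub>R L2_proj M l X g x + L2_proj M l X h x)"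
proof -
  have int: "integrable M (\<lambda>x. f x \<bullet> q x)" if "continuous_rep M f" "q \<in> poly_space l X UNIV"
    for f q :: "real^'d \<Rightarrow> 'v"
    by (rule integrable_rep[OF continuous_rep_inner[OF that(1) poly_rep[OF that(2)]]])
  note G = L2_proj_spec[OF int[OF g]] and H = L2_proj_spec[OF int[OF h]]
  have gh: "continuous_rep M (\<lambda>x. a *\<^sub>R g x + h x)"
    using g h by (intro continuous_rep_add continuous_rep_scale)
  show ?thesis
  proof (rule sym, rule L2_proj_characterization[OF int[OF gh], THEN iffD2], assumption, intro conjI ballI)
    show "(\<lambda>x. a *\<^sub>R L2_proj M l X g x + L2_proj M l X h x) \<in> poly_space l X UNIV"
      using G H by (intro poly_space_add poly_space_scale subspace_UNIV) auto
    fix q :: "real^'d \<Rightarrow> 'v" assume q: "q \<in> poly_space l X UNIV"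
    have reps: "continuous_rep M (L2_proj M l X g)" "continuous_rep M (L2_proj M l X h)"
      using G H by (auto intro: poly_rep)
    have "(LINT x|M. (a *\<^sub>R L2_proj M l X g x + L2_proj M l X h x) \<bullet> q x) =
        a * (LINT x|M. L2_proj M l X g x \<bullet> q x) + (LINT x|M. L2_proj M l X h x \<bullet> q x)"
      using int[OF reps(1) q] int[OF reps(2) q] by (simp add: inner_add_left)
    also have "\<dots> = a * (LINT x|M. g x \<bullet> q x) + (LINT x|M. h x \<bullet> q x)"
      using G H q by simp
    also have "\<dots> = (LINT x|M. (a *\<^sub>R g x + h x) \<bullet> q x)"
      using int[OF g q] int[OF h q] by (simp add: inner_add_left)
    finally show "(LINT x|M. (a *\<^sub>R L2_proj M l X g x + L2_proj M l X h x) \<bullet> q x) = (LINT x|M. (a *\<^sub>R g x + h x) \<bullet> q x)" .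
  qed
qed

lemma L2_proj_zero:
  fixes g :: "real^'d \<Rightarrow> 'v::euclidean_space"
  assumes "\<And>x. x \<in> space M \<Longrightarrow> g x = 0"
  shows "L2_proj M l X g = (\<lambda>x. 0)"
proof -
  have 0: "(LINT x|M. g x \<bullet> q x) = 0" and int: "integrable M (\<lambda>x. g x \<bullet> q x)" for q
    using assms by (subst Bochner_Integration.integral_cong[of M M _ "\<lambda>x. 0"]
        Bochner_Integration.integrable_cong[of M M _ "\<lambda>x. 0"]; simp)+
  show ?thesis
    by (rule sym, rule L2_proj_characterization[OF int, THEN iffD2])
      (simp add: 0 poly_space_0[OF subspace_UNIV])
qed

end

context hho_element
begin

text \<open>The strain form is degenerate on rigid motions. The products of the two means, one for
  each closure condition of \<open>disp_rec\<close>, make it an inner product on the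
  polynomials.\<close>

definition energy_form :: "'d vec_field \<Rightarrow> 'd vec_field \<Rightarrow> real" where
  "energy_form r w = (LINT x|vol. sym_grad r x \<bullet> sym_grad w x) + (LINT x|vol. r x) \<bullet> (LINT x|vol. w x) +
     (LINT x|vol. skew_grad r x) \<bullet> (LINT x|vol. skew_grad w x)"

lemma integral_grad_lincomb:
  assumes p: "p \<in> poly_space m T UNIV" and q: "q \<in> poly_space m T UNIV" and g: "continuous_rep vol g"
  shows "(LINT x|vol. sym_grad (\<lambda>x. a *\<^sub>R p x + q x) x \<bullet> g x) =
      a * (LINT x|vol. sym_grad p x \<bullet> g x) + (LINT x|vol. sym_grad q x \<bullet> g x)"
    and "(LINT x|vol. skew_grad (\<lambda>x. a *\<^sub>R p x + q x) x) = a *\<^sub>R (LINT x|vol. skew_grad p x) + (LINT x|vol. skew_grad q x)"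
    and "(LINT x|vol. a *\<^sub>R p x + q x) = a *\<^sub>R (LINT x|vol. p x) + (LINT x|vol. q x)"
proof -
  note rp = poly_grad_rep[OF open_T p] and rq = poly_grad_rep[OF open_T q]
  have "(LINT x|vol. sym_grad (\<lambda>x. a *\<^sub>R p x + q x) x \<bullet> g x) =
      (LINT x|vol. a *\<^sub>R (sym_grad p x \<bullet> g x) + sym_grad q x \<bullet> g x)"
    by (rule Bochner_Integration.integral_cong)
      (simp_all add: poly_grad_linear(1)[OF open_T p q] inner_add_left)
  then show "(LINT x|vol. sym_grad (\<lambda>x. a *\<^sub>R p x + q x) x \<bullet> g x) =
      a * (LINT x|vol. sym_grad p x \<bullet> g x) + (LINT x|vol. sym_grad q x \<bullet> g x)"
    using integral_lincomb[OF E.integrable_rep[OF continuous_rep_inner[OF rp(1) g]]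
        E.integrable_rep[OF continuous_rep_inner[OF rq(1) g]], of a] by simp
  have "(LINT x|vol. skew_grad (\<lambda>x. a *\<^sub>R p x + q x) x) = (LINT x|vol. a *\<^sub>R skew_grad p x + skew_grad q x)"
    by (rule Bochner_Integration.integral_cong) (simp_all add: poly_grad_linear(2)[OF open_T p q])
  then show "(LINT x|vol. skew_grad (\<lambda>x. a *\<^sub>R p x + q x) x) = a *\<^sub>R (LINT x|vol. skew_grad p x) + (LINT x|vol. skew_grad q x)"
    using integral_lincomb[OF E.integrable_rep[OF rp(2)] E.integrable_rep[OF rq(2)], of a] by simp
  show "(LINT x|vol. a *\<^sub>R p x + q x) = a *\<^sub>R (LINT x|vol. p x) + (LINT x|vol. q x)"
    by (intro integral_lincomb E.integrable_rep E.poly_rep[OF p] E.poly_rep[OF q])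
qed

lemma energy_form_sym: "energy_form r w = energy_form w r"
  by (simp add: energy_form_def inner_commute)

lemma energy_form_lincomb:
  assumes "p \<in> poly_space m T UNIV" "q \<in> poly_space m T UNIV" "w \<in> poly_space m T UNIV"
  shows "energy_form (\<lambda>x. a *\<^sub>R p x + q x) w = a * energy_form p w + energy_form q w"
  using integral_grad_lincomb[OF assms(1,2) poly_grad_rep(1)[OF open_T assms(3)], of a]
  by (simp add: energy_form_def inner_add_left algebra_simps)

lemma energy_form_definite:
  assumes p: "p \<in> poly_space m T UNIV" and 0: "energy_form p p = 0"
  shows "p = (\<lambda>x. 0)"
proof -
  have "(LINT x|vol. sym_grad p x \<bullet> sym_grad p x) \<ge> 0"
    by (rule Bochner_Integration.integral_nonneg) simp
  moreover have "(LINT x|vol. p x) \<bullet> (LINT x|vol. p x) \<ge> 0" "(LINT x|vol. skew_grad p x) \<bullet> (LINT x|vol. skew_grad p x) \<ge> 0"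
    by simp_all
  ultimately have "(LINT x|vol. sym_grad p x \<bullet> sym_grad p x) = 0"
    "(LINT x|vol. p x) \<bullet> (LINT x|vol. p x) = 0" "(LINT x|vol. skew_grad p x) \<bullet> (LINT x|vol. skew_grad p x) = 0"
    using 0 unfolding energy_form_def by linarith+
  then show ?thesis
    by (intro grad_zero_imp_zero[OF p]) simp_all
qed

lemma energy_riesz:
  assumes L: "\<And>a p q. p \<in> poly_space m T UNIV \<Longrightarrow> q \<in> poly_space m T UNIV \<Longrightarrow>
      L (\<lambda>x. a *\<^sub>R p x + q x) = a * L p + (L q :: real)"
  obtains r where "r \<in> poly_space m T UNIV" "\<forall>w\<in>poly_space m T UNIV. energy_form r w = L w"
proof -
  let ?W = "poly_space m T (UNIV :: (real^'d) set)"
  obtain b :: "('d \<Rightarrow> nat) \<times> (real^'d) \<Rightarrow> 'd vec_field" and I where b: "finite I" "?W = fspan b I"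
    using poly_space_fspan[OF subspace_UNIV] .
  have z: "(\<lambda>x. 0) \<in> ?W"
    by (intro poly_space_0 subspace_UNIV)
  have lin: "M (\<lambda>x. p x + q x) = M p + M q" "M (\<lambda>x. a *\<^sub>R p x) = a * M p"
    if M: "\<And>a p q. p \<in> ?W \<Longrightarrow> q \<in> ?W \<Longrightarrow> M (\<lambda>x. a *\<^sub>R p x + q x) = a * M p + (M q :: real)" and p: "p \<in> ?W" and q: "q \<in> ?W"
    for M p q a
  proof -
    show "M (\<lambda>x. p x + q x) = M p + M q"
      using M[OF p q, of 1] by simp
    have "M (\<lambda>x. 0) = 0"
      using M[OF z z, of 1] by simp
    then show "M (\<lambda>x. a *\<^sub>R p x) = a * M p"
      using M[OF p z, of a] by simp
  qed
  have "\<exists>!r. r \<in> ?W \<and> (\<forall>w\<in>?W. energy_form r w = L w)"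
  proof (rule riesz[OF b])
    fix p q r :: "'d vec_field" and a :: real assume p: "p \<in> ?W" and r: "r \<in> ?W"
    show "energy_form (\<lambda>x. a *\<^sub>R p x) r = a * energy_form p r"
      by (rule lin(2)[of "\<lambda>p. energy_form p r", OF energy_form_lincomb p p]) (use r in auto)
    show "L (\<lambda>x. a *\<^sub>R p x) = a * L p"
      by (rule lin(2)[of L, OF L p p])
    assume q: "q \<in> ?W"
    show "energy_form (\<lambda>x. p x + q x) r = energy_form p r + energy_form q r"
      by (rule lin(1)[of "\<lambda>p. energy_form p r", OF energy_form_lincomb p q]) (use r in auto)
    show "L (\<lambda>x. p x + q x) = L p + L q"
      by (rule lin(1)[of L, OF L p q])
  qed (use energy_form_sym energy_form_definite in auto)
  then show thesis
    using that by blast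
qed

text \<open>The sign in \<open>- K\<close> comes from the convention of \<open>skew_grad\<close>,
  which is minus the skew part of the Jacobian, here \<open>K\<close>.\<close>

lemma rigid_motion:
  assumes K: "transpose K = - K" and m: "m \<ge> 1"
  obtains w where "w \<in> poly_space m T UNIV" "\<forall>x\<in>T. w x = b + K *v x"
    "\<forall>x\<in>T. sym_grad w x = 0" "\<forall>x\<in>T. skew_grad w x = - K"
proof -
  let ?P = "\<lambda>x. b + K *v x"
  have lin: "linear ((*v) K)"
    by (rule matrix_vector_mul_linear)
  have "?P \<in> polynomials m UNIV"
    by (intro polynomials_add subspace_UNIV polynomials_const polynomials_linear[OF lin m]) auto
  then have w: "restr (closure T) ?P \<in> poly_space m T UNIV"
    by (rule poly_spaceI)
  have eq: "restr (closure T) ?P x = ?P x" if "x \<in> T" for x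
    using that closure_subset by (auto simp: restr_def)
  have der: "(restr (closure T) ?P has_derivative (\<lambda>h. \<Sum>j\<in>UNIV. h $ j *\<^sub>R (K *v axis j 1))) (at x)"
    if x: "x \<in> T" for x
  proof -
    have "(?P has_derivative (\<lambda>h. 0 + K *v h)) (at x)"
      by (intro has_derivative_add has_derivative_const bounded_linear_imp_has_derivative matrix_vector_mul_bounded_linear)
    moreover have "(\<lambda>h. 0 + K *v h) = (\<lambda>h. \<Sum>j\<in>UNIV. h $ j *\<^sub>R (K *v axis j 1))"
    proof
      fix h
      have "K *v h = K *v (\<Sum>j\<in>UNIV. h $ j *\<^sub>R axis j 1)"
        using basis_expansion[of h] by (simp add: scalar_mult_eq_scaleR)
      then show "0 + K *v h = (\<Sum>j\<in>UNIV. h $ j *\<^sub>R (K *v axis j 1))"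
        by (simp add: linear_sum[OF lin] linear_cmul[OF lin])
    qed
    ultimately have "(?P has_derivative (\<lambda>h. \<Sum>j\<in>UNIV. h $ j *\<^sub>R (K *v axis j 1))) (at x)"
      by (simp only:)
    then show ?thesis
      by (rule has_derivative_transform_within_open[OF _ open_T x]) (simp add: eq)
  qed
  have entry: "(K *v axis j 1) $ i = K $ i $ j" for i j
    by (simp add: matrix_vector_mult_basis column_def)
  have K': "K $ j $ i = - K $ i $ j" for i j
    using arg_cong[OF K, of "\<lambda>A. A $ i $ j"] by (simp add: transpose_def)
  show thesis
  proof (rule that[OF w])
    show "\<forall>x\<in>T. restr (closure T) ?P x = ?P x"
      using eq by blast
    show "\<forall>x\<in>T. sym_grad (restr (closure T) ?P) x = 0"
    proof
      fix x assume x: "x \<in> T"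
      have "(K $ i $ j + K $ j $ i) / 2 = 0" for i j
        using K'[of i j] by simp
      then show "sym_grad (restr (closure T) ?P) x = 0"
        by (simp add: sym_grad_has_derivative[OF der[OF x]] entry vec_eq_iff)
    qed
    show "\<forall>x\<in>T. skew_grad (restr (closure T) ?P) x = - K"
    proof
      fix x assume x: "x \<in> T"
      have "(K $ j $ i - K $ i $ j) / 2 = - K $ i $ j" for i j
        using K'[of i j] by simp
      then show "skew_grad (restr (closure T) ?P) x = - K"
        unfolding skew_grad_has_derivative[OF der[OF x]] entry vec_eq_iff by simp
    qed
  qed
qed

lemma integral_skew_grad_skew:
  assumes r: "r \<in> poly_space m T UNIV"
  shows "transpose (LINT x|vol. skew_grad r x) = - (LINT x|vol. skew_grad r x)"
proof -
  have bl: "bounded_linear (transpose :: real^'d^'d \<Rightarrow> real^'d^'d)"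
    by (auto simp: linear_conv_bounded_linear[symmetric] transpose_def vec_eq_iff intro!: linearI)
  have "transpose (LINT x|vol. skew_grad r x) = (LINT x|vol. transpose (skew_grad r x))"
    by (intro integral_bounded_linear[OF bl, symmetric] E.integrable_rep poly_grad_rep[OF open_T r])
  also have "\<dots> = (LINT x|vol. - skew_grad r x)"
    by (rule Bochner_Integration.integral_cong) (auto simp: transpose_def skew_grad_def vec_eq_iff field_simps)
  finally show ?thesis
    by simp
qed

text \<open>Testing against rigid motions recovers the two closure conditions separately from the
  single equation of the Riesz representation.\<close>

lemma disp_rec_exists:
  assumes G: "G \<in> poly_space k T sym_matrices" and A: "transpose A = - A"
  obtains r where "r \<in> poly_space (k + 1) T UNIV"
    "\<forall>w\<in>poly_space (k + 1) T UNIV. (LINT x|vol. (sym_grad r x - G x) \<bullet> sym_grad w x) = 0"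
    "(LINT x|vol. r x) = a" "(LINT x|vol. skew_grad r x) = A"
proof -
  let ?W = "poly_space (k + 1) T (UNIV :: (real^'d) set)"
  \<comment> \<open>The energy form with the prescribed data \<open>G\<close>, \<open>a\<close> and
    \<open>A\<close> in place of the strain and the two means of \<open>r\<close>.\<close>
  define L where "L w = (LINT x|vol. sym_grad w x \<bullet> G x) + a \<bullet> (LINT x|vol. w x) + A \<bullet> (LINT x|vol. skew_grad w x)" for w
  obtain r where r: "r \<in> ?W" "\<forall>w\<in>?W. energy_form r w = L w"
  proof (rule energy_riesz)
    show "L (\<lambda>x. c *\<^sub>R p x + q x) = c * L p + L q" if "p \<in> ?W" "q \<in> ?W" for c p q
      using integral_grad_lincomb[OF that E.poly_rep[OF G], of c]
      by (simp add: L_def inner_add_right algebra_simps)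
  qed
  let ?c = "(LINT x|vol. r x) - a" and ?K = "(LINT x|vol. skew_grad r x) - A"
  have "transpose ?K = transpose (LINT x|vol. skew_grad r x) - transpose A"
    by (simp add: transpose_def vec_eq_iff)
  then have skewK: "transpose ?K = - ?K"
    unfolding integral_skew_grad_skew[OF r(1)] A by simp
  \<comment> \<open>For a rigid motion the strain terms drop out on both sides, and only the defects
    \<open>?c\<close> and \<open>?K\<close> of the closure conditions remain.\<close>
  have test: "?c \<bullet> (LINT x|vol. b + K *v x) = ?K \<bullet> (measure vol T *\<^sub>R K)" if K: "transpose K = - K" for b K
  proof -
    interpret finite_measure vol by (rule E.finite_M)
    obtain w where w: "w \<in> ?W" "\<forall>x\<in>T. w x = b + K *v x" "\<forall>x\<in>T. sym_grad w x = 0" "\<forall>x\<in>T. skew_grad w x = - K"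
      by (rule rigid_motion[OF K, of "k + 1" b]) simp
    have 1: "(LINT x|vol. sym_grad w x \<bullet> g x) = 0" for g :: "'d tensor_field"
      using w(3) by (subst Bochner_Integration.integral_cong[of vol vol _ "\<lambda>x. 0"]) auto
    have 2: "(LINT x|vol. skew_grad w x) = - (measure vol T *\<^sub>R K)"
      using w(4) by (subst Bochner_Integration.integral_cong[of vol vol _ "\<lambda>x. - K"]) auto
    have 3: "(LINT x|vol. w x) = (LINT x|vol. b + K *v x)"
      using w(2) by (intro Bochner_Integration.integral_cong) auto
    have "energy_form r w = L w"
      using r w(1) by blast
    then show ?thesis
      unfolding energy_form_sym[of r w] unfolding energy_form_def L_def 1 2 3
      by (simp add: inner_diff_left inner_commute[of K] right_diff_distrib inner_commute[of "LINT x|vol. b + K *v x"]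
          inner_commute[of _ "LINT x|vol. r x"])
  qed
  \<comment> \<open>The translation by \<open>?c\<close> itself produces the squared norm of
    \<open>?c\<close>; once \<open>?c = 0\<close> is known, the rotation by \<open>?K\<close> does
    the same for \<open>?K\<close>.\<close>
  have mean: "?c = 0"
  proof -
    interpret finite_measure vol by (rule E.finite_M)
    have "transpose 0 = - (0 :: real^'d^'d)"
      by (simp add: transpose_def vec_eq_iff)
    from test[OF this, of ?c] have "measure vol T * (?c \<bullet> ?c) = 0"
      by simp
    then show ?thesis
      using vol_nonzero by simp
  qed
  have skew: "?K = 0"
    using test[OF skewK, of 0] vol_nonzero unfolding mean by simp
  show thesis
  proof (rule that[OF r(1)])
    show "(LINT x|vol. r x) = a" "(LINT x|vol. skew_grad r x) = A"
      using mean skew by simp_all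
    show "\<forall>w\<in>?W. (LINT x|vol. (sym_grad r x - G x) \<bullet> sym_grad w x) = 0"
    proof
      fix w assume w: "w \<in> ?W"
      have "integrable vol (\<lambda>x. sym_grad r x \<bullet> sym_grad w x)" "integrable vol (\<lambda>x. G x \<bullet> sym_grad w x)"
        by (intro E.integrable_rep continuous_rep_inner E.poly_rep[OF G] poly_grad_rep[OF open_T r(1)] poly_grad_rep[OF open_T w])+
      then have "(LINT x|vol. (sym_grad r x - G x) \<bullet> sym_grad w x) =
          (LINT x|vol. sym_grad r x \<bullet> sym_grad w x) - (LINT x|vol. G x \<bullet> sym_grad w x)"
        by (simp add: inner_diff_left)
      then show "(LINT x|vol. (sym_grad r x - G x) \<bullet> sym_grad w x) = 0"
        using r(2)[rule_format, OF w] mean skew by (simp add: energy_form_def L_def inner_commute)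
    qed
  qed
qed

text \<open>For uniqueness, the difference of two solutions has strain orthogonal to itself and
  vanishing means, so \<open>grad_zero_imp_zero\<close> applies.\<close>

lemma disp_rec_characterization:
  assumes v: "v \<in> local_space"
  shows "r = disp_rec k \<F> T v \<longleftrightarrow> r \<in> poly_space (k + 1) T UNIV \<and>
    (\<forall>w\<in>poly_space (k + 1) T UNIV. (LINT x|vol. (sym_grad r x - grad_rec k \<F> T v x) \<bullet> sym_grad w x) = 0) \<and>
    (LINT x|vol. r x) = (LINT x|vol. fst v x) \<and> (LINT x|vol. skew_grad r x) = mean_skew v"
proof -
  let ?W = "poly_space (k + 1) T (UNIV :: (real^'d) set)"
  let ?P = "\<lambda>r. r \<in> ?W \<and>
    (\<forall>w\<in>?W. (LINT x|vol. (sym_grad r x - grad_rec k \<F> T v x) \<bullet> sym_grad w x) = 0) \<and>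
    (LINT x|vol. r x) = (LINT x|vol. fst v x) \<and> (LINT x|vol. skew_grad r x) = mean_skew v"
  have G: "grad_rec k \<F> T v \<in> poly_space k T sym_matrices"
    using grad_rec_spec[OF v] by blast
  obtain r0 where r0: "?P r0"
    by (rule disp_rec_exists[OF G mean_skew_skew[OF v], of "LINT x|vol. fst v x"]) blast
  have unique: "r = s" if r: "?P r" and s: "?P s" for r s
  proof -
    let ?d = "\<lambda>x. (-1) *\<^sub>R r x + s x"
    have W: "r \<in> ?W" "s \<in> ?W"
      using r s by auto
    have d: "?d \<in> ?W"
      using W by (intro poly_space_lincomb subspace_UNIV)
    have e: "(LINT x|vol. sym_grad p x \<bullet> sym_grad ?d x) = (LINT x|vol. grad_rec k \<F> T v x \<bullet> sym_grad ?d x)"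
      if p: "?P p" for p
    proof -
      have pW: "p \<in> ?W" using p by blast
      have "integrable vol (\<lambda>x. sym_grad p x \<bullet> sym_grad ?d x)" "integrable vol (\<lambda>x. grad_rec k \<F> T v x \<bullet> sym_grad ?d x)"
        by (intro E.integrable_rep continuous_rep_inner E.poly_rep[OF G] poly_grad_rep(1)[OF open_T d]
            poly_grad_rep(1)[OF open_T pW])+
      then have "(LINT x|vol. (sym_grad p x - grad_rec k \<F> T v x) \<bullet> sym_grad ?d x) =
        (LINT x|vol. sym_grad p x \<bullet> sym_grad ?d x) - (LINT x|vol. grad_rec k \<F> T v x \<bullet> sym_grad ?d x)"
        by (simp add: inner_diff_left)
      then show ?thesis
        using p d by auto
    qed
    note lc = integral_grad_lincomb[OF W poly_grad_rep(1)[OF open_T d], of "-1"]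
    have "?d = (\<lambda>x. 0)"
    proof (rule grad_zero_imp_zero[OF d])
      show "(LINT x|vol. sym_grad ?d x \<bullet> sym_grad ?d x) = 0"
        unfolding lc(1) e[OF r] e[OF s] by simp
      show "(LINT x|vol. ?d x) = 0"
        unfolding lc(3) using r s by simp
      show "(LINT x|vol. skew_grad ?d x) = 0"
        unfolding lc(2) using r s by simp
    qed
    then have "s x = r x" for x
      using fun_cong[of ?d "\<lambda>x. 0" x] by simp
    then show ?thesis
      by (intro ext) simp
  qed
  have the: "disp_rec k \<F> T v = (THE r. ?P r)"
    unfolding disp_rec_def mean_skew_def ..
  have ex1: "\<exists>!r. ?P r"
    using r0 unique by blast
  show ?thesis
    unfolding the using theI'[OF ex1] the1_equality[OF ex1, of r] by blast
qed

lemmas disp_rec_spec = disp_rec_characterization[THEN iffD1, OF _ refl]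

end

lemma (in cell) L2_proj_poly:
  fixes g :: "real^'d \<Rightarrow> 'v::euclidean_space"
  assumes g: "continuous_rep M g"
  shows "L2_proj M l X g \<in> poly_space l X UNIV"
proof -
  have "integrable M (\<lambda>x. g x \<bullet> q x)" if "q \<in> poly_space l X UNIV" for q
    by (rule integrable_rep[OF continuous_rep_inner[OF g poly_rep[OF that]]])
  then show ?thesis
    using L2_proj_spec by blast
qed

context hho_element
begin

lemma disp_rec_lincomb:
  assumes u: "u \<in> local_space" and v: "v \<in> local_space"
  shows "disp_rec k \<F> T (lincomb a u v) = (\<lambda>x. a *\<^sub>R disp_rec k \<F> T u x + disp_rec k \<F> T v x)"
proof (rule sym, rule disp_rec_characterization[OF lincomb_local_space[OF u v], THEN iffD2], intro conjI ballI)
  note U = disp_rec_spec[OF u] and V = disp_rec_spec[OF v]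
  let ?W = "poly_space (k + 1) T (UNIV :: (real^'d) set)"
  let ?r = "\<lambda>x. a *\<^sub>R disp_rec k \<F> T u x + disp_rec k \<F> T v x"
  have W: "disp_rec k \<F> T u \<in> ?W" "disp_rec k \<F> T v \<in> ?W"
    using U V by auto
  show "?r \<in> ?W"
    using W by (intro poly_space_lincomb subspace_UNIV)
  show "(LINT x|vol. ?r x) = (LINT x|vol. fst (lincomb a u v) x)"
  proof -
    have "(LINT x|vol. fst (lincomb a u v) x) = a *\<^sub>R (LINT x|vol. fst u x) + (LINT x|vol. fst v x)"
      unfolding lincomb_def fst_conv
      by (intro integral_lincomb E.integrable_rep E.poly_rep[OF local_spaceD(1)[OF u]] E.poly_rep[OF local_spaceD(1)[OF v]])
    moreover have "(LINT x|vol. ?r x) = a *\<^sub>R (LINT x|vol. disp_rec k \<F> T u x) + (LINT x|vol. disp_rec k \<F> T v x)"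
      by (intro integral_lincomb E.integrable_rep E.poly_rep[OF W(1)] E.poly_rep[OF W(2)])
    ultimately show ?thesis
      using U V by simp
  qed
  fix w assume w: "w \<in> ?W"
  note g = poly_grad_rep(1)[OF open_T w]
  have int: "integrable vol (\<lambda>x. (sym_grad (disp_rec k \<F> T z) x - grad_rec k \<F> T z x) \<bullet> sym_grad w x)"
    if "z \<in> local_space" for z
    by (intro E.integrable_rep continuous_rep_inner continuous_rep_diff g
        poly_grad_rep(1)[OF open_T conjunct1[OF disp_rec_spec[OF that]]] E.poly_rep[OF conjunct1[OF grad_rec_spec[OF that]]])
  have "(LINT x|vol. (sym_grad ?r x - grad_rec k \<F> T (lincomb a u v) x) \<bullet> sym_grad w x) =
      (LINT x|vol. a *\<^sub>R ((sym_grad (disp_rec k \<F> T u) x - grad_rec k \<F> T u x) \<bullet> sym_grad w x) +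
        (sym_grad (disp_rec k \<F> T v) x - grad_rec k \<F> T v x) \<bullet> sym_grad w x)"
  proof (rule Bochner_Integration.integral_cong)
    fix x assume "x \<in> space vol"
    then have x: "x \<in> T" by simp
    show "(sym_grad ?r x - grad_rec k \<F> T (lincomb a u v) x) \<bullet> sym_grad w x =
      a *\<^sub>R ((sym_grad (disp_rec k \<F> T u) x - grad_rec k \<F> T u x) \<bullet> sym_grad w x) +
        (sym_grad (disp_rec k \<F> T v) x - grad_rec k \<F> T v x) \<bullet> sym_grad w x"
      unfolding poly_grad_linear(1)[OF open_T W x] grad_rec_lincomb[OF u v] by (simp add: algebra_simps)
  qed simp
  also have "\<dots> = 0"
    using integral_lincomb[OF int[OF u] int[OF v], of a] U V w by simp
  finally show "(LINT x|vol. (sym_grad ?r x - grad_rec k \<F> T (lincomb a u v) x) \<bullet> sym_grad w x) = 0" .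
next
  show "(LINT x|vol. skew_grad (\<lambda>x. a *\<^sub>R disp_rec k \<F> T u x + disp_rec k \<F> T v x) x) = mean_skew (lincomb a u v)"
    using integral_grad_lincomb(2)[OF conjunct1[OF disp_rec_spec[OF u]] conjunct1[OF disp_rec_spec[OF v]]
        E.poly_rep[OF poly_space_0[OF subspace_UNIV]], of a]
      disp_rec_spec[OF u] disp_rec_spec[OF v] mean_skew_lincomb[OF u v, of a] by simp
qed

text \<open>The defining conditions hold for \<open>p\<close> itself: the gradient reconstruction of
  the interpolant is the strain of \<open>p\<close>, the element means coincide, and the skew
  condition is the divergence theorem for the traces.\<close>

lemma disp_rec_interpolant:
  assumes p: "p \<in> poly_space k T UNIV"
  shows "disp_rec k \<F> T (interpolant p) = p"
proof (rule sym, rule disp_rec_characterization[OF interpolant_local_space[OF p], THEN iffD2], intro conjI ballI)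
  show "p \<in> poly_space (k + 1) T UNIV"
    using p poly_space_degree_mono[of UNIV k "k + 1"] by auto
  show "(LINT x|vol. p x) = (LINT x|vol. fst (interpolant p) x)"
    by (simp add: interpolant_def)
  show "(LINT x|vol. skew_grad p x) = mean_skew (interpolant p)"
    unfolding integral_skew_grad[OF p] mean_skew_def interpolant_def
    by (intro sum.cong refl Bochner_Integration.integral_cong) (simp_all add: restr_def)
  show "(LINT x|vol. (sym_grad p x - grad_rec k \<F> T (interpolant p) x) \<bullet> sym_grad w x) = 0" for w
    using grad_rec_interpolant[OF p] by (subst Bochner_Integration.integral_cong[of vol vol _ "\<lambda>x. 0"]) auto
qed

section \<open>Face differences\<close>

lemma face_diff_lincomb:
  assumes u: "u \<in> local_space" and v: "v \<in> local_space" and F: "F \<in> faces"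
  shows "face_diff k \<F> T F (lincomb a u v) x = a *\<^sub>R face_diff k \<F> T F u x + face_diff k \<F> T F v x"
proof -
  have W: "disp_rec k \<F> T z \<in> poly_space (k + 1) T UNIV" if "z \<in> local_space" for z
    using disp_rec_spec[OF that] by blast
  have repF: "continuous_rep (srf F) (\<lambda>y. disp_rec k \<F> T z y - snd z F y)" if "z \<in> local_space" for z
    by (intro continuous_rep_diff trace_rep[OF F W[OF that]] face_rep[OF F local_spaceD(2)[OF that F]])
  have repT: "continuous_rep vol (\<lambda>y. disp_rec k \<F> T z y - fst z y)" if "z \<in> local_space" for z
    by (intro continuous_rep_diff E.poly_rep[OF W[OF that]] E.poly_rep[OF local_spaceD(1)[OF that]])
  have 1: "(\<lambda>y. disp_rec k \<F> T (lincomb a u v) y - snd (lincomb a u v) F y) =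
      (\<lambda>y. a *\<^sub>R (disp_rec k \<F> T u y - snd u F y) + (disp_rec k \<F> T v y - snd v F y))"
    unfolding disp_rec_lincomb[OF u v] by (simp add: lincomb_def algebra_simps)
  have 2: "(\<lambda>y. disp_rec k \<F> T (lincomb a u v) y - fst (lincomb a u v) y) =
      (\<lambda>y. a *\<^sub>R (disp_rec k \<F> T u y - fst u y) + (disp_rec k \<F> T v y - fst v y))"
    unfolding disp_rec_lincomb[OF u v] by (simp add: lincomb_def algebra_simps)
  show ?thesis
    unfolding face_diff_def 1 2 cell.L2_proj_lincomb[OF face_cell[OF F] repF[OF u] repF[OF v]]
      E.L2_proj_lincomb[OF repT[OF u] repT[OF v]]
    by (simp add: algebra_simps)
qed

lemma face_diff_interpolant:
  assumes p: "p \<in> poly_space k T UNIV" and F: "F \<in> faces"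
  shows "face_diff k \<F> T F (interpolant p) x = 0"
proof -
  have 1: "face_proj k F (\<lambda>y. disp_rec k \<F> T (interpolant p) y - snd (interpolant p) F y) = (\<lambda>x. 0)"
    by (rule cell.L2_proj_zero[OF face_cell[OF F]])
      (simp only: disp_rec_interpolant[OF p], simp add: interpolant_def restr_def)
  have 2: "elem_proj k T (\<lambda>y. disp_rec k \<F> T (interpolant p) y - fst (interpolant p) y) = (\<lambda>x. 0)"
    by (rule E.L2_proj_zero) (simp only: disp_rec_interpolant[OF p], simp add: interpolant_def)
  show ?thesis
    unfolding face_diff_def 1 2 by simp
qed

lemma face_diff_rep:
  assumes v: "v \<in> local_space" and F: "F \<in> faces"
  shows "continuous_rep (srf F) (face_diff k \<F> T F v)"
proof -
  interpret FC: cell "srf F" F by (rule face_cell[OF F])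
  have W: "disp_rec k \<F> T v \<in> poly_space (k + 1) T UNIV"
    using disp_rec_spec[OF v] by blast
  have repF: "continuous_rep (srf F) (\<lambda>y. disp_rec k \<F> T v y - snd v F y)"
    by (intro continuous_rep_diff trace_rep[OF F W] face_rep[OF F local_spaceD(2)[OF v F]])
  have repT: "continuous_rep vol (\<lambda>y. disp_rec k \<F> T v y - fst v y)"
    by (intro continuous_rep_diff E.poly_rep[OF W] E.poly_rep[OF local_spaceD(1)[OF v]])
  have "face_proj k F (\<lambda>y. disp_rec k \<F> T v y - snd v F y) \<in> poly_space k F UNIV"
    by (rule FC.L2_proj_poly[OF repF])
  moreover have "elem_proj k T (\<lambda>y. disp_rec k \<F> T v y - fst v y) \<in> poly_space k T UNIV"
    by (rule E.L2_proj_poly[OF repT])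
  ultimately show ?thesis
    unfolding face_diff_def[abs_def] by (intro continuous_rep_diff FC.poly_rep trace_rep[OF F])
qed

section \<open>Stabilization and boundary residual\<close>

text \<open>The same local unknown occurs in several guises, restricted to \<open>faces\<close> or
  as a total function; only the values on \<open>faces\<close> matter.\<close>

lemma reconstruction_cong:
  assumes "fst u = fst v" "\<And>F. F \<in> faces \<Longrightarrow> snd u F = snd v F"
  shows "grad_rec k \<F> T u = grad_rec k \<F> T v" "disp_rec k \<F> T u = disp_rec k \<F> T v"
    and "F \<in> faces \<Longrightarrow> face_diff k \<F> T F u = face_diff k \<F> T F v"
proof -
  have 1: "(\<Sum>F\<in>faces. LINT x|srf F. snd u F x \<bullet> (\<tau> x *v \<nu> F)) = (\<Sum>F\<in>faces. LINT x|srf F. snd v F x \<bullet> (\<tau> x *v \<nu> F))"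
    for \<tau> :: "'d tensor_field"
    using assms(2) by (intro sum.cong) auto
  show G: "grad_rec k \<F> T u = grad_rec k \<F> T v"
    unfolding grad_rec_def 1 assms(1) ..
  have 2: "(\<Sum>F\<in>faces. LINT x|srf F. (1/2) *\<^sub>R (outer (\<nu> F) (snd u F x) - outer (snd u F x) (\<nu> F))) =
      (\<Sum>F\<in>faces. LINT x|srf F. (1/2) *\<^sub>R (outer (\<nu> F) (snd v F x) - outer (snd v F x) (\<nu> F)))"
    using assms(2) by (intro sum.cong) auto
  show D: "disp_rec k \<F> T u = disp_rec k \<F> T v"
    unfolding disp_rec_def G 2 assms(1) ..
  show "face_diff k \<F> T F u = face_diff k \<F> T F v" if "F \<in> faces"
    unfolding face_diff_def[abs_def] D assms(1) assms(2)[OF that] ..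
qed

lemma stab_cong:
  assumes "\<And>F x. F \<in> faces \<Longrightarrow> x \<in> F \<Longrightarrow> face_diff k \<F> T F u x = face_diff k \<F> T F u' x"
    and "\<And>F x. F \<in> faces \<Longrightarrow> x \<in> F \<Longrightarrow> face_diff k \<F> T F v x = face_diff k \<F> T F v' x"
  shows "stab k \<gamma> \<F> T u v = stab k \<gamma> \<F> T u' v'"
  unfolding stab_def using assms
  by (intro sum.cong refl arg_cong2[where f = "(*)"] Bochner_Integration.integral_cong) auto

lemma stab_lincomb_right:
  assumes u: "u \<in> local_space" and v: "v \<in> local_space" and w: "w \<in> local_space"
  shows "stab k \<gamma> \<F> T u (lincomb a v w) = a * stab k \<gamma> \<F> T u v + stab k \<gamma> \<F> T u w"
proof -
  have "(LINT x|srf F. face_diff k \<F> T F u x \<bullet> face_diff k \<F> T F (lincomb a v w) x) =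
      a * (LINT x|srf F. face_diff k \<F> T F u x \<bullet> face_diff k \<F> T F v x) +
      (LINT x|srf F. face_diff k \<F> T F u x \<bullet> face_diff k \<F> T F w x)" if F: "F \<in> faces" for F
  proof -
    have "integrable (srf F) (\<lambda>x. face_diff k \<F> T F u x \<bullet> face_diff k \<F> T F z x)" if "z \<in> local_space" for z
      by (intro face_int[OF F] continuous_rep_inner face_diff_rep[OF u F] face_diff_rep[OF that F])
    then have "(LINT x|srf F. a *\<^sub>R (face_diff k \<F> T F u x \<bullet> face_diff k \<F> T F v x) + face_diff k \<F> T F u x \<bullet> face_diff k \<F> T F w x) =
      a *\<^sub>R (LINT x|srf F. face_diff k \<F> T F u x \<bullet> face_diff k \<F> T F v x) +
      (LINT x|srf F. face_diff k \<F> T F u x \<bullet> face_diff k \<F> T F w x)"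
      using v w by (intro integral_lincomb) auto
    then show ?thesis
      by (simp add: face_diff_lincomb[OF v w F] inner_add_right)
  qed
  then show ?thesis
    by (simp add: stab_def distrib_left sum.distrib sum_distrib_left ac_simps)
qed

lemma boundary_local_space:
  assumes "\<And>F. F \<in> faces \<Longrightarrow> \<alpha> F \<in> poly_space k F UNIV"
  shows "((\<lambda>x. 0), \<alpha>) \<in> local_space"
  using assms by (simp add: local_space_def poly_space_0[OF subspace_UNIV])

lemma bdry_diff_apply: "F \<in> faces \<Longrightarrow> bdry_diff \<F> T v F = restr F (\<lambda>x. snd v F x - fst v x)"
  by (simp add: bdry_diff_def)

lemma bdry_diff_poly:
  assumes v: "v \<in> local_space" and F: "F \<in> faces"
  shows "bdry_diff \<F> T v F \<in> poly_space k F UNIV"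
proof -
  have "(\<lambda>x. snd v F x - restr F (fst v) x) \<in> poly_space k F UNIV"
    by (intro poly_space_diff subspace_UNIV local_spaceD(2)[OF v F] trace_poly[OF F local_spaceD(1)[OF v]])
  moreover have "(\<lambda>x. snd v F x - restr F (fst v) x) = bdry_diff \<F> T v F"
    unfolding bdry_diff_apply[OF F]
    using poly_space_outside[OF local_spaceD(2)[OF v F]] closed_faces[OF F] by (auto simp: restr_def)
  ultimately show ?thesis
    by simp
qed

text \<open>The face differences vanish on interpolants of polynomials, so they only see the boundary
  differences.\<close>

lemma face_diff_bdry_diff:
  assumes v: "v \<in> local_space" and F: "F \<in> faces"
  shows "face_diff k \<F> T F v x = face_diff k \<F> T F ((\<lambda>x. 0), bdry_diff \<F> T v) x"
proof -
  note p = local_spaceD(1)[OF v]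
  have b: "((\<lambda>x. 0), bdry_diff \<F> T v) \<in> local_space"
    by (intro boundary_local_space bdry_diff_poly[OF v])
  \<comment> \<open>On the faces of \<open>T\<close>, the unknown \<open>v\<close> is the sum of the
    interpolant of its element part and of its boundary differences.\<close>
  have "face_diff k \<F> T F v = face_diff k \<F> T F (lincomb 1 (interpolant (fst v)) ((\<lambda>x. 0), bdry_diff \<F> T v))"
  proof (rule reconstruction_cong(3)[OF _ _ F])
    show "fst v = fst (lincomb 1 (interpolant (fst v)) ((\<lambda>x. 0), bdry_diff \<F> T v))"
      by (simp add: lincomb_def interpolant_def)
    fix F' assume F': "F' \<in> faces"
    show "snd v F' = snd (lincomb 1 (interpolant (fst v)) ((\<lambda>x. 0), bdry_diff \<F> T v)) F'"
      using poly_space_outside[OF local_spaceD(2)[OF v F']] closed_faces[OF F']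
      by (auto simp: lincomb_def interpolant_def bdry_diff_apply[OF F'] restr_def)
  qed
  then show ?thesis
    using face_diff_lincomb[OF interpolant_local_space[OF p] b F, of 1 x] face_diff_interpolant[OF p F, of x] by simp
qed

lemma stab_bdry_diff:
  assumes "u \<in> local_space" "v \<in> local_space"
  shows "stab k \<gamma> \<F> T u v = stab k \<gamma> \<F> T ((\<lambda>x. 0), bdry_diff \<F> T u) ((\<lambda>x. 0), bdry_diff \<F> T v)"
  by (intro stab_cong face_diff_bdry_diff assms)

text \<open>Splits a boundary test function into contributions of single faces, so that the residual
  can be constructed one face at a time.\<close>

lemma stab_boundary_sum:
  assumes u: "u \<in> local_space" and \<alpha>: "\<alpha> \<in> bdry_space k \<F> T"
  shows "stab k \<gamma> \<F> T u ((\<lambda>x. 0), \<alpha>) =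
    (\<Sum>F\<in>faces. stab k \<gamma> \<F> T u ((\<lambda>x. 0), \<lambda>F'. if F' = F then \<alpha> F else (\<lambda>x. 0)))"
proof -
  have \<alpha>F: "\<alpha> F \<in> poly_space k F UNIV" if "F \<in> faces" for F
    using \<alpha> that by (auto simp: bdry_space_def)
  have z: "(\<lambda>x. 0) \<in> poly_space k F UNIV" for F
    by (rule poly_space_0[OF subspace_UNIV])
  have "stab k \<gamma> \<F> T u ((\<lambda>x. 0), \<lambda>F. if F \<in> S then \<alpha> F else (\<lambda>x. 0)) =
      (\<Sum>F\<in>S. stab k \<gamma> \<F> T u ((\<lambda>x. 0), \<lambda>F'. if F' = F then \<alpha> F else (\<lambda>x. 0)))"
    if "finite S" "S \<subseteq> faces" for S
    using that
  proof (induction S rule: finite_induct)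
    case empty
    have L: "((\<lambda>x. 0), \<lambda>F x. 0) \<in> local_space"
      by (intro boundary_local_space z)
    show ?case
      using stab_lincomb_right[OF u L L, of \<gamma> 1] by (simp add: lincomb_def)
  next
    case (insert F S)
    let ?A = "((\<lambda>x. 0), \<lambda>F'. if F' = F then \<alpha> F else (\<lambda>x. 0))"
    let ?B = "((\<lambda>x. 0), \<lambda>F. if F \<in> S then \<alpha> F else (\<lambda>x. 0))"
    have A: "?A \<in> local_space"
      using insert.prems \<alpha>F z by (intro boundary_local_space) auto
    have B: "?B \<in> local_space"
      using insert.prems \<alpha>F z by (intro boundary_local_space) auto
    have "((\<lambda>x. 0), \<lambda>F'. if F' \<in> insert F S then \<alpha> F' else (\<lambda>x. 0)) = lincomb 1 ?A ?B"
      using insert.hyps by (auto simp: lincomb_def fun_eq_iff)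
    then show ?case
      using stab_lincomb_right[OF u A B, of \<gamma> 1] insert by simp
  qed
  from this[OF finite_mesh_faces subset_refl]
  have "stab k \<gamma> \<F> T u ((\<lambda>x. 0), \<lambda>F. if F \<in> faces then \<alpha> F else (\<lambda>x. 0)) =
      (\<Sum>F\<in>faces. stab k \<gamma> \<F> T u ((\<lambda>x. 0), \<lambda>F'. if F' = F then \<alpha> F else (\<lambda>x. 0)))" .
  moreover have "stab k \<gamma> \<F> T u ((\<lambda>x. 0), \<lambda>F. if F \<in> faces then \<alpha> F else (\<lambda>x. 0)) = stab k \<gamma> \<F> T u ((\<lambda>x. 0), \<alpha>)"
  proof (rule stab_cong)
    show "face_diff k \<F> T F ((\<lambda>x. 0), \<lambda>F. if F \<in> faces then \<alpha> F else (\<lambda>x. 0)) x = face_diff k \<F> T F ((\<lambda>x. 0), \<alpha>) x"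
      if "F \<in> faces" for F x
      by (rule fun_cong[OF reconstruction_cong(3)[OF _ _ that]]) auto
  qed simp
  ultimately show ?thesis
    by simp
qed

text \<open>The boundary product decouples over the faces, so existence follows from one Riesz
  representation per face. For uniqueness, the difference of two candidates on one face, extended by
  zero, is used as test function.\<close>

lemma bdry_residual_spec:
  assumes u: "u \<in> local_space"
  shows "bdry_residual k \<gamma> \<F> T u \<in> bdry_space k \<F> T" (is "?R \<in> _")
    and "\<And>\<alpha>. \<alpha> \<in> bdry_space k \<F> T \<Longrightarrow>
      - (\<Sum>F\<in>faces. LINT x|srf F. bdry_residual k \<gamma> \<F> T u F x \<bullet> \<alpha> F x) =
      stab k \<gamma> \<F> T ((\<lambda>x. 0), bdry_diff \<F> T u) ((\<lambda>x. 0), \<alpha>)"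
proof -
  let ?b = "((\<lambda>x. 0), bdry_diff \<F> T u)"
  let ?single = "\<lambda>F q. ((\<lambda>x. 0), \<lambda>F'. if F' = F then q else (\<lambda>x. 0)) :: 'd local_unknown"
  let ?P = "\<lambda>R. R \<in> bdry_space k \<F> T \<and> (\<forall>\<alpha>\<in>bdry_space k \<F> T.
    - (\<Sum>F\<in>faces. LINT x|srf F. R F x \<bullet> \<alpha> F x) = stab k \<gamma> \<F> T ?b ((\<lambda>x. 0), \<alpha>))"
  have b: "?b \<in> local_space"
    by (intro boundary_local_space bdry_diff_poly[OF u])
  have z: "(\<lambda>x. 0) \<in> poly_space k F (UNIV :: (real^'d) set)" for F :: "(real^'d) set"
    by (rule poly_space_0[OF subspace_UNIV])
  have single: "?single F q \<in> local_space" if "q \<in> poly_space k F UNIV" for F q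
    using that z by (intro boundary_local_space) auto
  have lin: "stab k \<gamma> \<F> T ?b (?single F h) = a * stab k \<gamma> \<F> T ?b (?single F p) + stab k \<gamma> \<F> T ?b (?single F q)"
    if "p \<in> poly_space k F UNIV" "q \<in> poly_space k F UNIV" "h = (\<lambda>x. a *\<^sub>R p x + q x)" for F p q h a
  proof -
    have "?single F h = lincomb a (?single F p) (?single F q)"
      by (auto simp: lincomb_def fun_eq_iff that(3))
    then show ?thesis
      using stab_lincomb_right[OF b single[OF that(1)] single[OF that(2)], of \<gamma> a] by simp
  qed
  have "\<exists>!r. r \<in> poly_space k F UNIV \<and> (\<forall>q\<in>poly_space k F UNIV. (LINT x|srf F. r x \<bullet> q x) = - stab k \<gamma> \<F> T ?b (?single F q))"
    if F: "F \<in> faces" for F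
  proof (rule cell.riesz_poly[OF face_cell[OF F] subspace_UNIV])
    fix p q :: "'d vec_field" and a :: real assume p: "p \<in> poly_space k F UNIV"
    have "stab k \<gamma> \<F> T ?b (?single F (\<lambda>x. 0)) = 0"
      using lin[OF z z, of "\<lambda>x. 0" 1 F] by simp
    then show "- stab k \<gamma> \<F> T ?b (?single F (\<lambda>x. a *\<^sub>R p x)) = a * - stab k \<gamma> \<F> T ?b (?single F p)"
      using lin[OF p z, of "\<lambda>x. a *\<^sub>R p x" a] by simp
    assume q: "q \<in> poly_space k F UNIV"
    show "- stab k \<gamma> \<F> T ?b (?single F (\<lambda>x. p x + q x)) = - stab k \<gamma> \<F> T ?b (?single F p) + - stab k \<gamma> \<F> T ?b (?single F q)"
      using lin[OF p q, of "\<lambda>x. p x + q x" 1] by simp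
  qed
  then have "\<forall>F\<in>faces. \<exists>r. r \<in> poly_space k F UNIV \<and>
      (\<forall>q\<in>poly_space k F UNIV. (LINT x|srf F. r x \<bullet> q x) = - stab k \<gamma> \<F> T ?b (?single F q))"
    by (intro ballI ex1_implies_ex)
  from bchoice[OF this] obtain R where R0: "\<forall>F\<in>faces. R F \<in> poly_space k F UNIV \<and>
      (\<forall>q\<in>poly_space k F UNIV. (LINT x|srf F. R F x \<bullet> q x) = - stab k \<gamma> \<F> T ?b (?single F q))" ..
  have R: "\<And>F. F \<in> faces \<Longrightarrow> R F \<in> poly_space k F UNIV"
    "\<And>F q. F \<in> faces \<Longrightarrow> q \<in> poly_space k F UNIV \<Longrightarrow> (LINT x|srf F. R F x \<bullet> q x) = - stab k \<gamma> \<F> T ?b (?single F q)"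
    using R0 by blast+
  have "?P (restrict R faces)"
  proof (intro conjI ballI)
    show "restrict R faces \<in> bdry_space k \<F> T"
      using R(1) by (auto simp: bdry_space_def)
    fix \<alpha> assume \<alpha>: "\<alpha> \<in> bdry_space k \<F> T"
    then have "\<alpha> F \<in> poly_space k F UNIV" if "F \<in> faces" for F
      using that by (auto simp: bdry_space_def)
    then have "(\<Sum>F\<in>faces. LINT x|srf F. restrict R faces F x \<bullet> \<alpha> F x) = (\<Sum>F\<in>faces. - stab k \<gamma> \<F> T ?b (?single F (\<alpha> F)))"
      using R(2) by (intro sum.cong) auto
    then show "- (\<Sum>F\<in>faces. LINT x|srf F. restrict R faces F x \<bullet> \<alpha> F x) = stab k \<gamma> \<F> T ?b ((\<lambda>x. 0), \<alpha>)"
      unfolding stab_boundary_sum[OF b \<alpha>] by (simp add: sum_negf)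
  qed
  moreover have "Q = R'" if Q: "?P Q" and R': "?P R'" for Q R'
  proof (rule PiE_ext)
    show "Q \<in> (\<Pi>\<^sub>E F\<in>faces. poly_space k F UNIV)" "R' \<in> (\<Pi>\<^sub>E F\<in>faces. poly_space k F UNIV)"
      using Q R' by (auto simp: bdry_space_def)
    fix F assume F: "F \<in> faces"
    interpret FC: cell "srf F" F by (rule face_cell[OF F])
    have QF: "Q F \<in> poly_space k F UNIV" "R' F \<in> poly_space k F UNIV"
      using Q R' F by (auto simp: bdry_space_def)
    have d: "(\<lambda>x. Q F x - R' F x) \<in> poly_space k F UNIV" (is "?d \<in> _")
      using QF by (intro poly_space_diff subspace_UNIV)
    let ?\<alpha> = "\<lambda>F'\<in>faces. if F' = F then ?d else (\<lambda>x. 0)"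
    have \<alpha>: "?\<alpha> \<in> bdry_space k \<F> T"
      using d z by (auto simp: bdry_space_def)
    have "(\<Sum>F'\<in>faces. LINT x|srf F'. S F' x \<bullet> ?\<alpha> F' x) = (LINT x|srf F. S F x \<bullet> ?d x)" for S :: "(real^'d) set \<Rightarrow> 'd vec_field"
    proof -
      have "(\<Sum>F'\<in>faces. LINT x|srf F'. S F' x \<bullet> ?\<alpha> F' x) = (\<Sum>F'\<in>faces. if F' = F then LINT x|srf F. S F x \<bullet> ?d x else 0)"
        by (intro sum.cong) auto
      then show ?thesis
        using F finite_mesh_faces by simp
    qed
    then have "(LINT x|srf F. Q F x \<bullet> ?d x) = (LINT x|srf F. R' F x \<bullet> ?d x)"
      using conjunct2[OF Q, rule_format, OF \<alpha>] conjunct2[OF R', rule_format, OF \<alpha>] by simp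
    moreover have "integrable (srf F) (\<lambda>x. Q F x \<bullet> ?d x)" "integrable (srf F) (\<lambda>x. R' F x \<bullet> ?d x)"
      by (intro FC.integrable_rep continuous_rep_inner FC.poly_rep[OF QF(1)] FC.poly_rep[OF QF(2)] FC.poly_rep[OF d])+
    ultimately have "(LINT x|srf F. ?d x \<bullet> ?d x) = 0"
      by (simp add: inner_diff_left)
    then have "?d = (\<lambda>x. 0)"
      by (rule FC.poly_inner_self_eq_0[OF d])
    then have "Q F x - R' F x = 0" for x
      by (rule fun_cong)
    then show "Q F = R' F"
      by (intro ext) simp
  qed
  ultimately have ex1: "\<exists>!R. ?P R"
    by blast
  have the: "bdry_residual k \<gamma> \<F> T u = (THE R. ?P R)"
    unfolding bdry_residual_def ..
  have "?P (bdry_residual k \<gamma> \<F> T u)"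
    unfolding the by (rule theI'[OF ex1])
  then show "?R \<in> bdry_space k \<F> T" "\<And>\<alpha>. \<alpha> \<in> bdry_space k \<F> T \<Longrightarrow>
      - (\<Sum>F\<in>faces. LINT x|srf F. bdry_residual k \<gamma> \<F> T u F x \<bullet> \<alpha> F x) = stab k \<gamma> \<F> T ?b ((\<lambda>x. 0), \<alpha>)"
    by blast+
qed

lemma stab_eq_residual:
  assumes u: "u \<in> local_space" and v: "v \<in> local_space"
  shows "stab k \<gamma> \<F> T u v = - (\<Sum>F\<in>faces. LINT x|srf F. bdry_residual k \<gamma> \<F> T u F x \<bullet> (snd v F x - fst v x))"
proof -
  have "bdry_diff \<F> T v \<in> bdry_space k \<F> T"
    using bdry_diff_poly[OF v] by (auto simp: bdry_space_def bdry_diff_def)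
  then have "stab k \<gamma> \<F> T u v = - (\<Sum>F\<in>faces. LINT x|srf F. bdry_residual k \<gamma> \<F> T u F x \<bullet> bdry_diff \<F> T v F x)"
    unfolding stab_bdry_diff[OF u v] using bdry_residual_spec(2)[OF u] by simp
  also have "\<dots> = - (\<Sum>F\<in>faces. LINT x|srf F. bdry_residual k \<gamma> \<F> T u F x \<bullet> (snd v F x - fst v x))"
    by (intro arg_cong[where f = uminus] sum.cong refl Bochner_Integration.integral_cong)
      (auto simp: bdry_diff_apply restr_def)
  finally show ?thesis .
qed

end

section \<open>The principle of virtual work\<close>

lemma transpose_inner: "transpose A \<bullet> B = A \<bullet> transpose (B :: real^'d::finite^'d)"
  using inner_transpose[of A "transpose B"] by simp

lemma symmetrize_linear: "linear (\<lambda>A :: real^'d::finite^'d. (1/2) *\<^sub>R (A + transpose A))"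
  by (rule linearI) (simp_all add: vec_eq_iff transpose_def algebra_simps)

lemma symmetrize_sym: "(1/2) *\<^sub>R (A + transpose A) \<in> (sym_matrices :: (real^'d::finite^'d) set)"
  by (simp add: sym_matrices_def transpose_def vec_eq_iff)

lemma symmetrize_id: "A \<in> sym_matrices \<Longrightarrow> (1/2) *\<^sub>R (A + transpose A) = (A :: real^'d::finite^'d)"
proof -
  assume "A \<in> sym_matrices"
  then have "transpose A = A"
    by (simp add: sym_matrices_def)
  then show ?thesis
    by (simp only: scaleR_half_double)
qed

text \<open>The argument is approximated by simple functions, symmetrized so that their values stay in the
  domain of continuity.\<close>

lemma caratheodory_measurable:
  fixes \<sigma> :: "real^'d::finite \<Rightarrow> real^'d^'d \<Rightarrow> real^'d^'d"
  assumes T: "T \<in> sets lebesgue"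
    and cont: "AE x in lebesgue_on T. continuous_on sym_matrices (\<sigma> x)"
    and meas: "\<And>\<tau>. \<tau> \<in> sym_matrices \<Longrightarrow> (\<lambda>x. \<sigma> x \<tau>) \<in> borel_measurable (lebesgue_on T)"
    and G: "G \<in> borel_measurable (lebesgue_on T)" "\<And>x. x \<in> T \<Longrightarrow> G x \<in> sym_matrices"
  shows "(\<lambda>x. \<sigma> x (G x)) \<in> borel_measurable (lebesgue_on T)"
proof -
  let ?M = "lebesgue_on T" and ?P = "\<lambda>A :: real^'d^'d. (1/2) *\<^sub>R (A + transpose A)"
  have T': "T \<inter> space lebesgue \<in> sets lebesgue"
    using T by simp
  obtain s where s: "\<And>i. simple_function ?M (s i)" "\<And>x. x \<in> T \<Longrightarrow> (\<lambda>i. s i x) \<longlonglongrightarrow> G x"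
    using borel_measurable_implies_sequence_metric[OF G(1), of 0] by auto
  \<comment> \<open>A simple function takes finitely many values, so \<open>\<sigma> x\<close> is
    evaluated at finitely many fixed matrices on measurable pieces.\<close>
  have step: "(\<lambda>x. \<sigma> x (?P (s i x))) \<in> borel_measurable ?M" for i
  proof (rule measurable_compose_countable'[where f = "\<lambda>A x. \<sigma> x (?P A)" and I = "s i ` space ?M"])
    show "(\<lambda>x. \<sigma> x (?P A)) \<in> borel_measurable ?M" for A
      using meas symmetrize_sym by blast
    show "s i \<in> measurable ?M (count_space (s i ` space ?M))"
      using s(1)[of i] unfolding simple_function_def by (subst measurable_count_space_eq2) auto
    show "countable (s i ` space ?M)"
      using s(1)[of i] unfolding simple_function_def by (intro countable_finite) auto
  qed
  have "AE x in lebesgue. x \<in> T \<longrightarrow> continuous_on sym_matrices (\<sigma> x)"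
    using cont by (subst (asm) AE_restrict_space_iff[OF T']) auto
  then obtain N where N: "N \<in> null_sets lebesgue" "\<And>x. x \<in> T \<Longrightarrow> x \<notin> N \<Longrightarrow> continuous_on sym_matrices (\<sigma> x)"
    unfolding completion.AE_iff_null_sets by auto
  have [measurable]: "N \<in> sets lebesgue"
    using N(1) by auto
  \<comment> \<open>The null set where continuity may fail is cut out, so that the limit holds at
    every point; completeness of Lebesgue measure lets the indicator be dropped at the end.\<close>
  let ?f = "\<lambda>x. indicator (- N) x *\<^sub>R (indicator T x *\<^sub>R \<sigma> x (G x))"
  have "?f \<in> borel_measurable lebesgue"
  proof (rule borel_measurable_LIMSEQ_metric)
    show "(\<lambda>x. indicator (- N) x *\<^sub>R (indicator T x *\<^sub>R \<sigma> x (?P (s i x)))) \<in> borel_measurable lebesgue" for i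
    proof (rule borel_measurable_scaleR)
      show "(indicator (- N) :: _ \<Rightarrow> real) \<in> borel_measurable lebesgue"
        by (intro borel_measurable_indicator) (simp add: Compl_eq_Diff_UNIV sets.Diff)
      show "(\<lambda>x. indicator T x *\<^sub>R \<sigma> x (?P (s i x))) \<in> borel_measurable lebesgue"
        using step[of i] by (simp only: borel_measurable_restrict_space_iff[OF T'])
    qed
    fix x
    show "(\<lambda>i. indicator (- N) x *\<^sub>R (indicator T x *\<^sub>R \<sigma> x (?P (s i x)))) \<longlonglongrightarrow> ?f x"
    proof (cases "x \<in> T \<and> x \<notin> N")
      case True
      have "continuous_on UNIV ?P"
        by (rule linear_continuous_on) (simp only: symmetrize_linear linear_conv_bounded_linear[symmetric])
      then have "(\<lambda>i. ?P (s i x)) \<longlonglongrightarrow> ?P (G x)"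
        using s(2)[of x] True continuous_on_tendsto_compose[of UNIV ?P] by auto
      then have "(\<lambda>i. ?P (s i x)) \<longlonglongrightarrow> G x"
        using symmetrize_id[OF G(2)[of x]] True by simp
      then have "(\<lambda>i. \<sigma> x (?P (s i x))) \<longlonglongrightarrow> \<sigma> x (G x)"
        using True G(2) N(2)
        by (intro continuous_on_tendsto_compose[of sym_matrices "\<sigma> x"] always_eventually allI symmetrize_sym) auto
      then show ?thesis
        using True by simp
    qed auto
  qed
  moreover have "AE x in lebesgue. ?f x = indicator T x *\<^sub>R \<sigma> x (G x)"
    using AE_not_in[OF N(1)] by eventually_elim simp
  ultimately have "(\<lambda>x. indicator T x *\<^sub>R \<sigma> x (G x)) \<in> borel_measurable lebesgue"
    by (rule borel_measurable_AE)
  then show ?thesis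
    by (simp only: borel_measurable_restrict_space_iff[OF T'])
qed

lemma lebesgue_on_subset:
  assumes "T \<in> sets lebesgue" "\<Omega> \<in> sets lebesgue" "T \<subseteq> \<Omega>"
  shows "lebesgue_on T = restrict_space (lebesgue_on \<Omega>) T"
proof -
  have "restrict_space (lebesgue_on \<Omega>) T = restrict_space lebesgue (\<Omega> \<inter> T)"
    using assms by (intro restrict_restrict_space) auto
  then show ?thesis
    using assms(3) by (simp add: Int_absorb1)
qed

lemma square_integrable_imp_integrable_on:
  fixes f :: "real^'d::finite \<Rightarrow> 'v::euclidean_space"
  assumes f: "square_integrable (lebesgue_on \<Omega>) f" and T: "open T" "bounded T" "T \<subseteq> \<Omega>" and \<Omega>: "open \<Omega>"
  shows "integrable (lebesgue_on T) f"
proof -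
  have sets: "T \<in> sets lebesgue" "\<Omega> \<in> sets lebesgue"
    using T \<Omega> by auto
  note eq = lebesgue_on_subset[OF sets T(3)]
  have meas: "f \<in> borel_measurable (lebesgue_on T)"
    using f by (intro measurable_restrict_mono[OF _ T(3)]) (simp add: square_integrable_def)
  have "T \<in> sets (lebesgue_on \<Omega>)"
    using sets T(3) by (auto simp: sets_restrict_space)
  then have "integrable (lebesgue_on \<Omega>) (\<lambda>x. indicator T x *\<^sub>R (norm (f x))\<^sup>2)"
    using f by (intro integrable_mult_indicator) (auto simp: square_integrable_def)
  then have sq: "integrable (lebesgue_on T) (\<lambda>x. (norm (f x))\<^sup>2)"
    unfolding eq using sets T(3) by (subst integrable_restrict_space) (auto simp: sets_restrict_space)
  interpret finite_measure "lebesgue_on T"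
  proof (rule finite_measureI)
    have "emeasure lborel T < \<infinity>"
      using T(2) by (rule emeasure_bounded_finite)
    then show "emeasure (lebesgue_on T) (space (lebesgue_on T)) \<noteq> \<infinity>"
      using sets T(1) by (simp add: emeasure_restrict_space)
  qed
  show ?thesis
  proof (rule Bochner_Integration.integrable_bound)
    show "integrable (lebesgue_on T) (\<lambda>x. 1 + (norm (f x))\<^sup>2)"
      using sq by (intro Bochner_Integration.integrable_add integrable_const)
    \<comment> \<open>From the square of \<open>norm (f x) - 1\<close> being nonnegative; the
      constant 1 is integrable since \<open>T\<close> has finite measure.\<close>
    have "norm (f x) \<le> norm (1 + (norm (f x))\<^sup>2)" for x
    proof -
      have "2 * norm (f x) \<le> 1 + (norm (f x))\<^sup>2"
        using zero_le_power2[of "norm (f x) - 1"] by (simp add: power2_diff)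
      then have "norm (f x) \<le> 1 + (norm (f x))\<^sup>2"
        using norm_ge_zero[of "f x"] by linarith
      then show ?thesis
        by simp
    qed
    then show "AE x in lebesgue_on T. norm (f x) \<le> norm (1 + (norm (f x))\<^sup>2)"
      by simp
  qed (rule meas)
qed

context hho_element
begin

text \<open>The growth condition bounds the stress by the norm of \<open>\<sigma> x 0\<close> plus a
  multiple of the norm of \<open>G x\<close>, both integrable on the bounded element; measurability
  is the Caratheodory property.\<close>

lemma stress_integrable:
  fixes \<sigma> :: "real^'d \<Rightarrow> real^'d^'d \<Rightarrow> real^'d^'d"
  assumes \<sigma>: "assumption_S \<Omega> \<sigma>" and G: "G \<in> poly_space l T sym_matrices"
  shows "integrable vol (\<lambda>x. \<sigma> x (G x))"
proof -
  interpret finite_measure vol by (rule E.finite_M)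
  have sets: "T \<in> sets lebesgue" "\<Omega> \<in> sets lebesgue"
    using open_T open_\<Omega> by auto
  have sub: "T \<subseteq> \<Omega>"
    by (rule element(4)[OF T])
  have AE_T: "AE x in vol. Q x" if "AE x in lebesgue_on \<Omega>. Q x" for Q
  proof -
    have "AE x in lebesgue. x \<in> \<Omega> \<longrightarrow> Q x"
      using that sets by (subst (asm) AE_restrict_space_iff) auto
    then have "AE x in lebesgue. x \<in> T \<longrightarrow> Q x"
      by eventually_elim (use sub in auto)
    then show ?thesis
      using sets by (subst AE_restrict_space_iff) auto
  qed
  have G_sym: "G x \<in> sym_matrices" for x
    by (rule poly_space_values[OF subspace_sym_matrices G])
  have zero: "0 \<in> (sym_matrices :: (real^'d^'d) set)"
    by (rule subspace_0[OF subspace_sym_matrices])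
  have intG: "integrable vol G"
    by (intro E.integrable_rep E.poly_rep[OF G])
  obtain c where c: "c > 0" "AE x in lebesgue_on \<Omega>. \<forall>\<tau>\<in>sym_matrices. norm (\<sigma> x \<tau> - \<sigma> x 0) \<le> c * norm \<tau>"
  proof -
    from \<sigma> obtain c1 c2 where *: "c1 > 0" "AE x in lebesgue_on \<Omega>. \<forall>\<tau>\<in>sym_matrices. \<forall>\<eta>\<in>sym_matrices.
        norm (\<sigma> x \<tau> - \<sigma> x 0) \<le> c1 * norm \<tau> \<and> \<sigma> x \<tau> \<bullet> \<tau> \<ge> c2 * (norm \<tau>)\<^sup>2 \<and> (\<sigma> x \<tau> - \<sigma> x \<eta>) \<bullet> (\<tau> - \<eta>) \<ge> 0"
      unfolding assumption_S_def by blast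
    have "AE x in lebesgue_on \<Omega>. \<forall>\<tau>\<in>sym_matrices. norm (\<sigma> x \<tau> - \<sigma> x 0) \<le> c1 * norm \<tau>"
      using *(2) by eventually_elim (use zero in blast)
    then show thesis
      using that *(1) by blast
  qed
  have meas: "(\<lambda>x. \<sigma> x (G x)) \<in> borel_measurable vol"
  proof (rule caratheodory_measurable[of T \<sigma> G, OF sets(1)])
    show "AE x in vol. continuous_on sym_matrices (\<sigma> x)"
      using \<sigma> by (intro AE_T) (simp add: assumption_S_def)
    show "(\<lambda>x. \<sigma> x \<tau>) \<in> borel_measurable vol" if "\<tau> \<in> sym_matrices" for \<tau>
      using \<sigma> that by (intro measurable_restrict_mono[OF _ sub]) (simp add: assumption_S_def)
    show "G \<in> borel_measurable vol"
      using intG by auto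
  qed (rule G_sym)
  have int0: "integrable vol (\<lambda>x. \<sigma> x 0)"
    by (rule square_integrable_imp_integrable_on[OF _ open_T element(5)[OF T] sub open_\<Omega>])
      (use \<sigma> in \<open>simp add: assumption_S_def\<close>)
  show ?thesis
  proof (rule Bochner_Integration.integrable_bound)
    show "integrable vol (\<lambda>x. norm (\<sigma> x 0) + c * norm (G x))"
      by (intro Bochner_Integration.integrable_add integrable_mult_right integrable_norm int0 intG)
    show "AE x in vol. norm (\<sigma> x (G x)) \<le> norm (norm (\<sigma> x 0) + c * norm (G x))"
      using AE_T[OF c(2)]
    proof eventually_elim
      case (elim x)
      have "norm (\<sigma> x (G x)) \<le> norm (\<sigma> x 0) + norm (\<sigma> x (G x) - \<sigma> x 0)"
        by (rule norm_triangle_sub)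
      also have "\<dots> \<le> norm (\<sigma> x 0) + c * norm (G x)"
        using elim G_sym by auto
      finally show ?case
        by simp
    qed
  qed (rule meas)
qed

text \<open>\<open>L2_proj\<close> works with all matrices, while test tensors must be symmetric.
  The transpose of the projection has the same moments as the symmetric field \<open>s\<close>, so
  by uniqueness it is the projection.\<close>

lemma elem_proj_sym:
  fixes s :: "'d tensor_field"
  assumes s: "integrable vol s" and sym: "\<And>x. x \<in> T \<Longrightarrow> s x \<in> sym_matrices"
  shows "elem_proj k T s \<in> poly_space k T sym_matrices"
proof -
  let ?p = "elem_proj k T s"
  have int: "integrable vol (\<lambda>x. s x \<bullet> q x)" if "q \<in> poly_space k T UNIV" for q :: "'d tensor_field"
    by (rule E.integrable_inner_rep[OF s E.poly_rep[OF that]])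
  have spec: "?p \<in> poly_space k T UNIV" "\<forall>q\<in>poly_space k T UNIV. (LINT x|vol. ?p x \<bullet> q x) = (LINT x|vol. s x \<bullet> q x)"
    using E.L2_proj_spec[OF int] by blast+
  note p = spec(1)
  have lin: "linear (transpose :: real^'d^'d \<Rightarrow> real^'d^'d)"
    by (auto simp: transpose_def vec_eq_iff intro!: linearI)
  have tr: "(\<lambda>x. transpose (q x)) \<in> poly_space k T UNIV" if "q \<in> poly_space k T UNIV" for q :: "'d tensor_field"
    by (rule poly_space_linear_image[OF lin subset_UNIV that])
  have "(\<lambda>x. transpose (?p x)) = ?p"
  proof (rule E.L2_proj_characterization[OF int, THEN iffD2], assumption, intro conjI ballI)
    show "(\<lambda>x. transpose (?p x)) \<in> poly_space k T UNIV"
      by (rule tr[OF p])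
    fix q :: "'d tensor_field" assume q: "q \<in> poly_space k T UNIV"
    have "(LINT x|vol. transpose (?p x) \<bullet> q x) = (LINT x|vol. ?p x \<bullet> transpose (q x))"
      by (simp only: transpose_inner)
    also have "\<dots> = (LINT x|vol. s x \<bullet> transpose (q x))"
      by (rule bspec[OF spec(2) tr[OF q]])
    also have "\<dots> = (LINT x|vol. s x \<bullet> q x)"
      using sym by (intro Bochner_Integration.integral_cong) (auto simp: sym_matrix_inner_transpose)
    finally show "(LINT x|vol. transpose (?p x) \<bullet> q x) = (LINT x|vol. s x \<bullet> q x)" .
  qed
  then have "transpose (?p x) = ?p x" for x
    by (rule fun_cong)
  \<comment> \<open>Membership asks for symmetric coefficients, not only symmetric values; writing
    the projection as its own symmetrization provides them.\<close>
  then have "(\<lambda>x. (1/2) *\<^sub>R (?p x + transpose (?p x))) = ?p"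
    by (intro ext symmetrize_id) (simp add: sym_matrices_def)
  moreover have "(\<lambda>x. (1/2) *\<^sub>R (?p x + transpose (?p x))) \<in> poly_space k T sym_matrices"
    by (rule poly_space_linear_image[OF symmetrize_linear _ p]) (use symmetrize_sym in blast)
  ultimately show ?thesis
    by simp
qed

text \<open>The projection may replace \<open>s\<close> against both gradients because they are
  polynomials of degree at most \<open>k\<close> on \<open>T\<close>, and, being such a polynomial
  itself, it can be inserted as test tensor in the definition of \<open>grad_rec\<close>. The second
  claim makes the traction admissible as a face unknown.\<close>

lemma local_virtual_work:
  fixes \<gamma> :: real and s :: "'d tensor_field"
  assumes u: "u \<in> local_space" and v: "v \<in> local_space"
    and s: "integrable vol s" and sym: "\<And>x. x \<in> T \<Longrightarrow> s x \<in> sym_matrices"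
  defines "t \<equiv> \<lambda>F x. - (elem_proj k T s x *v \<nu> F) + bdry_residual k \<gamma> \<F> T u F x"
  shows "(LINT x|vol. s x \<bullet> grad_rec k \<F> T v x) + stab k \<gamma> \<F> T u v =
    (LINT x|vol. s x \<bullet> sym_grad (fst v) x) - (\<Sum>F\<in>faces. LINT x|srf F. t F x \<bullet> (snd v F x - fst v x))"
    and "F \<in> faces \<Longrightarrow> restr F (t F) \<in> poly_space k F UNIV"
proof -
  let ?p = "elem_proj k T s"
  have p: "?p \<in> poly_space k T sym_matrices"
    by (rule elem_proj_sym[OF s sym])
  have int_s: "integrable vol (\<lambda>x. s x \<bullet> q x)" if "q \<in> poly_space k T UNIV" for q :: "'d tensor_field"
    by (rule E.integrable_inner_rep[OF s E.poly_rep[OF that]])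
  have proj: "(LINT x|vol. ?p x \<bullet> q x) = (LINT x|vol. s x \<bullet> q x)" if "q \<in> poly_space k T sym_matrices" for q
  proof -
    have "q \<in> poly_space k T UNIV"
      using that poly_space_mono[OF subset_UNIV] by blast
    then show ?thesis
      using E.L2_proj_spec[OF int_s] by blast
  qed
  note v1 = local_spaceD(1)[OF v] and v2 = local_spaceD(2)[OF v]
  note G = grad_rec_spec[OF v]
  have "(LINT x|vol. s x \<bullet> grad_rec k \<F> T v x) = (LINT x|vol. ?p x \<bullet> grad_rec k \<F> T v x)"
    using proj G by simp
  also have "\<dots> = grad_form v ?p"
    unfolding inner_commute[of "elem_proj k T s _"] using G p by blast
  also have "\<dots> = (LINT x|vol. ?p x \<bullet> sym_grad (fst v) x) - (\<Sum>F\<in>faces. LINT x|srf F. fst v x \<bullet> (?p x *v \<nu> F)) +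
      (\<Sum>F\<in>faces. LINT x|srf F. snd v F x \<bullet> (?p x *v \<nu> F))"
    unfolding green[OF p v1] grad_form_def by simp
  also have "(LINT x|vol. ?p x \<bullet> sym_grad (fst v) x) = (LINT x|vol. s x \<bullet> sym_grad (fst v) x)"
  proof -
    obtain q where q: "q \<in> poly_space k T sym_matrices" "\<forall>x\<in>T. q x = sym_grad (fst v) x"
      by (rule sym_grad_poly_space[OF open_T v1])
    have "(LINT x|vol. g x \<bullet> q x) = (LINT x|vol. g x \<bullet> sym_grad (fst v) x)" for g
      using q(2) by (intro Bochner_Integration.integral_cong) auto
    then show ?thesis
      using proj[OF q(1)] by metis
  qed
  finally have 1: "(LINT x|vol. s x \<bullet> grad_rec k \<F> T v x) = (LINT x|vol. s x \<bullet> sym_grad (fst v) x) -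
    (\<Sum>F\<in>faces. LINT x|srf F. fst v x \<bullet> (?p x *v \<nu> F)) + (\<Sum>F\<in>faces. LINT x|srf F. snd v F x \<bullet> (?p x *v \<nu> F))" .
  have R: "bdry_residual k \<gamma> \<F> T u F \<in> poly_space k F UNIV" if "F \<in> faces" for F
    using bdry_residual_spec(1)[OF u] that by (auto simp: bdry_space_def)
  have 2: "(LINT x|srf F. t F x \<bullet> (snd v F x - fst v x)) =
      (LINT x|srf F. fst v x \<bullet> (?p x *v \<nu> F)) - (LINT x|srf F. snd v F x \<bullet> (?p x *v \<nu> F)) +
      (LINT x|srf F. bdry_residual k \<gamma> \<F> T u F x \<bullet> (snd v F x - fst v x))" if F: "F \<in> faces" for F
  proof -
    note pn = trace_normal_rep[OF F p] and vF = face_rep[OF F v2[OF F]] and vT = trace_rep[OF F v1]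
    have int: "integrable (srf F) (\<lambda>x. fst v x \<bullet> (?p x *v \<nu> F))" "integrable (srf F) (\<lambda>x. snd v F x \<bullet> (?p x *v \<nu> F))"
      "integrable (srf F) (\<lambda>x. bdry_residual k \<gamma> \<F> T u F x \<bullet> (snd v F x - fst v x))"
      by (intro face_int[OF F] continuous_rep_inner continuous_rep_diff pn vF vT face_rep[OF F R[OF F]])+
    have "(LINT x|srf F. t F x \<bullet> (snd v F x - fst v x)) =
      (LINT x|srf F. fst v x \<bullet> (?p x *v \<nu> F) - snd v F x \<bullet> (?p x *v \<nu> F) +
        bdry_residual k \<gamma> \<F> T u F x \<bullet> (snd v F x - fst v x))"
      unfolding t_def inner_add_left inner_minus_left inner_commute[of "?p _ *v \<nu> F"]
      by (rule Bochner_Integration.integral_cong) (simp_all add: inner_diff_left)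
    then show ?thesis
      using int by simp
  qed
  have "(\<Sum>F\<in>faces. LINT x|srf F. t F x \<bullet> (snd v F x - fst v x)) =
      (\<Sum>F\<in>faces. LINT x|srf F. fst v x \<bullet> (?p x *v \<nu> F)) - (\<Sum>F\<in>faces. LINT x|srf F. snd v F x \<bullet> (?p x *v \<nu> F)) +
      (\<Sum>F\<in>faces. LINT x|srf F. bdry_residual k \<gamma> \<F> T u F x \<bullet> (snd v F x - fst v x))"
    unfolding sum_subtractf[symmetric] sum.distrib[symmetric] by (intro sum.cong refl 2)
  then show "(LINT x|vol. s x \<bullet> grad_rec k \<F> T v x) + stab k \<gamma> \<F> T u v =
    (LINT x|vol. s x \<bullet> sym_grad (fst v) x) - (\<Sum>F\<in>faces. LINT x|srf F. t F x \<bullet> (snd v F x - fst v x))"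
    unfolding 1 stab_eq_residual[OF u v] by simp
  assume F: "F \<in> faces"
  have lin: "linear (\<lambda>A :: real^'d^'d. (-1) *\<^sub>R (A *v \<nu> F))"
    by (auto intro!: linearI simp: matrix_vector_mult_add_rdistrib scaleR_matrix_vector_assoc[symmetric])
  have "(\<lambda>x. (-1) *\<^sub>R (?p x *v \<nu> F)) \<in> poly_space k T UNIV"
    by (rule poly_space_linear_image[OF lin subset_UNIV p])
  then have "(\<lambda>x. restr F (\<lambda>x. (-1) *\<^sub>R (?p x *v \<nu> F)) x + bdry_residual k \<gamma> \<F> T u F x) \<in> poly_space k F UNIV"
    by (intro poly_space_add subspace_UNIV trace_poly[OF F] R[OF F])
  moreover have "(\<lambda>x. restr F (\<lambda>x. (-1) *\<^sub>R (?p x *v \<nu> F)) x + bdry_residual k \<gamma> \<F> T u F x) = restr F (t F)"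
    using poly_space_outside[OF R[OF F]] closed_faces[OF F] by (auto simp: restr_def t_def)
  ultimately show "restr F (t F) \<in> poly_space k F UNIV"
    by simp
qed

end

section \<open>Piecewise functions\<close>

lemma broken_in:
  assumes "finite \<T>" "T \<in> \<T>" "x \<in> T" "\<And>T'. T' \<in> \<T> \<Longrightarrow> T' \<noteq> T \<Longrightarrow> x \<notin> T'"
  shows "broken \<T> g x = g T x"
proof -
  have "broken \<T> g x = restr T (g T) x + (\<Sum>T'\<in>\<T> - {T}. restr T' (g T') x)"
    unfolding broken_def using assms(1,2) by (rule sum.remove)
  also have "(\<Sum>T'\<in>\<T> - {T}. restr T' (g T') x) = 0"
    using assms(4) by (intro sum.neutral) (auto simp: restr_def)
  finally show ?thesis
    using assms(3) by (simp add: restr_def)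
qed

lemma broken_out: "(\<And>T. T \<in> \<T> \<Longrightarrow> x \<notin> T) \<Longrightarrow> broken \<T> g x = 0"
  unfolding broken_def by (intro sum.neutral) (auto simp: restr_def)

context polyhedral_mesh_on
begin

lemma broken_element: "T \<in> \<T> \<Longrightarrow> x \<in> T \<Longrightarrow> broken \<T> g x = g T x"
  using elements_disjoint by (intro broken_in finite_T) blast+

text \<open>\<open>broken\<close> is zero on the skeleton, so the two sides agree already as
  integrands, point by point.\<close>

lemma integral_broken:
  fixes g :: "'a set \<Rightarrow> 'a \<Rightarrow> real"
  assumes int: "\<And>T. T \<in> \<T> \<Longrightarrow> integrable (lebesgue_on T) (g T)"
  shows "(LINT x|lebesgue_on \<Omega>. broken \<T> g x) = (\<Sum>T\<in>\<T>. LINT x|lebesgue_on T. g T x)"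
proof -
  have sets: "\<Omega> \<inter> space lebesgue \<in> sets lebesgue" "\<And>T. T \<in> \<T> \<Longrightarrow> T \<inter> space lebesgue \<in> sets lebesgue"
    using open_\<Omega> element(1) by auto
  have "(LINT x|lebesgue_on \<Omega>. broken \<T> g x) = (LINT x|lebesgue. indicator \<Omega> x *\<^sub>R broken \<T> g x)"
    by (rule integral_restrict_space[OF sets(1)])
  also have "\<dots> = (LINT x|lebesgue. (\<Sum>T\<in>\<T>. indicator T x *\<^sub>R g T x))"
  proof (rule Bochner_Integration.integral_cong)
    fix x
    show "indicator \<Omega> x *\<^sub>R broken \<T> g x = (\<Sum>T\<in>\<T>. indicator T x *\<^sub>R g T x)"
      unfolding broken_def scaleR_sum_right
      by (intro sum.cong refl) (use element(4) in \<open>auto simp: restr_def split: split_indicator\<close>)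
  qed simp
  also have "\<dots> = (\<Sum>T\<in>\<T>. LINT x|lebesgue. indicator T x *\<^sub>R g T x)"
    using int integrable_restrict_space[OF sets(2)] by (intro Bochner_Integration.integral_sum) blast
  also have "\<dots> = (\<Sum>T\<in>\<T>. LINT x|lebesgue_on T. g T x)"
    by (intro sum.cong refl integral_restrict_space[OF sets(2), symmetric])
  finally show ?thesis .
qed

end

locale discrete_problem = polyhedral_mesh_on \<Omega> \<T> \<F>
  for \<Omega> :: "(real^'d::finite) set" and \<T> \<F> +
  fixes f :: "'d vec_field" and \<gamma> :: real and k :: nat
    and \<sigma> :: "real^'d \<Rightarrow> real^'d^'d \<Rightarrow> real^'d^'d" and u :: "'d global_unknown"
  assumes load: "square_integrable (lebesgue_on \<Omega>) f"
    and sigma_sym: "\<And>x \<tau>. x \<in> \<Omega> \<Longrightarrow> \<tau> \<in> sym_matrices \<Longrightarrow> \<sigma> x \<tau> \<in> sym_matrices"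
    and sigma: "assumption_S \<Omega> \<sigma>"
    and unknown: "u \<in> global_space_0 \<Omega> k \<T> \<F>"
    and equation: "\<And>v. v \<in> global_space_0 \<Omega> k \<T> \<F> \<Longrightarrow>
      (LINT x|lebesgue_on \<Omega>. \<sigma> x (global_grad_rec k \<T> \<F> u x) \<bullet> global_grad_rec k \<T> \<F> v x)
        + global_stab k \<gamma> \<T> \<F> u v
      = (LINT x|lebesgue_on \<Omega>. f x \<bullet> broken \<T> (fst v) x)"
begin

abbreviation "loc \<equiv> localize \<F>"
abbreviation "stress T x \<equiv> \<sigma> x (grad_rec k \<F> T (loc T u) x)"
abbreviation "trac T F \<equiv> traction k \<gamma> \<sigma> \<F> T F (loc T u)"

lemma hho_element_mesh: "T \<in> \<T> \<Longrightarrow> hho_element \<Omega> \<T> \<F> T"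
  by (simp add: hho_element_def hho_element_axioms_def polyhedral_mesh_on_axioms)

lemma loc_local_space:
  assumes T: "T \<in> \<T>" and v: "v \<in> global_space_0 \<Omega> k \<T> \<F>"
  shows "loc T v \<in> hho_element.local_space \<F> T k"
proof -
  interpret hho_element \<Omega> \<T> \<F> T k
    by (rule hho_element_mesh[OF T])
  show ?thesis
    using v T mesh_facesD(1)
    by (auto simp: local_space_def localize_def global_space_0_def global_space_def)
qed

lemma stress_facts:
  assumes T: "T \<in> \<T>"
  shows "integrable (lebesgue_on T) (stress T)" "\<And>x. x \<in> T \<Longrightarrow> stress T x \<in> sym_matrices"
proof -
  interpret hho_element \<Omega> \<T> \<F> T k
    by (rule hho_element_mesh[OF T])
  have G: "grad_rec k \<F> T (loc T u) \<in> poly_space k T sym_matrices"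
    using grad_rec_spec[OF loc_local_space[OF T unknown]] by blast
  show "integrable (lebesgue_on T) (stress T)"
    by (rule stress_integrable[OF sigma G])
  show "stress T x \<in> sym_matrices" if "x \<in> T" for x
    using sigma_sym poly_space_values[OF subspace_sym_matrices G] element(4)[OF T] that by blast
qed

text \<open>In this form every element unknown and every face unknown of \<open>v\<close> can be
  varied separately, with explicit coefficients.\<close>

lemma tested_equation:
  assumes v: "v \<in> global_space_0 \<Omega> k \<T> \<F>"
  shows "(\<Sum>T\<in>\<T>. (LINT x|lebesgue_on T. stress T x \<bullet> sym_grad (fst v T) x)
      - (\<Sum>F\<in>mesh_faces \<F> T. LINT x|surface_measure F. trac T F x \<bullet> (snd v F x - fst v T x)))
    = (\<Sum>T\<in>\<T>. LINT x|lebesgue_on T. f x \<bullet> fst v T x)"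
proof -
  have local: "(LINT x|lebesgue_on T. stress T x \<bullet> grad_rec k \<F> T (loc T v) x) + stab k \<gamma> \<F> T (loc T u) (loc T v) =
      (LINT x|lebesgue_on T. stress T x \<bullet> sym_grad (fst v T) x)
      - (\<Sum>F\<in>mesh_faces \<F> T. LINT x|surface_measure F. trac T F x \<bullet> (snd v F x - fst v T x))"
    and int_stress: "integrable (lebesgue_on T) (\<lambda>x. stress T x \<bullet> grad_rec k \<F> T (loc T v) x)"
    and int_load: "integrable (lebesgue_on T) (\<lambda>x. f x \<bullet> fst v T x)"
    if T: "T \<in> \<T>" for T
  proof -
    interpret hho_element \<Omega> \<T> \<F> T k
      by (rule hho_element_mesh[OF T])
    note U = loc_local_space[OF T unknown] and V = loc_local_space[OF T v]
    have G: "grad_rec k \<F> T (loc T v) \<in> poly_space k T sym_matrices"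
      using grad_rec_spec[OF V] by blast
    show "integrable (lebesgue_on T) (\<lambda>x. stress T x \<bullet> grad_rec k \<F> T (loc T v) x)"
      by (rule E.integrable_inner_rep[OF stress_facts(1)[OF T] E.poly_rep[OF G]])
    have "fst v T \<in> poly_space k T UNIV"
      using local_spaceD(1)[OF V] by (simp add: localize_def)
    then show "integrable (lebesgue_on T) (\<lambda>x. f x \<bullet> fst v T x)"
      by (intro E.integrable_inner_rep[OF square_integrable_imp_integrable_on[OF load open_T element(5,4)[OF T] open_\<Omega>]] E.poly_rep)
    have "(LINT x|lebesgue_on T. stress T x \<bullet> grad_rec k \<F> T (loc T v) x) + stab k \<gamma> \<F> T (loc T u) (loc T v) =
      (LINT x|lebesgue_on T. stress T x \<bullet> sym_grad (fst (loc T v)) x)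
      - (\<Sum>F\<in>mesh_faces \<F> T. LINT x|surface_measure F. trac T F x \<bullet> (snd (loc T v) F x - fst (loc T v) x))"
      unfolding traction_def by (rule local_virtual_work(1)[OF U V stress_facts[OF T]])
    also have "(\<Sum>F\<in>mesh_faces \<F> T. LINT x|surface_measure F. trac T F x \<bullet> (snd (loc T v) F x - fst (loc T v) x)) =
      (\<Sum>F\<in>mesh_faces \<F> T. LINT x|surface_measure F. trac T F x \<bullet> (snd v F x - fst v T x))"
      by (intro sum.cong refl) (simp add: localize_def)
    finally show "(LINT x|lebesgue_on T. stress T x \<bullet> grad_rec k \<F> T (loc T v) x) + stab k \<gamma> \<F> T (loc T u) (loc T v) =
      (LINT x|lebesgue_on T. stress T x \<bullet> sym_grad (fst v T) x)
      - (\<Sum>F\<in>mesh_faces \<F> T. LINT x|surface_measure F. trac T F x \<bullet> (snd v F x - fst v T x))"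
      by (simp add: localize_def)
  qed
  have 1: "(LINT x|lebesgue_on \<Omega>. \<sigma> x (global_grad_rec k \<T> \<F> u x) \<bullet> global_grad_rec k \<T> \<F> v x) =
      (\<Sum>T\<in>\<T>. LINT x|lebesgue_on T. stress T x \<bullet> grad_rec k \<F> T (loc T v) x)"
  proof -
    \<comment> \<open>Off the elements \<open>\<sigma>\<close> is evaluated at zero, but the broken
      gradient of \<open>v\<close> vanishes there as well, so both sides are zero.\<close>
    have "\<sigma> x (global_grad_rec k \<T> \<F> u x) \<bullet> global_grad_rec k \<T> \<F> v x =
        broken \<T> (\<lambda>T x. stress T x \<bullet> grad_rec k \<F> T (loc T v) x) x" for x
    proof (cases "\<exists>T\<in>\<T>. x \<in> T")
      case True
      then obtain T where "T \<in> \<T>" "x \<in> T" by blast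
      then show ?thesis
        by (simp add: global_grad_rec_def broken_element)
    next
      case False
      then have "\<And>T. T \<in> \<T> \<Longrightarrow> x \<notin> T" by blast
      then show ?thesis
        by (simp add: global_grad_rec_def broken_out)
    qed
    then show ?thesis
      using integral_broken[OF int_stress] by simp
  qed
  have 2: "(LINT x|lebesgue_on \<Omega>. f x \<bullet> broken \<T> (fst v) x) = (\<Sum>T\<in>\<T>. LINT x|lebesgue_on T. f x \<bullet> fst v T x)"
  proof -
    have "f x \<bullet> broken \<T> (fst v) x = broken \<T> (\<lambda>T x. f x \<bullet> fst v T x) x" for x
      by (simp add: broken_def inner_sum_right restr_def if_distrib[of "\<lambda>y. _ \<bullet> y"] cong: if_cong)
    then show ?thesis
      using integral_broken[OF int_load] by simp
  qed
  have "(\<Sum>T\<in>\<T>. LINT x|lebesgue_on T. stress T x \<bullet> grad_rec k \<F> T (loc T v) x) +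
      (\<Sum>T\<in>\<T>. stab k \<gamma> \<F> T (loc T u) (loc T v)) = (\<Sum>T\<in>\<T>. LINT x|lebesgue_on T. f x \<bullet> fst v T x)"
    using equation[OF v] unfolding 1 2 global_stab_def .
  moreover have "(\<Sum>T\<in>\<T>. LINT x|lebesgue_on T. stress T x \<bullet> grad_rec k \<F> T (loc T v) x) +
      (\<Sum>T\<in>\<T>. stab k \<gamma> \<F> T (loc T u) (loc T v)) =
      (\<Sum>T\<in>\<T>. (LINT x|lebesgue_on T. stress T x \<bullet> sym_grad (fst v T) x)
      - (\<Sum>F\<in>mesh_faces \<F> T. LINT x|surface_measure F. trac T F x \<bullet> (snd v F x - fst v T x)))"
    unfolding sum.distrib[symmetric] by (intro sum.cong refl local)
  ultimately show ?thesis
    by simp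
qed

lemma zero_poly: "(\<lambda>x. 0) \<in> poly_space k X (UNIV :: (real^'d) set)"
  by (rule poly_space_0[OF subspace_UNIV])

theorem virtual_work:
  assumes T: "T \<in> \<T>" and w: "w \<in> poly_space k T UNIV"
  shows "(LINT x|lebesgue_on T. stress T x \<bullet> sym_grad w x)
      + (\<Sum>F\<in>mesh_faces \<F> T. LINT x|surface_measure F. trac T F x \<bullet> w x)
    = (LINT x|lebesgue_on T. f x \<bullet> w x)"
proof -
  define v where "v = ((\<lambda>T'\<in>\<T>. if T' = T then w else (\<lambda>x. 0)), (\<lambda>F\<in>\<F>. (\<lambda>x. 0)) :: (real^'d) set \<Rightarrow> 'd vec_field)"
  have v: "v \<in> global_space_0 \<Omega> k \<T> \<F>"
    using w zero_poly by (auto simp: v_def global_space_0_def global_space_def)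
  have fst_v: "fst v T' = (if T' = T then w else (\<lambda>x. 0))" if "T' \<in> \<T>" for T'
    using that by (simp add: v_def)
  have snd_v: "snd v F = (\<lambda>x. 0)" if "F \<in> mesh_faces \<F> T'" for F T'
    using mesh_facesD(1)[OF that] by (simp add: v_def)
  let ?L = "\<lambda>T'. (LINT x|lebesgue_on T'. stress T' x \<bullet> sym_grad (fst v T') x)
      - (\<Sum>F\<in>mesh_faces \<F> T'. LINT x|surface_measure F. trac T' F x \<bullet> (snd v F x - fst v T' x))"
  have zero: "?L T' = 0" "(LINT x|lebesgue_on T'. f x \<bullet> fst v T' x) = 0" if "T' \<in> \<T> - {T}" for T'
  proof -
    have "fst v T' = (\<lambda>x. 0)"
      using that fst_v by simp
    moreover have "(\<Sum>F\<in>mesh_faces \<F> T'. LINT x|surface_measure F. trac T' F x \<bullet> (snd v F x - 0)) = 0"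
      by (intro sum.neutral) (simp add: snd_v)
    ultimately show "?L T' = 0" "(LINT x|lebesgue_on T'. f x \<bullet> fst v T' x) = 0"
      by (simp_all add: sym_grad_zero)
  qed
  have "(\<Sum>T'\<in>\<T>. ?L T') = ?L T"
    using zero(1) finite_T T by (subst sum.remove[of _ T]) (simp_all del: diff_eq_eq)
  moreover have "(\<Sum>T'\<in>\<T>. LINT x|lebesgue_on T'. f x \<bullet> fst v T' x) = (LINT x|lebesgue_on T. f x \<bullet> fst v T x)"
    using zero(2) finite_T T by (subst sum.remove[of _ T]) simp_all
  ultimately have "?L T = (LINT x|lebesgue_on T. f x \<bullet> fst v T x)"
    using tested_equation[OF v] by simp
  \<comment> \<open>With zero face unknowns the difference \<open>v\<^sub>F - v\<^sub>T\<close> is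
    \<open>- w\<close>, which gives the traction term its sign.\<close>
  moreover have "(\<Sum>F\<in>mesh_faces \<F> T. LINT x|surface_measure F. trac T F x \<bullet> (snd v F x - fst v T x)) =
      - (\<Sum>F\<in>mesh_faces \<F> T. LINT x|surface_measure F. trac T F x \<bullet> w x)"
    unfolding sum_negf[symmetric] by (intro sum.cong refl) (simp add: snd_v fst_v[OF T])
  ultimately show ?thesis
    using fst_v[OF T] by simp
qed

theorem action_reaction:
  assumes T: "T1 \<in> \<T>" "T2 \<in> \<T>" "T1 \<noteq> T2" and F: "F \<in> mesh_faces \<F> T1" "F \<in> mesh_faces \<F> T2" and x: "x \<in> F"
  shows "trac T1 F x + trac T2 F x = 0"
proof -
  interpret FC: cell "surface_measure F" F
    using F(1) by (intro cell_face face_mesh mesh_facesD)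
  have poly: "restr F (trac T' F) \<in> poly_space k F UNIV" if T': "T' \<in> \<T>" "F \<in> mesh_faces \<F> T'" for T'
  proof -
    interpret hho_element \<Omega> \<T> \<F> T' k
      by (rule hho_element_mesh[OF T'(1)])
    show ?thesis
      unfolding traction_def[abs_def]
      by (rule local_virtual_work(2)[OF loc_local_space[OF T'(1) unknown] loc_local_space[OF T'(1) unknown] stress_facts[OF T'(1)] T'(2)])
  qed
  note p1 = poly[OF T(1) F(1)] and p2 = poly[OF T(2) F(2)]
  \<comment> \<open>The sum of the tractions is tested against itself; cut off to \<open>F\<close>
    it is a polynomial and thus admissible as a face unknown.\<close>
  define q where "q = (\<lambda>x. restr F (trac T1 F) x + restr F (trac T2 F) x)"
  have q: "q \<in> poly_space k F UNIV"
    unfolding q_def by (intro poly_space_add subspace_UNIV p1 p2)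
  define v where "v = ((\<lambda>T'\<in>\<T>. (\<lambda>x. 0)) :: (real^'d) set \<Rightarrow> 'd vec_field, (\<lambda>F'\<in>\<F>. if F' = F then q else (\<lambda>x. 0)))"
  \<comment> \<open>Membership requires that \<open>F\<close> is not a boundary face, where the
    unknown would have to vanish.\<close>
  have v: "v \<in> global_space_0 \<Omega> k \<T> \<F>"
    using q zero_poly interface_faces(1)[OF T F] by (auto simp: v_def global_space_0_def global_space_def)
  have fst_v: "fst v T' = (\<lambda>x. 0)" if "T' \<in> \<T>" for T'
    using that by (simp add: v_def)
  have snd_v: "snd v F' = (if F' = F then q else (\<lambda>x. 0))" if "F' \<in> mesh_faces \<F> T'" for F' T'
    using mesh_facesD(1)[OF that] by (simp add: v_def)
  let ?B = "\<lambda>T'. LINT x|surface_measure F. trac T' F x \<bullet> q x"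
  let ?L = "\<lambda>T'. (LINT x|lebesgue_on T'. stress T' x \<bullet> sym_grad (fst v T') x)
      - (\<Sum>F'\<in>mesh_faces \<F> T'. LINT x|surface_measure F'. trac T' F' x \<bullet> (snd v F' x - fst v T' x))"
  have L: "?L T' = (if T' = T1 \<or> T' = T2 then - ?B T' else 0)" if T': "T' \<in> \<T>" for T'
  proof -
    have "(\<Sum>F'\<in>mesh_faces \<F> T'. LINT x|surface_measure F'. trac T' F' x \<bullet> (snd v F' x - fst v T' x)) =
        (\<Sum>F'\<in>mesh_faces \<F> T'. if F' = F then ?B T' else 0)"
      by (intro sum.cong refl) (auto simp: snd_v fst_v[OF T'])
    also have "\<dots> = (if F \<in> mesh_faces \<F> T' then ?B T' else 0)"
      using finite_mesh_faces by simp
    also have "F \<in> mesh_faces \<F> T' \<longleftrightarrow> T' = T1 \<or> T' = T2"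
      using interface_faces(2)[OF T F T'] F by blast
    finally show ?thesis
      by (simp add: fst_v[OF T'] sym_grad_zero)
  qed
  have "(\<Sum>T'\<in>\<T>. ?L T') = (\<Sum>T'\<in>{T1, T2}. - ?B T')"
  proof -
    have "(\<Sum>T'\<in>\<T>. ?L T') = (\<Sum>T'\<in>\<T>. if T' = T1 \<or> T' = T2 then - ?B T' else 0)"
      by (intro sum.cong refl L)
    also have "\<dots> = (\<Sum>T'\<in>{T1, T2}. - ?B T')"
      using finite_T T by (intro sum.mono_neutral_cong_right) auto
    finally show ?thesis .
  qed
  moreover have "(\<Sum>T'\<in>\<T>. LINT x|lebesgue_on T'. f x \<bullet> fst v T' x) = 0"
    by (intro sum.neutral) (simp add: fst_v)
  ultimately have "?B T1 + ?B T2 = 0"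
    using tested_equation[OF v] T(3) by simp
  moreover have B: "?B T' = (LINT x|surface_measure F. restr F (trac T' F) x \<bullet> q x)" for T'
    by (rule Bochner_Integration.integral_cong) (simp_all add: restr_def)
  moreover have "integrable (surface_measure F) (\<lambda>x. restr F (trac T1 F) x \<bullet> q x)"
    "integrable (surface_measure F) (\<lambda>x. restr F (trac T2 F) x \<bullet> q x)"
    by (intro FC.integrable_rep continuous_rep_inner FC.poly_rep[OF p1] FC.poly_rep[OF p2] FC.poly_rep[OF q])+
  ultimately have "(LINT x|surface_measure F. q x \<bullet> q x) = 0"
    unfolding q_def[THEN fun_cong] by (simp add: inner_add_left)
  then have "q = (\<lambda>x. 0)"
    by (rule FC.poly_inner_self_eq_0[OF q])
  then have "q x = 0"
    by (rule fun_cong)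
  then show ?thesis
    using x by (simp add: q_def restr_def)
qed

end

theorem lemma17:
  fixes \<Omega> :: "(real^'d::finite) set"
    and f :: "real^'d \<Rightarrow> real^'d"
    and \<gamma> :: real
    and k :: nat
    and \<sigma> :: "real^'d \<Rightarrow> real^'d^'d \<Rightarrow> real^'d^'d"
    and \<H> :: "real set"
    and \<T>_seq \<F>_seq :: "real \<Rightarrow> (real^'d) set set"
    and h :: real
    and \<T> \<F> :: "(real^'d) set set"
    and u :: "'d global_unknown"
  assumes dim: "CARD('d) \<in> {2, 3}"
    and domain: "polyhedral_lipschitz_domain \<Omega>"
    and load: "square_integrable (lebesgue_on \<Omega>) f"
    and gamma: "\<gamma> > 0"
    and degree: "k \<ge> 1"
    and sigma_sym: "\<forall>x\<in>\<Omega>. \<forall>\<tau>\<in>sym_matrices. \<sigma> x \<tau> \<in> sym_matrices"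
    and sigma: "assumption_S \<Omega> \<sigma>"
    and mesh_seq: "regular_mesh_sequence \<Omega> \<H> \<T>_seq \<F>_seq"
    and mesh: "h \<in> \<H>" "\<T> = \<T>_seq h" "\<F> = \<F>_seq h"
    and unknown: "u \<in> global_space_0 \<Omega> k \<T> \<F>"
    and discrete_problem:
      "\<forall>v\<in>global_space_0 \<Omega> k \<T> \<F>.
         (LINT x|lebesgue_on \<Omega>. \<sigma> x (global_grad_rec k \<T> \<F> u x) \<bullet> global_grad_rec k \<T> \<F> v x)
           + global_stab k \<gamma> \<T> \<F> u v
         = (LINT x|lebesgue_on \<Omega>. f x \<bullet> broken \<T> (fst v) x)"
  shows "(\<forall>T\<in>\<T>. \<forall>v\<in>poly_space k T UNIV.
            (LINT x|lebesgue_on T. \<sigma> x (grad_rec k \<F> T (localize \<F> T u) x) \<bullet> sym_grad v x)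
              + (\<Sum>F\<in>mesh_faces \<F> T. LINT x|surface_measure F.
                   traction k \<gamma> \<sigma> \<F> T F (localize \<F> T u) x \<bullet> v x)
            = (LINT x|lebesgue_on T. f x \<bullet> v x)) \<and>
         (\<forall>T1\<in>\<T>. \<forall>T2\<in>\<T>. \<forall>F\<in>mesh_faces \<F> T1 \<inter> mesh_faces \<F> T2. T1 \<noteq> T2 \<longrightarrow>
            (\<forall>x\<in>F. traction k \<gamma> \<sigma> \<F> T1 F (localize \<F> T1 u) x
                     + traction k \<gamma> \<sigma> \<F> T2 F (localize \<F> T2 u) x = 0))"
proof -
  have "polyhedral_mesh \<Omega> \<T> \<F>"
    using mesh_seq mesh by (auto simp: regular_mesh_sequence_def)
  then interpret discrete_problem \<Omega> \<T> \<F> f \<gamma> k \<sigma> u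
    using domain load sigma_sym sigma unknown discrete_problem by unfold_locales auto
  show ?thesis
    using virtual_work action_reaction by blast
qed

end
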